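(* Let $\Sigma$ be a many-typed signature, $\Gamma$ a context, $\tau$ a type, and $\Gamma\vdash t:\tau$ a term. Then $\Gamma\vdash\ \downarrow^{\mathrm{nf}}_\tau(\mathrm{nf}_{\Gamma,\tau}(t))=t:\tau$.
   Context: A many-typed signature $\Sigma=(S,O)$ consists of a set $S$ of atomic types and operation symbols $\vartheta$ with arities $O(\vartheta)=(\Delta,\tau)$ ($\Delta$ a list of types, $\tau$ a type). Simple types are generated from $S$ by $\times,\to$; contexts are finite lists of types. Syntax: terms $\Gamma\vdash t:\tau$ and substitutions $\Gamma\vdash\delta:\Delta$ generated by the last variable $\mathrm{v}$, operations $\Delta\vdash\vartheta:\tau$, explicit substitution $t[\delta]$, $\lambda$, application, pairs, projections $t.1,t.2$, and substitutions $\mathrm{id}$, weakening $\mathrm{p}$, extension $(\delta,t)$, composition; quotiented by the congruence generated by $\beta\eta$ for functions and pairs, category laws, $\mathrm{p}\circ(\delta,t)=\delta$, $(\xi,t)\circ\delta=(\xi\circ\delta,t[\delta])$, $\mathrm{v}[(\delta,t)]=t$, $\mathrm{v}[\mathrm{id}]=\mathrm{v}$, and substitution commuting with term formers; "$\Gamma\vdash s=t:\tau$" denotes this definitional equality. $\mathrm{Cl}(\Sigma)$: contexts and equivalence classes of substitutions (the free $\lambda$-theory on $\Sigma$). $\mathrm{Ren}(\Sigma)$: contexts and type-preserving variable renamings, $i:\mathrm{Ren}(\Sigma)\to\mathrm{Cl}(\Sigma)$ the inclusion; $\mathrm{TM}(\Delta)=\mathrm{Hom}_{\mathrm{Cl}(\Sigma)}(i(-),\Delta)$,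 a presheaf on $\mathrm{Ren}(\Sigma)$. Neutrals: variables, $\vartheta[\delta]$ ($\delta$ normal substitution), $t(s)$ ($t$ neutral, $s$ normal), $t.1,t.2$; normals: neutrals at atomic type, $\lambda^\sigma.t$, pairs; substitutions are tuples. $\mathrm{NE}_\tau,\mathrm{NF}_\tau$ (and $\mathrm{NE}_\Gamma,\mathrm{NF}_\Gamma$ for contexts) are the presheaves of these unquotiented syntactic forms; $\downarrow^{\mathrm{ne}},\downarrow^{\mathrm{nf}}$ map them to their equivalence classes in $\mathrm{TM}$. $\mathrm{id}_\Gamma\in\mathrm{NE}_\Gamma(\Gamma)$ is the tuple of all variables of $\Gamma$. Presheaves $P_\tau$, maps $\mathrm{reflect}_\tau:\mathrm{NE}_\tau\to P_\tau$, $\mathrm{reify}_\tau:P_\tau\to\mathrm{NF}_\tau$: atomic $P_\tau=\mathrm{NF}_\tau$ (reflect = inclusion, reify = identity); $P_{\sigma\times\tau}=P_\sigma\times P_\tau$ componentwise; $P_{\sigma\to\tau}$ the pullback of $F\mapsto\lambda v.\downarrow^{\mathrm{nf}}\mathrm{reify}_\tau(Fv)$ and $t\mapsto\lambda v.t(\downarrow^{\mathrm{nf}}\mathrm{reify}_\sigma v)$ into $\mathrm{TM}(\tau)^{P_\sigma}$, elements pairs $(t,F)$, $\mathrm{reflect}(t)=(\downarrow^{\mathrm{ne}}t,\lambda v.\mathrm{reflect}_\tau(t(\mathrm{reify}_\sigma v)))$, $\mathrm{reify}(t,F)=\lambda^\sigma.\mathrm{reify}_\tau(F(\mathrm{reflect}_\sigma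 x))$, $x$ the fresh variable; contexts: $P_{[\,]}=1$, $P_{\Gamma,\tau}=P_\Gamma\times P_\tau$ componentwise. Gluing category $\mathrm{Gl}(\Sigma)=\mathrm{id}\downarrow\mathrm{TM}$: objects $(\mathcal D,\Delta,q:\mathcal D\to\mathrm{TM}(\Delta))$, morphisms pairs $(d,\delta)$ with $q_\Delta\circ d=\mathrm{TM}(\delta)\circ q_\Gamma$. It is cartesian closed with $[\![\tau]\!]=(P_\tau,\tau,\downarrow^{\mathrm{nf}}\circ\mathrm{reify}_\tau)$ (similarly for contexts) realizing products and exponentials; $[\![-]\!]:\mathrm{Cl}(\Sigma)\to\mathrm{Gl}(\Sigma)$ is the induced structure-preserving interpretation functor (each operation $\vartheta$ interpreted by a $\mathrm{Gl}$-morphism whose $\mathrm{Cl}$-component is $\vartheta$). The normalization function $\mathrm{nf}_{\Gamma,\Delta}:\mathrm{Hom}_{\mathrm{Cl}(\Sigma)}(\Gamma,\Delta)\to\mathrm{NF}_\Delta(\Gamma)$ is: given $\delta$, write $[\![\delta]\!]=(d,\delta')$ with $d:P_\Gamma\to P_\Delta$, and set $\mathrm{nf}_{\Gamma,\Delta}(\delta)=(\mathrm{reify}_\Delta)_\Gamma\big(d_\Gamma((\mathrm{reflect}_\Gamma)_\Gamma(\mathrm{id}_\Gamma))\big)$.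
   Formalization: Definitional equality is taken to include the law (p,v)=id, which the listed laws omit though contexts are meant to be products; without it the claim fails for an operation ϑ of non-empty arity, since its normal form is ϑ applied to the tuple of variables. *)

theory Defs
  imports Main
begin

section \<open>Types, contexts, signatures\<close>

datatype 's ty =
    Atom 's
  | Times "'s ty" "'s ty"  (infixr "\<otimes>" 75)
  | Arrow "'s ty" "'s ty"  (infixr "\<rightarrow>" 70)

text \<open>The context \<open>\<Gamma>,\<tau>\<close> is written \<open>\<tau> # \<Gamma>\<close>: the head of the list is the type of the last
  variable. All tuples (substitutions, renamings, environments) are listed in the same order.\<close>

type_synonym 's ctx = "'s ty list"

text \<open>The atomic types are the elements of the type \<open>'s\<close>; the operation symbols are the elements
  of the domain of the partial arity map, which may be empty.\<close>

type_synonym ('s, 'o) signature = "'o \<rightharpoonup> 's ctx \<times> 's ty"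


section \<open>Raw syntax, typing, definitional equality\<close>

text \<open>\<open>TSub t \<delta>\<close> is \<open>t[\<delta>]\<close>, \<open>SWk\<close> is \<open>p\<close>, \<open>SExt \<delta> t\<close> is \<open>(\<delta>,t)\<close> and \<open>SComp \<delta> \<xi>\<close> is \<open>\<delta> \<circ> \<xi>\<close>
  (first \<open>\<xi>\<close>, then \<open>\<delta>\<close>).\<close>

datatype ('s, 'o) tm =
    TVar
  | TOp 'o
  | TSub "('s, 'o) tm" "('s, 'o) sb"
  | TLam "'s ty" "('s, 'o) tm"
  | TApp "('s, 'o) tm" "('s, 'o) tm"
  | TPair "('s, 'o) tm" "('s, 'o) tm"
  | TFst "('s, 'o) tm"
  | TSnd "('s, 'o) tm"
and ('s, 'o) sb =
    SId
  | SWk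
  | SExt "('s, 'o) sb" "('s, 'o) tm"
  | SComp "('s, 'o) sb" "('s, 'o) sb"

inductive
  tm_ty :: "('s, 'o) signature \<Rightarrow> 's ctx \<Rightarrow> ('s, 'o) tm \<Rightarrow> 's ty \<Rightarrow> bool"
    ("_ \<bar> _ \<turnstile> _ \<Colon> _" [51, 51, 51, 51] 50) and
  sb_ty :: "('s, 'o) signature \<Rightarrow> 's ctx \<Rightarrow> ('s, 'o) sb \<Rightarrow> 's ctx \<Rightarrow> bool"
    ("_ \<bar> _ \<turnstile>\<^sub>s _ \<Colon> _" [51, 51, 51, 51] 50)
  for Sg :: "('s, 'o) signature"
where
  ty_var: "Sg \<bar> \<tau> # \<Gamma> \<turnstile> TVar \<Colon> \<tau>"
| ty_op: "Sg \<theta> = Some (\<Delta>, \<tau>) \<Longrightarrow> Sg \<bar> \<Delta> \<turnstile> TOp \<theta> \<Colon> \<tau>"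
| ty_sub: "Sg \<bar> \<Delta> \<turnstile> t \<Colon> \<tau> \<Longrightarrow> Sg \<bar> \<Gamma> \<turnstile>\<^sub>s \<delta> \<Colon> \<Delta> \<Longrightarrow> Sg \<bar> \<Gamma> \<turnstile> TSub t \<delta> \<Colon> \<tau>"
| ty_lam: "Sg \<bar> \<sigma> # \<Gamma> \<turnstile> t \<Colon> \<tau> \<Longrightarrow> Sg \<bar> \<Gamma> \<turnstile> TLam \<sigma> t \<Colon> \<sigma> \<rightarrow> \<tau>"
| ty_app: "Sg \<bar> \<Gamma> \<turnstile> t \<Colon> \<sigma> \<rightarrow> \<tau> \<Longrightarrow> Sg \<bar> \<Gamma> \<turnstile> s \<Colon> \<sigma> \<Longrightarrow> Sg \<bar> \<Gamma> \<turnstile> TApp t s \<Colon> \<tau>"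
| ty_pair: "Sg \<bar> \<Gamma> \<turnstile> s \<Colon> \<sigma> \<Longrightarrow> Sg \<bar> \<Gamma> \<turnstile> t \<Colon> \<tau> \<Longrightarrow> Sg \<bar> \<Gamma> \<turnstile> TPair s t \<Colon> \<sigma> \<otimes> \<tau>"
| ty_fst: "Sg \<bar> \<Gamma> \<turnstile> t \<Colon> \<sigma> \<otimes> \<tau> \<Longrightarrow> Sg \<bar> \<Gamma> \<turnstile> TFst t \<Colon> \<sigma>"
| ty_snd: "Sg \<bar> \<Gamma> \<turnstile> t \<Colon> \<sigma> \<otimes> \<tau> \<Longrightarrow> Sg \<bar> \<Gamma> \<turnstile> TSnd t \<Colon> \<tau>"
| ty_id: "Sg \<bar> \<Gamma> \<turnstile>\<^sub>s SId \<Colon> \<Gamma>"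
| ty_wk: "Sg \<bar> \<tau> # \<Gamma> \<turnstile>\<^sub>s SWk \<Colon> \<Gamma>"
| ty_ext: "Sg \<bar> \<Gamma> \<turnstile>\<^sub>s \<delta> \<Colon> \<Delta> \<Longrightarrow> Sg \<bar> \<Gamma> \<turnstile> t \<Colon> \<tau> \<Longrightarrow> Sg \<bar> \<Gamma> \<turnstile>\<^sub>s SExt \<delta> t \<Colon> \<tau> # \<Delta>"
| ty_comp: "Sg \<bar> \<Delta> \<turnstile>\<^sub>s \<delta> \<Colon> \<Xi> \<Longrightarrow> Sg \<bar> \<Gamma> \<turnstile>\<^sub>s \<xi> \<Colon> \<Delta> \<Longrightarrow> Sg \<bar> \<Gamma> \<turnstile>\<^sub>s SComp \<delta> \<xi> \<Colon> \<Xi>"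

text \<open>The laws \<open>eq_sub_id\<close>, \<open>eq_sub_comp\<close> and \<open>eq_sb_eta\<close> say that terms are acted on functorially by
  the category of substitutions and that \<open>\<tau> # \<Gamma>\<close> is the product of \<open>\<Gamma>\<close> and \<open>\<tau>\<close> (\<open>v[id] = v\<close> is an
  instance of the first). That the empty context is terminal is derivable.\<close>

inductive
  eq_tm :: "('s, 'o) signature \<Rightarrow> 's ctx \<Rightarrow> ('s, 'o) tm \<Rightarrow> ('s, 'o) tm \<Rightarrow> 's ty \<Rightarrow> bool"
    ("_ \<bar> _ \<turnstile> _ \<approx> _ \<Colon> _" [51, 51, 51, 51, 51] 50) and
  eq_sb :: "('s, 'o) signature \<Rightarrow> 's ctx \<Rightarrow> ('s, 'o) sb \<Rightarrow> ('s, 'o) sb \<Rightarrow> 's ctx \<Rightarrow> bool"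
    ("_ \<bar> _ \<turnstile>\<^sub>s _ \<approx> _ \<Colon> _" [51, 51, 51, 51, 51] 50)
  for Sg :: "('s, 'o) signature"
where
  eq_refl: "Sg \<bar> \<Gamma> \<turnstile> t \<Colon> \<tau> \<Longrightarrow> Sg \<bar> \<Gamma> \<turnstile> t \<approx> t \<Colon> \<tau>"
| eq_sym: "Sg \<bar> \<Gamma> \<turnstile> s \<approx> t \<Colon> \<tau> \<Longrightarrow> Sg \<bar> \<Gamma> \<turnstile> t \<approx> s \<Colon> \<tau>"
| eq_trans: "Sg \<bar> \<Gamma> \<turnstile> s \<approx> t \<Colon> \<tau> \<Longrightarrow> Sg \<bar> \<Gamma> \<turnstile> t \<approx> u \<Colon> \<tau> \<Longrightarrow> Sg \<bar> \<Gamma> \<turnstile> s \<approx> u \<Colon> \<tau>"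
| eqs_refl: "Sg \<bar> \<Gamma> \<turnstile>\<^sub>s \<delta> \<Colon> \<Delta> \<Longrightarrow> Sg \<bar> \<Gamma> \<turnstile>\<^sub>s \<delta> \<approx> \<delta> \<Colon> \<Delta>"
| eqs_sym: "Sg \<bar> \<Gamma> \<turnstile>\<^sub>s \<delta> \<approx> \<xi> \<Colon> \<Delta> \<Longrightarrow> Sg \<bar> \<Gamma> \<turnstile>\<^sub>s \<xi> \<approx> \<delta> \<Colon> \<Delta>"
| eqs_trans: "Sg \<bar> \<Gamma> \<turnstile>\<^sub>s \<delta> \<approx> \<xi> \<Colon> \<Delta> \<Longrightarrow> Sg \<bar> \<Gamma> \<turnstile>\<^sub>s \<xi> \<approx> \<zeta> \<Colon> \<Delta> \<Longrightarrow> Sg \<bar> \<Gamma> \<turnstile>\<^sub>s \<delta> \<approx> \<zeta> \<Colon> \<Delta>"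
| cong_sub: "Sg \<bar> \<Delta> \<turnstile> t \<approx> t' \<Colon> \<tau> \<Longrightarrow> Sg \<bar> \<Gamma> \<turnstile>\<^sub>s \<delta> \<approx> \<delta>' \<Colon> \<Delta> \<Longrightarrow> Sg \<bar> \<Gamma> \<turnstile> TSub t \<delta> \<approx> TSub t' \<delta>' \<Colon> \<tau>"
| cong_lam: "Sg \<bar> \<sigma> # \<Gamma> \<turnstile> t \<approx> t' \<Colon> \<tau> \<Longrightarrow> Sg \<bar> \<Gamma> \<turnstile> TLam \<sigma> t \<approx> TLam \<sigma> t' \<Colon> \<sigma> \<rightarrow> \<tau>"
| cong_app: "Sg \<bar> \<Gamma> \<turnstile> t \<approx> t' \<Colon> \<sigma> \<rightarrow> \<tau> \<Longrightarrow> Sg \<bar> \<Gamma> \<turnstile> s \<approx> s' \<Colon> \<sigma> \<Longrightarrow> Sg \<bar> \<Gamma> \<turnstile> TApp t s \<approx> TApp t' s' \<Colon> \<tau>"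
| cong_pair: "Sg \<bar> \<Gamma> \<turnstile> s \<approx> s' \<Colon> \<sigma> \<Longrightarrow> Sg \<bar> \<Gamma> \<turnstile> t \<approx> t' \<Colon> \<tau> \<Longrightarrow> Sg \<bar> \<Gamma> \<turnstile> TPair s t \<approx> TPair s' t' \<Colon> \<sigma> \<otimes> \<tau>"
| cong_fst: "Sg \<bar> \<Gamma> \<turnstile> t \<approx> t' \<Colon> \<sigma> \<otimes> \<tau> \<Longrightarrow> Sg \<bar> \<Gamma> \<turnstile> TFst t \<approx> TFst t' \<Colon> \<sigma>"
| cong_snd: "Sg \<bar> \<Gamma> \<turnstile> t \<approx> t' \<Colon> \<sigma> \<otimes> \<tau> \<Longrightarrow> Sg \<bar> \<Gamma> \<turnstile> TSnd t \<approx> TSnd t' \<Colon> \<tau>"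
| cong_ext: "Sg \<bar> \<Gamma> \<turnstile>\<^sub>s \<delta> \<approx> \<delta>' \<Colon> \<Delta> \<Longrightarrow> Sg \<bar> \<Gamma> \<turnstile> t \<approx> t' \<Colon> \<tau> \<Longrightarrow> Sg \<bar> \<Gamma> \<turnstile>\<^sub>s SExt \<delta> t \<approx> SExt \<delta>' t' \<Colon> \<tau> # \<Delta>"
| cong_comp: "Sg \<bar> \<Delta> \<turnstile>\<^sub>s \<delta> \<approx> \<delta>' \<Colon> \<Xi> \<Longrightarrow> Sg \<bar> \<Gamma> \<turnstile>\<^sub>s \<xi> \<approx> \<xi>' \<Colon> \<Delta> \<Longrightarrow> Sg \<bar> \<Gamma> \<turnstile>\<^sub>s SComp \<delta> \<xi> \<approx> SComp \<delta>' \<xi>' \<Colon> \<Xi>"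
| eq_beta: "Sg \<bar> \<sigma> # \<Gamma> \<turnstile> t \<Colon> \<tau> \<Longrightarrow> Sg \<bar> \<Gamma> \<turnstile> s \<Colon> \<sigma> \<Longrightarrow> Sg \<bar> \<Gamma> \<turnstile> TApp (TLam \<sigma> t) s \<approx> TSub t (SExt SId s) \<Colon> \<tau>"
| eq_eta: "Sg \<bar> \<Gamma> \<turnstile> t \<Colon> \<sigma> \<rightarrow> \<tau> \<Longrightarrow> Sg \<bar> \<Gamma> \<turnstile> t \<approx> TLam \<sigma> (TApp (TSub t SWk) TVar) \<Colon> \<sigma> \<rightarrow> \<tau>"
| eq_fst: "Sg \<bar> \<Gamma> \<turnstile> s \<Colon> \<sigma> \<Longrightarrow> Sg \<bar> \<Gamma> \<turnstile> t \<Colon> \<tau> \<Longrightarrow> Sg \<bar> \<Gamma> \<turnstile> TFst (TPair s t) \<approx> s \<Colon> \<sigma>"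
| eq_snd: "Sg \<bar> \<Gamma> \<turnstile> s \<Colon> \<sigma> \<Longrightarrow> Sg \<bar> \<Gamma> \<turnstile> t \<Colon> \<tau> \<Longrightarrow> Sg \<bar> \<Gamma> \<turnstile> TSnd (TPair s t) \<approx> t \<Colon> \<tau>"
| eq_pair: "Sg \<bar> \<Gamma> \<turnstile> t \<Colon> \<sigma> \<otimes> \<tau> \<Longrightarrow> Sg \<bar> \<Gamma> \<turnstile> t \<approx> TPair (TFst t) (TSnd t) \<Colon> \<sigma> \<otimes> \<tau>"
| eq_id_left: "Sg \<bar> \<Gamma> \<turnstile>\<^sub>s \<delta> \<Colon> \<Delta> \<Longrightarrow> Sg \<bar> \<Gamma> \<turnstile>\<^sub>s SComp SId \<delta> \<approx> \<delta> \<Colon> \<Delta>"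
| eq_id_right: "Sg \<bar> \<Gamma> \<turnstile>\<^sub>s \<delta> \<Colon> \<Delta> \<Longrightarrow> Sg \<bar> \<Gamma> \<turnstile>\<^sub>s SComp \<delta> SId \<approx> \<delta> \<Colon> \<Delta>"
| eq_assoc: "Sg \<bar> \<Xi> \<turnstile>\<^sub>s \<delta> \<Colon> \<Theta> \<Longrightarrow> Sg \<bar> \<Delta> \<turnstile>\<^sub>s \<xi> \<Colon> \<Xi> \<Longrightarrow> Sg \<bar> \<Gamma> \<turnstile>\<^sub>s \<zeta> \<Colon> \<Delta> \<Longrightarrow>
    Sg \<bar> \<Gamma> \<turnstile>\<^sub>s SComp (SComp \<delta> \<xi>) \<zeta> \<approx> SComp \<delta> (SComp \<xi> \<zeta>) \<Colon> \<Theta>"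
| eq_wk_ext: "Sg \<bar> \<Gamma> \<turnstile>\<^sub>s \<delta> \<Colon> \<Delta> \<Longrightarrow> Sg \<bar> \<Gamma> \<turnstile> t \<Colon> \<tau> \<Longrightarrow> Sg \<bar> \<Gamma> \<turnstile>\<^sub>s SComp SWk (SExt \<delta> t) \<approx> \<delta> \<Colon> \<Delta>"
| eq_ext_comp: "Sg \<bar> \<Delta> \<turnstile>\<^sub>s \<xi> \<Colon> \<Xi> \<Longrightarrow> Sg \<bar> \<Delta> \<turnstile> t \<Colon> \<tau> \<Longrightarrow> Sg \<bar> \<Gamma> \<turnstile>\<^sub>s \<delta> \<Colon> \<Delta> \<Longrightarrow>
    Sg \<bar> \<Gamma> \<turnstile>\<^sub>s SComp (SExt \<xi> t) \<delta> \<approx> SExt (SComp \<xi> \<delta>) (TSub t \<delta>) \<Colon> \<tau> # \<Xi>"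
| eq_sb_eta: "Sg \<bar> \<tau> # \<Gamma> \<turnstile>\<^sub>s SId \<approx> SExt SWk TVar \<Colon> \<tau> # \<Gamma>"
| eq_var_ext: "Sg \<bar> \<Gamma> \<turnstile>\<^sub>s \<delta> \<Colon> \<Delta> \<Longrightarrow> Sg \<bar> \<Gamma> \<turnstile> t \<Colon> \<tau> \<Longrightarrow> Sg \<bar> \<Gamma> \<turnstile> TSub TVar (SExt \<delta> t) \<approx> t \<Colon> \<tau>"
| eq_sub_id: "Sg \<bar> \<Gamma> \<turnstile> t \<Colon> \<tau> \<Longrightarrow> Sg \<bar> \<Gamma> \<turnstile> TSub t SId \<approx> t \<Colon> \<tau>"
| eq_sub_comp: "Sg \<bar> \<Xi> \<turnstile> t \<Colon> \<tau> \<Longrightarrow> Sg \<bar> \<Delta> \<turnstile>\<^sub>s \<delta> \<Colon> \<Xi> \<Longrightarrow> Sg \<bar> \<Gamma> \<turnstile>\<^sub>s \<xi> \<Colon> \<Delta> \<Longrightarrow>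
    Sg \<bar> \<Gamma> \<turnstile> TSub (TSub t \<delta>) \<xi> \<approx> TSub t (SComp \<delta> \<xi>) \<Colon> \<tau>"
| eq_sub_lam: "Sg \<bar> \<sigma> # \<Delta> \<turnstile> t \<Colon> \<tau> \<Longrightarrow> Sg \<bar> \<Gamma> \<turnstile>\<^sub>s \<delta> \<Colon> \<Delta> \<Longrightarrow>
    Sg \<bar> \<Gamma> \<turnstile> TSub (TLam \<sigma> t) \<delta> \<approx> TLam \<sigma> (TSub t (SExt (SComp \<delta> SWk) TVar)) \<Colon> \<sigma> \<rightarrow> \<tau>"
| eq_sub_app: "Sg \<bar> \<Delta> \<turnstile> t \<Colon> \<sigma> \<rightarrow> \<tau> \<Longrightarrow> Sg \<bar> \<Delta> \<turnstile> s \<Colon> \<sigma> \<Longrightarrow> Sg \<bar> \<Gamma> \<turnstile>\<^sub>s \<delta> \<Colon> \<Delta> \<Longrightarrow>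
    Sg \<bar> \<Gamma> \<turnstile> TSub (TApp t s) \<delta> \<approx> TApp (TSub t \<delta>) (TSub s \<delta>) \<Colon> \<tau>"
| eq_sub_pair: "Sg \<bar> \<Delta> \<turnstile> s \<Colon> \<sigma> \<Longrightarrow> Sg \<bar> \<Delta> \<turnstile> t \<Colon> \<tau> \<Longrightarrow> Sg \<bar> \<Gamma> \<turnstile>\<^sub>s \<delta> \<Colon> \<Delta> \<Longrightarrow>
    Sg \<bar> \<Gamma> \<turnstile> TSub (TPair s t) \<delta> \<approx> TPair (TSub s \<delta>) (TSub t \<delta>) \<Colon> \<sigma> \<otimes> \<tau>"
| eq_sub_fst: "Sg \<bar> \<Delta> \<turnstile> t \<Colon> \<sigma> \<otimes> \<tau> \<Longrightarrow> Sg \<bar> \<Gamma> \<turnstile>\<^sub>s \<delta> \<Colon> \<Delta> \<Longrightarrow>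
    Sg \<bar> \<Gamma> \<turnstile> TSub (TFst t) \<delta> \<approx> TFst (TSub t \<delta>) \<Colon> \<sigma>"
| eq_sub_snd: "Sg \<bar> \<Delta> \<turnstile> t \<Colon> \<sigma> \<otimes> \<tau> \<Longrightarrow> Sg \<bar> \<Gamma> \<turnstile>\<^sub>s \<delta> \<Colon> \<Delta> \<Longrightarrow>
    Sg \<bar> \<Gamma> \<turnstile> TSub (TSnd t) \<delta> \<approx> TSnd (TSub t \<delta>) \<Colon> \<tau>"

text \<open>The \<open>i\<close>-th variable (counted from the last one), the substitution \<open>\<Gamma> \<rightarrow> []\<close>, and tuples of terms
  in context \<open>\<Gamma>\<close>.\<close>

primrec var :: "nat \<Rightarrow> ('s, 'o) tm" where
  "var 0 = TVar"
| "var (Suc i) = TSub (var i) SWk"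

primrec bang :: "'s ctx \<Rightarrow> ('s, 'o) sb" where
  "bang [] = SId"
| "bang (\<tau> # \<Gamma>) = SComp (bang \<Gamma>) SWk"

primrec tuple :: "'s ctx \<Rightarrow> ('s, 'o) tm list \<Rightarrow> ('s, 'o) sb" where
  "tuple \<Gamma> [] = bang \<Gamma>"
| "tuple \<Gamma> (t # ts) = SExt (tuple \<Gamma> ts) t"


section \<open>The category \<open>Cl(\<Sigma>)\<close>\<close>

text \<open>A type \<open>\<tau>\<close> is identified with the one-element context: \<open>Hom(\<Gamma>,\<tau>)\<close> consists of the equivalence
  classes of terms \<open>\<Gamma> \<turnstile> t : \<tau>\<close>, and \<open>Hom(\<Gamma>,\<Delta>)\<close> of those of substitutions.\<close>

definition cls_tm :: "('s, 'o) signature \<Rightarrow> 's ctx \<Rightarrow> 's ty \<Rightarrow> ('s, 'o) tm \<Rightarrow> ('s, 'o) tm set" where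
  "cls_tm Sg \<Gamma> \<tau> t = {s. Sg \<bar> \<Gamma> \<turnstile> s \<approx> t \<Colon> \<tau>}"

definition cls_sb :: "('s, 'o) signature \<Rightarrow> 's ctx \<Rightarrow> 's ctx \<Rightarrow> ('s, 'o) sb \<Rightarrow> ('s, 'o) sb set" where
  "cls_sb Sg \<Gamma> \<Delta> \<delta> = {\<xi>. Sg \<bar> \<Gamma> \<turnstile>\<^sub>s \<xi> \<approx> \<delta> \<Colon> \<Delta>}"

definition Hom_tm :: "('s, 'o) signature \<Rightarrow> 's ctx \<Rightarrow> 's ty \<Rightarrow> ('s, 'o) tm set set" where
  "Hom_tm Sg \<Gamma> \<tau> = {cls_tm Sg \<Gamma> \<tau> t |t. Sg \<bar> \<Gamma> \<turnstile> t \<Colon> \<tau>}"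

definition Hom_sb :: "('s, 'o) signature \<Rightarrow> 's ctx \<Rightarrow> 's ctx \<Rightarrow> ('s, 'o) sb set set" where
  "Hom_sb Sg \<Gamma> \<Delta> = {cls_sb Sg \<Gamma> \<Delta> \<delta> |\<delta>. Sg \<bar> \<Gamma> \<turnstile>\<^sub>s \<delta> \<Colon> \<Delta>}"

definition c_sub where
  "c_sub Sg \<Gamma> \<tau> T D = {u. \<exists>t\<in>T. \<exists>\<delta>\<in>D. Sg \<bar> \<Gamma> \<turnstile> u \<approx> TSub t \<delta> \<Colon> \<tau>}"

definition c_lam where
  "c_lam Sg \<Gamma> \<sigma> \<tau> T = {u. \<exists>t\<in>T. Sg \<bar> \<Gamma> \<turnstile> u \<approx> TLam \<sigma> t \<Colon> \<sigma> \<rightarrow> \<tau>}"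

definition c_app where
  "c_app Sg \<Gamma> \<tau> T S = {u. \<exists>t\<in>T. \<exists>s\<in>S. Sg \<bar> \<Gamma> \<turnstile> u \<approx> TApp t s \<Colon> \<tau>}"

definition c_pair where
  "c_pair Sg \<Gamma> \<sigma> \<tau> S T = {u. \<exists>s\<in>S. \<exists>t\<in>T. Sg \<bar> \<Gamma> \<turnstile> u \<approx> TPair s t \<Colon> \<sigma> \<otimes> \<tau>}"

definition c_fst where
  "c_fst Sg \<Gamma> \<sigma> T = {u. \<exists>t\<in>T. Sg \<bar> \<Gamma> \<turnstile> u \<approx> TFst t \<Colon> \<sigma>}"

definition c_snd where
  "c_snd Sg \<Gamma> \<tau> T = {u. \<exists>t\<in>T. Sg \<bar> \<Gamma> \<turnstile> u \<approx> TSnd t \<Colon> \<tau>}"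

definition c_ext where
  "c_ext Sg \<Gamma> \<Delta> \<tau> D T = {\<zeta>. \<exists>\<delta>\<in>D. \<exists>t\<in>T. Sg \<bar> \<Gamma> \<turnstile>\<^sub>s \<zeta> \<approx> SExt \<delta> t \<Colon> \<tau> # \<Delta>}"

definition c_comp where
  "c_comp Sg \<Gamma> \<Xi> D E = {\<zeta>. \<exists>\<delta>\<in>D. \<exists>\<xi>\<in>E. Sg \<bar> \<Gamma> \<turnstile>\<^sub>s \<zeta> \<approx> SComp \<delta> \<xi> \<Colon> \<Xi>}"


section \<open>Renamings and the presheaf \<open>TM\<close>\<close>

text \<open>A renaming \<open>\<Delta> \<rightarrow> \<Gamma>\<close> gives, for each variable of \<open>\<Gamma>\<close>, a variable of \<open>\<Delta>\<close> of the same type.\<close>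

type_synonym ren = "nat list"

definition Ren :: "'s ctx \<Rightarrow> 's ctx \<Rightarrow> ren set" where
  "Ren \<Delta> \<Gamma> = {\<rho>. list_all2 (\<lambda>i \<tau>. i < length \<Delta> \<and> \<Delta> ! i = \<tau>) \<rho> \<Gamma>}"

definition ren_id :: "'s ctx \<Rightarrow> ren" where
  "ren_id \<Gamma> = [0..<length \<Gamma>]"

definition ren_wk :: "'s ctx \<Rightarrow> ren" where
  "ren_wk \<Gamma> = map Suc (ren_id \<Gamma>)"

definition ren_comp :: "ren \<Rightarrow> ren \<Rightarrow> ren"  (infixl "\<odot>" 75) where
  "\<rho> \<odot> \<theta> = map (\<lambda>i. \<theta> ! i) \<rho>"

definition ren_lift :: "ren \<Rightarrow> ren" where
  "ren_lift \<rho> = 0 # map Suc \<rho>"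

definition ren_sb :: "'s ctx \<Rightarrow> ren \<Rightarrow> ('s, 'o) sb" where
  "ren_sb \<Delta> \<rho> = tuple \<Delta> (map var \<rho>)"

definition tm_act :: "('s, 'o) signature \<Rightarrow> 's ty \<Rightarrow> 's ctx \<Rightarrow> 's ctx \<Rightarrow> ren \<Rightarrow> ('s, 'o) tm set \<Rightarrow> ('s, 'o) tm set" where
  "tm_act Sg \<tau> \<Gamma> \<Delta> \<rho> T = c_sub Sg \<Delta> \<tau> T (cls_sb Sg \<Delta> \<Gamma> (ren_sb \<Delta> \<rho>))"


section \<open>Neutral and normal forms\<close>

datatype ('s, 'o) ne =
    NVar nat
  | NOp 'o "('s, 'o) nf list"
  | NApp "('s, 'o) ne" "('s, 'o) nf"
  | NFst "('s, 'o) ne"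
  | NSnd "('s, 'o) ne"
and ('s, 'o) nf =
    NNe "('s, 'o) ne"
  | NLam "'s ty" "('s, 'o) nf"
  | NPair "('s, 'o) nf" "('s, 'o) nf"

inductive
  ne_ty :: "('s, 'o) signature \<Rightarrow> 's ctx \<Rightarrow> ('s, 'o) ne \<Rightarrow> 's ty \<Rightarrow> bool" and
  nf_ty :: "('s, 'o) signature \<Rightarrow> 's ctx \<Rightarrow> ('s, 'o) nf \<Rightarrow> 's ty \<Rightarrow> bool"
  for Sg :: "('s, 'o) signature"
where
  ne_var: "i < length \<Gamma> \<Longrightarrow> ne_ty Sg \<Gamma> (NVar i) (\<Gamma> ! i)"
| ne_op: "Sg \<theta> = Some (\<Delta>, \<tau>) \<Longrightarrow> list_all2 (nf_ty Sg \<Gamma>) ns \<Delta> \<Longrightarrow> ne_ty Sg \<Gamma> (NOp \<theta> ns) \<tau>"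
| ne_app: "ne_ty Sg \<Gamma> t (\<sigma> \<rightarrow> \<tau>) \<Longrightarrow> nf_ty Sg \<Gamma> s \<sigma> \<Longrightarrow> ne_ty Sg \<Gamma> (NApp t s) \<tau>"
| ne_fst: "ne_ty Sg \<Gamma> t (\<sigma> \<otimes> \<tau>) \<Longrightarrow> ne_ty Sg \<Gamma> (NFst t) \<sigma>"
| ne_snd: "ne_ty Sg \<Gamma> t (\<sigma> \<otimes> \<tau>) \<Longrightarrow> ne_ty Sg \<Gamma> (NSnd t) \<tau>"
| nf_ne: "ne_ty Sg \<Gamma> t (Atom a) \<Longrightarrow> nf_ty Sg \<Gamma> (NNe t) (Atom a)"
| nf_lam: "nf_ty Sg (\<sigma> # \<Gamma>) t \<tau> \<Longrightarrow> nf_ty Sg \<Gamma> (NLam \<sigma> t) (\<sigma> \<rightarrow> \<tau>)"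
| nf_pair: "nf_ty Sg \<Gamma> s \<sigma> \<Longrightarrow> nf_ty Sg \<Gamma> t \<tau> \<Longrightarrow> nf_ty Sg \<Gamma> (NPair s t) (\<sigma> \<otimes> \<tau>)"

definition NE :: "('s, 'o) signature \<Rightarrow> 's ty \<Rightarrow> 's ctx \<Rightarrow> ('s, 'o) ne set" where
  "NE Sg \<tau> \<Gamma> = {t. ne_ty Sg \<Gamma> t \<tau>}"

definition NF :: "('s, 'o) signature \<Rightarrow> 's ty \<Rightarrow> 's ctx \<Rightarrow> ('s, 'o) nf set" where
  "NF Sg \<tau> \<Gamma> = {t. nf_ty Sg \<Gamma> t \<tau>}"

fun ren_ne :: "ren \<Rightarrow> ('s, 'o) ne \<Rightarrow> ('s, 'o) ne"
and ren_nf :: "ren \<Rightarrow> ('s, 'o) nf \<Rightarrow> ('s, 'o) nf" where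
  "ren_ne \<rho> (NVar i) = NVar (\<rho> ! i)"
| "ren_ne \<rho> (NOp \<theta> ns) = NOp \<theta> (map (ren_nf \<rho>) ns)"
| "ren_ne \<rho> (NApp t s) = NApp (ren_ne \<rho> t) (ren_nf \<rho> s)"
| "ren_ne \<rho> (NFst t) = NFst (ren_ne \<rho> t)"
| "ren_ne \<rho> (NSnd t) = NSnd (ren_ne \<rho> t)"
| "ren_nf \<rho> (NNe t) = NNe (ren_ne \<rho> t)"
| "ren_nf \<rho> (NLam \<sigma> t) = NLam \<sigma> (ren_nf (ren_lift \<rho>) t)"
| "ren_nf \<rho> (NPair s t) = NPair (ren_nf \<rho> s) (ren_nf \<rho> t)"

text \<open>The context argument is needed for tuples over an empty arity.\<close>

fun emb_ne :: "'s ctx \<Rightarrow> ('s, 'o) ne \<Rightarrow> ('s, 'o) tm"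
and emb_nf :: "'s ctx \<Rightarrow> ('s, 'o) nf \<Rightarrow> ('s, 'o) tm" where
  "emb_ne \<Gamma> (NVar i) = var i"
| "emb_ne \<Gamma> (NOp \<theta> ns) = TSub (TOp \<theta>) (tuple \<Gamma> (map (emb_nf \<Gamma>) ns))"
| "emb_ne \<Gamma> (NApp t s) = TApp (emb_ne \<Gamma> t) (emb_nf \<Gamma> s)"
| "emb_ne \<Gamma> (NFst t) = TFst (emb_ne \<Gamma> t)"
| "emb_ne \<Gamma> (NSnd t) = TSnd (emb_ne \<Gamma> t)"
| "emb_nf \<Gamma> (NNe t) = emb_ne \<Gamma> t"
| "emb_nf \<Gamma> (NLam \<sigma> t) = TLam \<sigma> (emb_nf (\<sigma> # \<Gamma>) t)"
| "emb_nf \<Gamma> (NPair s t) = TPair (emb_nf \<Gamma> s) (emb_nf \<Gamma> t)"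

definition down_ne :: "('s, 'o) signature \<Rightarrow> 's ty \<Rightarrow> 's ctx \<Rightarrow> ('s, 'o) ne \<Rightarrow> ('s, 'o) tm set" where
  "down_ne Sg \<tau> \<Gamma> t = cls_tm Sg \<Gamma> \<tau> (emb_ne \<Gamma> t)"

definition down_nf :: "('s, 'o) signature \<Rightarrow> 's ty \<Rightarrow> 's ctx \<Rightarrow> ('s, 'o) nf \<Rightarrow> ('s, 'o) tm set" where
  "down_nf Sg \<tau> \<Gamma> t = cls_tm Sg \<Gamma> \<tau> (emb_nf \<Gamma> t)"

definition down_nf_ctx :: "('s, 'o) signature \<Rightarrow> 's ctx \<Rightarrow> 's ctx \<Rightarrow> ('s, 'o) nf list \<Rightarrow> ('s, 'o) sb set" where
  "down_nf_ctx Sg \<Delta> \<Gamma> ns = cls_sb Sg \<Gamma> \<Delta> (tuple \<Gamma> (map (emb_nf \<Gamma>) ns))"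


section \<open>The presheaves \<open>P\<close> with reflection and reification\<close>

text \<open>No HOL type contains full function spaces over itself, so an element \<open>(t,F)\<close> of \<open>P\<^bsub>\<sigma>\<rightarrow>\<tau>\<^esub>(\<Gamma>)\<close> is
  stored as the token \<open>VFun t\<close>. Nothing is lost, because \<open>F\<close> is determined by \<open>t\<close>:
  by induction on types \<open>\<down>\<^sup>n\<^sup>f \<circ> reify\<close> is injective (at atomic types since equal normal forms are
  identical), and the pullback condition fixes \<open>\<down>\<^sup>n\<^sup>f (reify (F v))\<close>. See \<open>inj_on_encode\<close> below.\<close>

datatype ('s, 'o) val =
    VNf (un_nf: "('s, 'o) nf")
  | VPair (vfst: "('s, 'o) val") (vsnd: "('s, 'o) val")
  | VFun "('s, 'o) tm set"

text \<open>\<open>act A \<Gamma> \<Delta> \<rho>\<close> is the action of \<open>\<rho> \<in> Ren \<Delta> \<Gamma>\<close>, a map from \<open>car A \<Gamma>\<close> to \<open>car A \<Delta>\<close>.\<close>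

record ('s, 'o) sem =
  car :: "'s ctx \<Rightarrow> ('s, 'o) val set"
  act :: "'s ctx \<Rightarrow> 's ctx \<Rightarrow> ren \<Rightarrow> ('s, 'o) val \<Rightarrow> ('s, 'o) val"
  reflect :: "'s ctx \<Rightarrow> ('s, 'o) ne \<Rightarrow> ('s, 'o) val"
  reify :: "'s ctx \<Rightarrow> ('s, 'o) val \<Rightarrow> ('s, 'o) nf"

type_synonym ('s, 'o) fam = "'s ctx \<Rightarrow> ren \<Rightarrow> ('s, 'o) val \<Rightarrow> ('s, 'o) val"

definition restr :: "('s, 'o) sem \<Rightarrow> 's ctx \<Rightarrow> ('s, 'o) fam \<Rightarrow> ('s, 'o) fam" where
  "restr A \<Gamma> F = (\<lambda>\<Delta> \<rho> v. if \<rho> \<in> Ren \<Delta> \<Gamma> \<and> v \<in> car A \<Delta> then F \<Delta> \<rho> v else undefined)"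

text \<open>The exponential presheaf: natural families indexed by renamings into \<open>\<Gamma>\<close>.\<close>

definition expo :: "('s, 'o) sem \<Rightarrow> ('s, 'o) sem \<Rightarrow> 's ctx \<Rightarrow> ('s, 'o) fam set" where
  "expo A B \<Gamma> = {F. F = restr A \<Gamma> F
     \<and> (\<forall>\<Delta>. \<forall>\<rho>\<in>Ren \<Delta> \<Gamma>. \<forall>v\<in>car A \<Delta>. F \<Delta> \<rho> v \<in> car B \<Delta>)
     \<and> (\<forall>\<Delta> \<Xi>. \<forall>\<rho>\<in>Ren \<Delta> \<Gamma>. \<forall>\<theta>\<in>Ren \<Xi> \<Delta>. \<forall>v\<in>car A \<Delta>.
          F \<Xi> (\<rho> \<odot> \<theta>) (act A \<Delta> \<Xi> \<theta> v) = act B \<Delta> \<Xi> \<theta> (F \<Delta> \<rho> v))}"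

definition expo_act :: "('s, 'o) sem \<Rightarrow> 's ctx \<Rightarrow> ren \<Rightarrow> ('s, 'o) fam \<Rightarrow> ('s, 'o) fam" where
  "expo_act A \<Delta> \<rho> F = restr A \<Delta> (\<lambda>\<Xi> \<theta> v. F \<Xi> (\<rho> \<odot> \<theta>) v)"

definition pullback :: "('s, 'o) signature \<Rightarrow> 's ty \<Rightarrow> 's ty \<Rightarrow> ('s, 'o) sem \<Rightarrow> ('s, 'o) sem \<Rightarrow> 's ctx
    \<Rightarrow> (('s, 'o) tm set \<times> ('s, 'o) fam) set" where
  "pullback Sg \<sigma> \<tau> A B \<Gamma> = {(t, F). t \<in> Hom_tm Sg \<Gamma> (\<sigma> \<rightarrow> \<tau>) \<and> F \<in> expo A B \<Gamma>
     \<and> (\<forall>\<Delta>. \<forall>\<rho>\<in>Ren \<Delta> \<Gamma>. \<forall>v\<in>car A \<Delta>.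
          down_nf Sg \<tau> \<Delta> (reify B \<Delta> (F \<Delta> \<rho> v))
            = c_app Sg \<Delta> \<tau> (tm_act Sg (\<sigma> \<rightarrow> \<tau>) \<Gamma> \<Delta> \<rho> t) (down_nf Sg \<sigma> \<Delta> (reify A \<Delta> v)))}"

definition encode :: "('s, 'o) tm set \<times> ('s, 'o) fam \<Rightarrow> ('s, 'o) val" where
  "encode = (\<lambda>(t, F). VFun t)"

definition decode :: "('s, 'o) signature \<Rightarrow> 's ty \<Rightarrow> 's ty \<Rightarrow> ('s, 'o) sem \<Rightarrow> ('s, 'o) sem \<Rightarrow> 's ctx
    \<Rightarrow> ('s, 'o) val \<Rightarrow> ('s, 'o) tm set \<times> ('s, 'o) fam" where
  "decode Sg \<sigma> \<tau> A B \<Gamma> = inv_into (pullback Sg \<sigma> \<tau> A B \<Gamma>) encode"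

definition sem_atom :: "('s, 'o) signature \<Rightarrow> 's \<Rightarrow> ('s, 'o) sem" where
  "sem_atom Sg a = \<lparr>
     car = \<lambda>\<Gamma>. VNf ` NF Sg (Atom a) \<Gamma>,
     act = \<lambda>\<Gamma> \<Delta> \<rho> v. VNf (ren_nf \<rho> (un_nf v)),
     reflect = \<lambda>\<Gamma> t. VNf (NNe t),
     reify = \<lambda>\<Gamma> v. un_nf v\<rparr>"

definition sem_times :: "('s, 'o) sem \<Rightarrow> ('s, 'o) sem \<Rightarrow> ('s, 'o) sem" where
  "sem_times A B = \<lparr>
     car = \<lambda>\<Gamma>. {VPair a b |a b. a \<in> car A \<Gamma> \<and> b \<in> car B \<Gamma>},
     act = \<lambda>\<Gamma> \<Delta> \<rho> v. VPair (act A \<Gamma> \<Delta> \<rho> (vfst v)) (act B \<Gamma> \<Delta> \<rho> (vsnd v)),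
     reflect = \<lambda>\<Gamma> t. VPair (reflect A \<Gamma> (NFst t)) (reflect B \<Gamma> (NSnd t)),
     reify = \<lambda>\<Gamma> v. NPair (reify A \<Gamma> (vfst v)) (reify B \<Gamma> (vsnd v))\<rparr>"

definition sem_arrow :: "('s, 'o) signature \<Rightarrow> 's ty \<Rightarrow> 's ty \<Rightarrow> ('s, 'o) sem \<Rightarrow> ('s, 'o) sem \<Rightarrow> ('s, 'o) sem" where
  "sem_arrow Sg \<sigma> \<tau> A B = \<lparr>
     car = \<lambda>\<Gamma>. encode ` pullback Sg \<sigma> \<tau> A B \<Gamma>,
     act = \<lambda>\<Gamma> \<Delta> \<rho> v. case decode Sg \<sigma> \<tau> A B \<Gamma> v of
       (t, F) \<Rightarrow> encode (tm_act Sg (\<sigma> \<rightarrow> \<tau>) \<Gamma> \<Delta> \<rho> t, expo_act A \<Delta> \<rho> F),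
     reflect = \<lambda>\<Gamma> t. encode (down_ne Sg (\<sigma> \<rightarrow> \<tau>) \<Gamma> t,
       restr A \<Gamma> (\<lambda>\<Delta> \<rho> v. reflect B \<Delta> (NApp (ren_ne \<rho> t) (reify A \<Delta> v)))),
     reify = \<lambda>\<Gamma> v. case decode Sg \<sigma> \<tau> A B \<Gamma> v of
       (t, F) \<Rightarrow> NLam \<sigma> (reify B (\<sigma> # \<Gamma>) (F (\<sigma> # \<Gamma>) (ren_wk \<Gamma>) (reflect A (\<sigma> # \<Gamma>) (NVar 0))))\<rparr>"

primrec P_ty :: "('s, 'o) signature \<Rightarrow> 's ty \<Rightarrow> ('s, 'o) sem" where
  "P_ty Sg (Atom a) = sem_atom Sg a"
| "P_ty Sg (\<sigma> \<otimes> \<tau>) = sem_times (P_ty Sg \<sigma>) (P_ty Sg \<tau>)"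
| "P_ty Sg (\<sigma> \<rightarrow> \<tau>) = sem_arrow Sg \<sigma> \<tau> (P_ty Sg \<sigma>) (P_ty Sg \<tau>)"

definition P_ctx :: "('s, 'o) signature \<Rightarrow> 's ctx \<Rightarrow> 's ctx \<Rightarrow> ('s, 'o) val list set" where
  "P_ctx Sg \<Delta> \<Gamma> = {vs. list_all2 (\<lambda>v \<tau>. v \<in> car (P_ty Sg \<tau>) \<Gamma>) vs \<Delta>}"

definition act_ctx :: "('s, 'o) signature \<Rightarrow> 's ctx \<Rightarrow> 's ctx \<Rightarrow> 's ctx \<Rightarrow> ren \<Rightarrow> ('s, 'o) val list \<Rightarrow> ('s, 'o) val list" where
  "act_ctx Sg \<Delta> \<Gamma> \<Xi> \<rho> vs = map2 (\<lambda>\<tau>. act (P_ty Sg \<tau>) \<Gamma> \<Xi> \<rho>) \<Delta> vs"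

definition reflect_ctx :: "('s, 'o) signature \<Rightarrow> 's ctx \<Rightarrow> 's ctx \<Rightarrow> ('s, 'o) ne list \<Rightarrow> ('s, 'o) val list" where
  "reflect_ctx Sg \<Delta> \<Gamma> ts = map2 (\<lambda>\<tau>. reflect (P_ty Sg \<tau>) \<Gamma>) \<Delta> ts"

definition reify_ctx :: "('s, 'o) signature \<Rightarrow> 's ctx \<Rightarrow> 's ctx \<Rightarrow> ('s, 'o) val list \<Rightarrow> ('s, 'o) nf list" where
  "reify_ctx Sg \<Delta> \<Gamma> vs = map2 (\<lambda>\<tau>. reify (P_ty Sg \<tau>) \<Gamma>) \<Delta> vs"


section \<open>The gluing category\<close>

definition glue :: "('s, 'o) signature \<Rightarrow> 's ty \<Rightarrow> 's ctx \<Rightarrow> ('s, 'o) val \<Rightarrow> ('s, 'o) tm set" where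
  "glue Sg \<tau> \<Gamma> v = down_nf Sg \<tau> \<Gamma> (reify (P_ty Sg \<tau>) \<Gamma> v)"

definition glue_ctx :: "('s, 'o) signature \<Rightarrow> 's ctx \<Rightarrow> 's ctx \<Rightarrow> ('s, 'o) val list \<Rightarrow> ('s, 'o) sb set" where
  "glue_ctx Sg \<Delta> \<Gamma> vs = down_nf_ctx Sg \<Delta> \<Gamma> (reify_ctx Sg \<Delta> \<Gamma> vs)"

type_synonym ('s, 'o) gl_tm = "('s ctx \<Rightarrow> ('s, 'o) val list \<Rightarrow> ('s, 'o) val) \<times> ('s, 'o) tm set"
type_synonym ('s, 'o) gl_sb = "('s ctx \<Rightarrow> ('s, 'o) val list \<Rightarrow> ('s, 'o) val list) \<times> ('s, 'o) sb set"

text \<open>Morphisms from the interpretation of a context \<open>\<Gamma>\<close> to that of a type \<open>\<tau>\<close>, resp. a context \<open>\<Delta>\<close>.\<close>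

definition Gl_tm :: "('s, 'o) signature \<Rightarrow> 's ctx \<Rightarrow> 's ty \<Rightarrow> ('s, 'o) gl_tm set" where
  "Gl_tm Sg \<Gamma> \<tau> = {(d, t). t \<in> Hom_tm Sg \<Gamma> \<tau>
     \<and> (\<forall>\<Xi>. \<forall>e\<in>P_ctx Sg \<Gamma> \<Xi>. d \<Xi> e \<in> car (P_ty Sg \<tau>) \<Xi>)
     \<and> (\<forall>\<Xi> \<Theta>. \<forall>\<rho>\<in>Ren \<Theta> \<Xi>. \<forall>e\<in>P_ctx Sg \<Gamma> \<Xi>. d \<Theta> (act_ctx Sg \<Gamma> \<Xi> \<Theta> \<rho> e) = act (P_ty Sg \<tau>) \<Xi> \<Theta> \<rho> (d \<Xi> e))
     \<and> (\<forall>\<Xi>. \<forall>e\<in>P_ctx Sg \<Gamma> \<Xi>. glue Sg \<tau> \<Xi> (d \<Xi> e) = c_sub Sg \<Xi> \<tau> t (glue_ctx Sg \<Gamma> \<Xi> e))}"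

definition Gl_sb :: "('s, 'o) signature \<Rightarrow> 's ctx \<Rightarrow> 's ctx \<Rightarrow> ('s, 'o) gl_sb set" where
  "Gl_sb Sg \<Gamma> \<Delta> = {(d, \<delta>). \<delta> \<in> Hom_sb Sg \<Gamma> \<Delta>
     \<and> (\<forall>\<Xi>. \<forall>e\<in>P_ctx Sg \<Gamma> \<Xi>. d \<Xi> e \<in> P_ctx Sg \<Delta> \<Xi>)
     \<and> (\<forall>\<Xi> \<Theta>. \<forall>\<rho>\<in>Ren \<Theta> \<Xi>. \<forall>e\<in>P_ctx Sg \<Gamma> \<Xi>. d \<Theta> (act_ctx Sg \<Gamma> \<Xi> \<Theta> \<rho> e) = act_ctx Sg \<Delta> \<Xi> \<Theta> \<rho> (d \<Xi> e))
     \<and> (\<forall>\<Xi>. \<forall>e\<in>P_ctx Sg \<Gamma> \<Xi>. glue_ctx Sg \<Delta> \<Xi> (d \<Xi> e) = c_comp Sg \<Xi> \<Delta> \<delta> (glue_ctx Sg \<Gamma> \<Xi> e))}"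

definition gl_var :: "('s, 'o) signature \<Rightarrow> 's ctx \<Rightarrow> 's ty \<Rightarrow> ('s, 'o) gl_tm" where
  "gl_var Sg \<Gamma> \<tau> = (\<lambda>\<Xi> e. hd e, cls_tm Sg (\<tau> # \<Gamma>) \<tau> TVar)"

definition gl_sub :: "('s, 'o) signature \<Rightarrow> 's ctx \<Rightarrow> 's ty \<Rightarrow> ('s, 'o) gl_tm \<Rightarrow> ('s, 'o) gl_sb \<Rightarrow> ('s, 'o) gl_tm" where
  "gl_sub Sg \<Gamma> \<tau> f g = (\<lambda>\<Xi> e. fst f \<Xi> (fst g \<Xi> e), c_sub Sg \<Gamma> \<tau> (snd f) (snd g))"

definition gl_lam :: "('s, 'o) signature \<Rightarrow> 's ctx \<Rightarrow> 's ty \<Rightarrow> 's ty \<Rightarrow> ('s, 'o) gl_tm \<Rightarrow> ('s, 'o) gl_tm" where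
  "gl_lam Sg \<Gamma> \<sigma> \<tau> f =
     (let t = c_lam Sg \<Gamma> \<sigma> \<tau> (snd f) in
      (\<lambda>\<Xi> e. encode (c_sub Sg \<Xi> (\<sigma> \<rightarrow> \<tau>) t (glue_ctx Sg \<Gamma> \<Xi> e),
          restr (P_ty Sg \<sigma>) \<Xi> (\<lambda>\<Theta> \<rho> v. fst f \<Theta> (v # act_ctx Sg \<Gamma> \<Xi> \<Theta> \<rho> e))), t))"

definition gl_app :: "('s, 'o) signature \<Rightarrow> 's ctx \<Rightarrow> 's ty \<Rightarrow> 's ty \<Rightarrow> ('s, 'o) gl_tm \<Rightarrow> ('s, 'o) gl_tm \<Rightarrow> ('s, 'o) gl_tm" where
  "gl_app Sg \<Gamma> \<sigma> \<tau> f g =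
     (\<lambda>\<Xi> e. snd (decode Sg \<sigma> \<tau> (P_ty Sg \<sigma>) (P_ty Sg \<tau>) \<Xi> (fst f \<Xi> e)) \<Xi> (ren_id \<Xi>) (fst g \<Xi> e),
      c_app Sg \<Gamma> \<tau> (snd f) (snd g))"

definition gl_pair :: "('s, 'o) signature \<Rightarrow> 's ctx \<Rightarrow> 's ty \<Rightarrow> 's ty \<Rightarrow> ('s, 'o) gl_tm \<Rightarrow> ('s, 'o) gl_tm \<Rightarrow> ('s, 'o) gl_tm" where
  "gl_pair Sg \<Gamma> \<sigma> \<tau> f g =
     (\<lambda>\<Xi> e. VPair (fst f \<Xi> e) (fst g \<Xi> e), c_pair Sg \<Gamma> \<sigma> \<tau> (snd f) (snd g))"

definition gl_fst :: "('s, 'o) signature \<Rightarrow> 's ctx \<Rightarrow> 's ty \<Rightarrow> ('s, 'o) gl_tm \<Rightarrow> ('s, 'o) gl_tm" where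
  "gl_fst Sg \<Gamma> \<sigma> f = (\<lambda>\<Xi> e. vfst (fst f \<Xi> e), c_fst Sg \<Gamma> \<sigma> (snd f))"

definition gl_snd :: "('s, 'o) signature \<Rightarrow> 's ctx \<Rightarrow> 's ty \<Rightarrow> ('s, 'o) gl_tm \<Rightarrow> ('s, 'o) gl_tm" where
  "gl_snd Sg \<Gamma> \<tau> f = (\<lambda>\<Xi> e. vsnd (fst f \<Xi> e), c_snd Sg \<Gamma> \<tau> (snd f))"

definition gl_id :: "('s, 'o) signature \<Rightarrow> 's ctx \<Rightarrow> ('s, 'o) gl_sb" where
  "gl_id Sg \<Gamma> = (\<lambda>\<Xi> e. e, cls_sb Sg \<Gamma> \<Gamma> SId)"

definition gl_wk :: "('s, 'o) signature \<Rightarrow> 's ctx \<Rightarrow> 's ty \<Rightarrow> ('s, 'o) gl_sb" where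
  "gl_wk Sg \<Gamma> \<tau> = (\<lambda>\<Xi> e. tl e, cls_sb Sg (\<tau> # \<Gamma>) \<Gamma> SWk)"

definition gl_ext :: "('s, 'o) signature \<Rightarrow> 's ctx \<Rightarrow> 's ctx \<Rightarrow> 's ty \<Rightarrow> ('s, 'o) gl_sb \<Rightarrow> ('s, 'o) gl_tm \<Rightarrow> ('s, 'o) gl_sb" where
  "gl_ext Sg \<Gamma> \<Delta> \<tau> f g = (\<lambda>\<Xi> e. fst g \<Xi> e # fst f \<Xi> e, c_ext Sg \<Gamma> \<Delta> \<tau> (snd f) (snd g))"

definition gl_comp :: "('s, 'o) signature \<Rightarrow> 's ctx \<Rightarrow> 's ctx \<Rightarrow> ('s, 'o) gl_sb \<Rightarrow> ('s, 'o) gl_sb \<Rightarrow> ('s, 'o) gl_sb" where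
  "gl_comp Sg \<Gamma> \<Xi> f g = (\<lambda>\<Theta> e. fst f \<Theta> (fst g \<Theta> e), c_comp Sg \<Gamma> \<Xi> (snd f) (snd g))"


section \<open>Interpretation and normalization\<close>

text \<open>An interpretation of the operations by morphisms of the gluing category lying over them.\<close>

definition op_interpretation :: "('s, 'o) signature \<Rightarrow> ('o \<Rightarrow> ('s, 'o) gl_tm) \<Rightarrow> bool" where
  "op_interpretation Sg J \<longleftrightarrow>
     (\<forall>\<theta> \<Delta> \<tau>. Sg \<theta> = Some (\<Delta>, \<tau>) \<longrightarrow> J \<theta> \<in> Gl_tm Sg \<Delta> \<tau> \<and> snd (J \<theta>) = cls_tm Sg \<Delta> \<tau> (TOp \<theta>))"

definition typ_of :: "('s, 'o) signature \<Rightarrow> 's ctx \<Rightarrow> ('s, 'o) tm \<Rightarrow> 's ty" where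
  "typ_of Sg \<Gamma> t = (THE \<tau>. Sg \<bar> \<Gamma> \<turnstile> t \<Colon> \<tau>)"

definition cod_of :: "('s, 'o) signature \<Rightarrow> 's ctx \<Rightarrow> ('s, 'o) sb \<Rightarrow> 's ctx" where
  "cod_of Sg \<Gamma> \<delta> = (THE \<Delta>. Sg \<bar> \<Gamma> \<turnstile>\<^sub>s \<delta> \<Colon> \<Delta>)"

fun interp_tm :: "('s, 'o) signature \<Rightarrow> ('o \<Rightarrow> ('s, 'o) gl_tm) \<Rightarrow> 's ctx \<Rightarrow> ('s, 'o) tm \<Rightarrow> ('s, 'o) gl_tm"
and interp_sb :: "('s, 'o) signature \<Rightarrow> ('o \<Rightarrow> ('s, 'o) gl_tm) \<Rightarrow> 's ctx \<Rightarrow> ('s, 'o) sb \<Rightarrow> ('s, 'o) gl_sb" where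
  "interp_tm Sg J \<Gamma> TVar = gl_var Sg (tl \<Gamma>) (hd \<Gamma>)"
| "interp_tm Sg J \<Gamma> (TOp \<theta>) = J \<theta>"
| "interp_tm Sg J \<Gamma> (TSub t \<delta>) =
     gl_sub Sg \<Gamma> (typ_of Sg \<Gamma> (TSub t \<delta>)) (interp_tm Sg J (cod_of Sg \<Gamma> \<delta>) t) (interp_sb Sg J \<Gamma> \<delta>)"
| "interp_tm Sg J \<Gamma> (TLam \<sigma> t) =
     gl_lam Sg \<Gamma> \<sigma> (typ_of Sg (\<sigma> # \<Gamma>) t) (interp_tm Sg J (\<sigma> # \<Gamma>) t)"
| "interp_tm Sg J \<Gamma> (TApp t s) =
     gl_app Sg \<Gamma> (typ_of Sg \<Gamma> s) (typ_of Sg \<Gamma> (TApp t s)) (interp_tm Sg J \<Gamma> t) (interp_tm Sg J \<Gamma> s)"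
| "interp_tm Sg J \<Gamma> (TPair s t) =
     gl_pair Sg \<Gamma> (typ_of Sg \<Gamma> s) (typ_of Sg \<Gamma> t) (interp_tm Sg J \<Gamma> s) (interp_tm Sg J \<Gamma> t)"
| "interp_tm Sg J \<Gamma> (TFst t) = gl_fst Sg \<Gamma> (typ_of Sg \<Gamma> (TFst t)) (interp_tm Sg J \<Gamma> t)"
| "interp_tm Sg J \<Gamma> (TSnd t) = gl_snd Sg \<Gamma> (typ_of Sg \<Gamma> (TSnd t)) (interp_tm Sg J \<Gamma> t)"
| "interp_sb Sg J \<Gamma> SId = gl_id Sg \<Gamma>"
| "interp_sb Sg J \<Gamma> SWk = gl_wk Sg (tl \<Gamma>) (hd \<Gamma>)"
| "interp_sb Sg J \<Gamma> (SExt \<delta> t) =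
     gl_ext Sg \<Gamma> (cod_of Sg \<Gamma> \<delta>) (typ_of Sg \<Gamma> t) (interp_sb Sg J \<Gamma> \<delta>) (interp_tm Sg J \<Gamma> t)"
| "interp_sb Sg J \<Gamma> (SComp \<delta> \<xi>) =
     gl_comp Sg \<Gamma> (cod_of Sg \<Gamma> (SComp \<delta> \<xi>)) (interp_sb Sg J (cod_of Sg \<Gamma> \<xi>) \<delta>) (interp_sb Sg J \<Gamma> \<xi>)"

text \<open>The choice of representative does not matter: the two components of a morphism \<open>(d,\<delta>)\<close> of the
  gluing category satisfy \<open>q \<circ> d = TM(\<delta>) \<circ> q\<close>, and the structure maps \<open>q\<close> are injective, so that \<open>\<delta>\<close>
  determines \<open>d\<close>.\<close>

definition Interp_tm :: "('s, 'o) signature \<Rightarrow> ('o \<Rightarrow> ('s, 'o) gl_tm) \<Rightarrow> 's ctx \<Rightarrow> ('s, 'o) tm set \<Rightarrow> ('s, 'o) gl_tm" where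
  "Interp_tm Sg J \<Gamma> T = interp_tm Sg J \<Gamma> (SOME t. t \<in> T)"

definition Interp_sb :: "('s, 'o) signature \<Rightarrow> ('o \<Rightarrow> ('s, 'o) gl_tm) \<Rightarrow> 's ctx \<Rightarrow> ('s, 'o) sb set \<Rightarrow> ('s, 'o) gl_sb" where
  "Interp_sb Sg J \<Gamma> D = interp_sb Sg J \<Gamma> (SOME \<delta>. \<delta> \<in> D)"

definition ne_id :: "'s ctx \<Rightarrow> ('s, 'o) ne list" where
  "ne_id \<Gamma> = map NVar [0..<length \<Gamma>]"

definition norm_tm :: "('s, 'o) signature \<Rightarrow> ('o \<Rightarrow> ('s, 'o) gl_tm) \<Rightarrow> 's ctx \<Rightarrow> 's ty \<Rightarrow> ('s, 'o) tm set \<Rightarrow> ('s, 'o) nf" where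
  "norm_tm Sg J \<Gamma> \<tau> T = reify (P_ty Sg \<tau>) \<Gamma> (fst (Interp_tm Sg J \<Gamma> T) \<Gamma> (reflect_ctx Sg \<Gamma> \<Gamma> (ne_id \<Gamma>)))"

definition norm_sb :: "('s, 'o) signature \<Rightarrow> ('o \<Rightarrow> ('s, 'o) gl_tm) \<Rightarrow> 's ctx \<Rightarrow> 's ctx \<Rightarrow> ('s, 'o) sb set \<Rightarrow> ('s, 'o) nf list" where
  "norm_sb Sg J \<Gamma> \<Delta> D = reify_ctx Sg \<Delta> \<Gamma> (fst (Interp_sb Sg J \<Gamma> D) \<Gamma> (reflect_ctx Sg \<Gamma> \<Gamma> (ne_id \<Gamma>)))"


section \<open>Uniqueness of normal forms\<close>

text \<open>The rest of this theory proves that the encoding of \<open>P\<^bsub>\<sigma>\<rightarrow>\<tau>\<^esub>\<close> is injective (\<open>inj_on_encode\<close>) and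
  that interpretations of the operations exist (\<open>canon_op\<close>); no definition above depends on it.
  Explicit substitutions are first executed, giving ordinary de Bruijn terms; a Kripke logical
  relation for type-directed normalization of these then shows that equal normal forms are
  identical (\<open>nf_unique\<close>).\<close>

datatype 'o lt = LV nat | LO 'o "'o lt list" | LL "'o lt" | LA "'o lt" "'o lt"
  | LP "'o lt" "'o lt" | LF "'o lt" | LS "'o lt"

definition rup :: "(nat \<Rightarrow> nat) \<Rightarrow> nat \<Rightarrow> nat" where
  "rup f = case_nat 0 (\<lambda>i. Suc (f i))"

fun lren :: "(nat \<Rightarrow> nat) \<Rightarrow> 'o lt \<Rightarrow> 'o lt" where
  "lren f (LV i) = LV (f i)"
| "lren f (LO \<theta> ts) = LO \<theta> (map (lren f) ts)"
| "lren f (LL t) = LL (lren (rup f) t)"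
| "lren f (LA t s) = LA (lren f t) (lren f s)"
| "lren f (LP t s) = LP (lren f t) (lren f s)"
| "lren f (LF t) = LF (lren f t)"
| "lren f (LS t) = LS (lren f t)"

definition lsup :: "(nat \<Rightarrow> 'o lt) \<Rightarrow> nat \<Rightarrow> 'o lt" where
  "lsup f = case_nat (LV 0) (\<lambda>i. lren Suc (f i))"

fun lsub :: "(nat \<Rightarrow> 'o lt) \<Rightarrow> 'o lt \<Rightarrow> 'o lt" where
  "lsub f (LV i) = f i"
| "lsub f (LO \<theta> ts) = LO \<theta> (map (lsub f) ts)"
| "lsub f (LL t) = LL (lsub (lsup f) t)"
| "lsub f (LA t s) = LA (lsub f t) (lsub f s)"
| "lsub f (LP t s) = LP (lsub f t) (lsub f s)"
| "lsub f (LF t) = LF (lsub f t)"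
| "lsub f (LS t) = LS (lsub f t)"

lemma rup_comp: "rup f (rup g i) = rup (\<lambda>i. f (g i)) i"
  by (cases i) (auto simp: rup_def)

lemma lren_lren: "lren f (lren g t) = lren (\<lambda>i. f (g i)) t"
  by (induction t arbitrary: f g) (auto simp: rup_comp)

lemma lsup_rup: "lsup f (rup g i) = lsup (\<lambda>i. f (g i)) i"
  by (cases i) (auto simp: lsup_def rup_def)

lemma lsub_lren: "lsub f (lren g t) = lsub (\<lambda>i. f (g i)) t"
  by (induction t arbitrary: f g) (auto simp: lsup_rup)

lemma lren_lsup: "lren (rup f) (lsup g i) = lsup (\<lambda>i. lren f (g i)) i"
  by (cases i) (auto simp: lsup_def rup_def lren_lren)

lemma lren_lsub: "lren f (lsub g t) = lsub (\<lambda>i. lren f (g i)) t"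
  by (induction t arbitrary: f g) (auto simp: lren_lsup)

lemma lsub_lsup: "lsub (lsup f) (lsup g i) = lsup (\<lambda>i. lsub f (g i)) i"
proof (cases i)
  case (Suc j)
  have "lsub (\<lambda>i. lsup f (Suc i)) (g j) = lsub (\<lambda>i. lren Suc (f i)) (g j)"
    by (simp add: lsup_def)
  with Suc show ?thesis by (simp add: lsup_def lsub_lren lren_lsub)
qed (simp add: lsup_def)

lemma lsub_lsub: "lsub f (lsub g t) = lsub (\<lambda>i. lsub f (g i)) t"
  by (induction t arbitrary: f g) (auto simp: lsub_lsup)

lemma lsup_LV: "lsup LV = LV"
  by (auto simp: lsup_def fun_eq_iff split: nat.split)

lemma lsub_LV [simp]: "lsub LV t = t"
  by (induction t) (auto simp: lsup_LV intro: map_idI)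

lemma lsup_LV_comp: "lsup (\<lambda>i. LV (f i)) = (\<lambda>i. LV (rup f i))"
  by (auto simp: lsup_def rup_def fun_eq_iff split: nat.split)

lemma lsub_LV_comp: "lsub (\<lambda>i. LV (f i)) t = lren f t"
  by (induction t arbitrary: f) (auto simp: lsup_LV_comp)

lemma lren_id [simp]: "lren (\<lambda>i. i) t = t"
  using lsub_LV_comp[of "\<lambda>i. i" t] by simp

lemma inst_up: "lsub (case_nat a LV) (lren (rup f) (lsub (lsup \<delta>) t)) = lsub (case_nat a (\<lambda>i. lren f (\<delta> i))) t"
proof -
  have "lsub (case_nat a LV) (lren (rup f) (lsup \<delta> i)) = case_nat a (\<lambda>i. lren f (\<delta> i)) i" for i
    by (cases i) (auto simp: lsup_def rup_def lsub_lren lsub_LV_comp)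
  then show ?thesis by (simp add: lsub_lren lsub_lsub lren_lsub)
qed

lemma rup_id: "rup (\<lambda>i. i) = (\<lambda>i. i)"
  by (auto simp: fun_eq_iff rup_def split: nat.split)

lemma inst: "lsub (case_nat a LV) (lsub (lsup \<delta>) t) = lsub (case_nat a \<delta>) t"
  using inst_up[of a "\<lambda>i. i" \<delta> t] by (simp add: rup_id)

lemma case_nat_rup_Suc: "(\<lambda>i. case_nat (LV 0) LV (rup Suc i)) = LV"
  by (auto simp: fun_eq_iff rup_def split: nat.split)

primrec er :: "('s, 'o) signature \<Rightarrow> ('s, 'o) tm \<Rightarrow> 'o lt"
and es :: "('s, 'o) signature \<Rightarrow> ('s, 'o) sb \<Rightarrow> nat \<Rightarrow> 'o lt" where
  "er Sg TVar = LV 0"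
| "er Sg (TOp \<theta>) = LO \<theta> (map LV [0..<length (fst (the (Sg \<theta>)))])"
| "er Sg (TSub t \<delta>) = lsub (es Sg \<delta>) (er Sg t)"
| "er Sg (TLam \<sigma> t) = LL (er Sg t)"
| "er Sg (TApp t s) = LA (er Sg t) (er Sg s)"
| "er Sg (TPair t s) = LP (er Sg t) (er Sg s)"
| "er Sg (TFst t) = LF (er Sg t)"
| "er Sg (TSnd t) = LS (er Sg t)"
| "es Sg SId = LV"
| "es Sg SWk = (\<lambda>i. LV (Suc i))"
| "es Sg (SExt \<delta> t) = case_nat (er Sg t) (es Sg \<delta>)"
| "es Sg (SComp \<delta> \<xi>) = (\<lambda>i. lsub (es Sg \<xi>) (es Sg \<delta> i))"

inductive whr :: "'o lt \<Rightarrow> 'o lt \<Rightarrow> bool" where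
  whr_beta: "whr (LA (LL t) s) (lsub (case_nat s LV) t)"
| whr_fst: "whr (LF (LP s t)) s"
| whr_snd: "whr (LS (LP s t)) t"
| whr_app: "whr t t' \<Longrightarrow> whr (LA t s) (LA t' s)"
| whr_cfst: "whr t t' \<Longrightarrow> whr (LF t) (LF t')"
| whr_csnd: "whr t t' \<Longrightarrow> whr (LS t) (LS t')"

inductive_cases whrE: "whr (LV i) u" "whr (LO \<theta> ts) u" "whr (LL t) u" "whr (LP s t) u"
  "whr (LA t s) u" "whr (LF t) u" "whr (LS t) u"

lemma whr_det: "whr t u \<Longrightarrow> whr t u' \<Longrightarrow> u = u'"
proof (induction arbitrary: u' rule: whr.induct)
  case (whr_beta t s)
  then show ?case by (rule whrE(5)) (auto elim: whrE(3))
next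
  case (whr_fst s t)
  then show ?case by (rule whrE(6)) (auto elim: whrE(4))
next
  case (whr_snd s t)
  then show ?case by (rule whrE(7)) (auto elim: whrE(4))
next
  case (whr_app t t' s)
  from whr_app.prems show ?case
    by (rule whrE(5)) (use whr_app whrE(3) in \<open>blast+\<close>)
next
  case (whr_cfst t t')
  from whr_cfst.prems show ?case
    by (rule whrE(6)) (use whr_cfst whrE(4) in \<open>blast+\<close>)
next
  case (whr_csnd t t')
  from whr_csnd.prems show ?case
    by (rule whrE(7)) (use whr_csnd whrE(4) in \<open>blast+\<close>)
qed

lemma whr_lren: "whr t u \<Longrightarrow> whr (lren f t) (lren f u)"
proof (induction rule: whr.induct)
  case (whr_beta t s)
  have "lsub (case_nat (lren f s) LV) (lren (rup f) t) = lren f (lsub (case_nat s LV) t)"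
  proof -
    have "case_nat (lren f s) LV (rup f i) = lren f (case_nat s LV i)" for i
      by (cases i) (auto simp: rup_def)
    then show ?thesis by (simp add: lsub_lren lren_lsub)
  qed
  then show ?case using whr.whr_beta[of "lren (rup f) t" "lren f s"] by simp
qed (auto intro: whr.intros)

lemma whrs_lren: "whr\<^sup>*\<^sup>* t u \<Longrightarrow> whr\<^sup>*\<^sup>* (lren f t) (lren f u)"
  by (induction rule: rtranclp_induct) (auto intro: whr_lren rtranclp.rtrancl_into_rtrancl)

inductive
  nen :: "('s, 'o) signature \<Rightarrow> 's ctx \<Rightarrow> 'o lt \<Rightarrow> 's ty \<Rightarrow> ('s, 'o) ne \<Rightarrow> bool" and
  nrm :: "('s, 'o) signature \<Rightarrow> 's ctx \<Rightarrow> 's ty \<Rightarrow> 'o lt \<Rightarrow> ('s, 'o) nf \<Rightarrow> bool"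
  for Sg :: "('s, 'o) signature" where
  nen_var: "i < length \<Gamma> \<Longrightarrow> nen Sg \<Gamma> (LV i) (\<Gamma> ! i) (NVar i)"
| nen_op: "Sg \<theta> = Some (\<Delta>, \<tau>) \<Longrightarrow> length ts = length \<Delta> \<Longrightarrow> length ns = length \<Delta> \<Longrightarrow>
    (\<And>i. i < length \<Delta> \<Longrightarrow> nrm Sg \<Gamma> (\<Delta> ! i) (ts ! i) (ns ! i)) \<Longrightarrow> nen Sg \<Gamma> (LO \<theta> ts) \<tau> (NOp \<theta> ns)"
| nen_app: "nen Sg \<Gamma> t (\<sigma> \<rightarrow> \<tau>) n \<Longrightarrow> nrm Sg \<Gamma> \<sigma> s m \<Longrightarrow> nen Sg \<Gamma> (LA t s) \<tau> (NApp n m)"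
| nen_fst: "nen Sg \<Gamma> t (\<sigma> \<otimes> \<tau>) n \<Longrightarrow> nen Sg \<Gamma> (LF t) \<sigma> (NFst n)"
| nen_snd: "nen Sg \<Gamma> t (\<sigma> \<otimes> \<tau>) n \<Longrightarrow> nen Sg \<Gamma> (LS t) \<tau> (NSnd n)"
| nrm_atom: "whr\<^sup>*\<^sup>* t u \<Longrightarrow> nen Sg \<Gamma> u (Atom a) n \<Longrightarrow> nrm Sg \<Gamma> (Atom a) t (NNe n)"
| nrm_arrow: "nrm Sg (\<sigma> # \<Gamma>) \<tau> (LA (lren Suc t) (LV 0)) n \<Longrightarrow> nrm Sg \<Gamma> (\<sigma> \<rightarrow> \<tau>) t (NLam \<sigma> n)"
| nrm_times: "nrm Sg \<Gamma> \<sigma> (LF t) n \<Longrightarrow> nrm Sg \<Gamma> \<tau> (LS t) m \<Longrightarrow> nrm Sg \<Gamma> (\<sigma> \<otimes> \<tau>) t (NPair n m)"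

inductive_cases nenE: "nen Sg \<Gamma> (LV i) \<tau> n" "nen Sg \<Gamma> (LO \<theta> ts) \<tau> n" "nen Sg \<Gamma> (LL t) \<tau> n"
  "nen Sg \<Gamma> (LA t s) \<tau> n" "nen Sg \<Gamma> (LF t) \<tau> n" "nen Sg \<Gamma> (LS t) \<tau> n" "nen Sg \<Gamma> (LP s t) \<tau> n"
inductive_cases nrmE: "nrm Sg \<Gamma> (Atom a) t n" "nrm Sg \<Gamma> (\<sigma> \<rightarrow> \<tau>) t n" "nrm Sg \<Gamma> (\<sigma> \<otimes> \<tau>) t n"

lemma nen_whnf:
  shows "nen Sg \<Gamma> t \<tau> n \<Longrightarrow> \<not> whr t u" and "nrm Sg \<Gamma> \<tau> t' n' \<Longrightarrow> True"
proof (induction arbitrary: u and rule: nen_nrm.inducts)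
  case (nen_app \<Gamma> t \<sigma> \<tau> n s m)
  then show ?case by (auto elim!: whrE elim: nenE)
next
  case (nen_fst \<Gamma> t \<sigma> \<tau> n)
  then show ?case by (auto elim!: whrE elim: nenE)
next
  case (nen_snd \<Gamma> t \<sigma> \<tau> n)
  then show ?case by (auto elim!: whrE elim: nenE)
qed (auto elim: whrE)

lemma whrs_det:
  assumes "whr\<^sup>*\<^sup>* t u" "whr\<^sup>*\<^sup>* t u'" "\<And>v. \<not> whr u v" "\<And>v. \<not> whr u' v"
  shows "u = u'"
  using assms
proof (induction rule: converse_rtranclp_induct)
  case base
  then show ?case by (metis converse_rtranclpE)
next
  case (step y z)
  then show ?case by (metis converse_rtranclpE whr_det)
qed

lemma nrm_det:
  shows "nen Sg \<Gamma> t \<tau> n \<Longrightarrow> nen Sg \<Gamma> t \<tau>' n' \<Longrightarrow> \<tau> = \<tau>' \<and> n = n'"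
    and "nrm Sg \<Gamma> \<tau>'' s m \<Longrightarrow> nrm Sg \<Gamma> \<tau>'' s m' \<Longrightarrow> m = m'"
proof (induction arbitrary: \<tau>' n' and m' rule: nen_nrm.inducts)
  case (nen_op \<theta> \<Delta> \<tau> ts ns \<Gamma>)
  from nen_op.prems obtain \<Delta>' ms where m: "n' = NOp \<theta> ms" "Sg \<theta> = Some (\<Delta>', \<tau>')" "length ms = length \<Delta>'"
    "\<And>i. i < length \<Delta>' \<Longrightarrow> nrm Sg \<Gamma> (\<Delta>' ! i) (ts ! i) (ms ! i)"
    by (rule nenE(2)) blast
  have "\<Delta> = \<Delta>'" "\<tau> = \<tau>'" using m(2) nen_op(1) by auto
  moreover have "ns = ms"
    by (rule nth_equalityI) (use m nen_op \<open>\<Delta> = \<Delta>'\<close> in auto)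
  ultimately show ?case using m(1) by simp
next
  case (nrm_atom t u \<Gamma> a n)
  from nrm_atom.prems obtain u' n' where u': "m' = NNe n'" "whr\<^sup>*\<^sup>* t u'" "nen Sg \<Gamma> u' (Atom a) n'"
    by (auto elim: nrmE)
  have "u = u'"
    by (rule whrs_det[OF nrm_atom.hyps(1) u'(2)])
      (rule nen_whnf(1)[OF nrm_atom(2)], rule nen_whnf(1)[OF u'(3)])
  then show ?case using nrm_atom(3)[of "Atom a" n'] u' by simp
next
  case (nen_var i \<Gamma>) then show ?case by (auto elim: nenE)
next
  case (nen_app \<Gamma> t \<sigma> \<tau> n s m)
  from nen_app.prems show ?case by (rule nenE(4)) (use nen_app in blast)
next
  case (nen_fst \<Gamma> t \<sigma> \<tau> n)
  from nen_fst.prems show ?case by (rule nenE(5)) (use nen_fst in blast)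
next
  case (nen_snd \<Gamma> t \<sigma> \<tau> n)
  from nen_snd.prems show ?case by (rule nenE(6)) (use nen_snd in blast)
next
  case (nrm_arrow \<sigma> \<Gamma> \<tau> t n)
  from nrm_arrow.prems show ?case by (rule nrmE(2)) (use nrm_arrow in blast)
next
  case (nrm_times \<Gamma> \<sigma> t n \<tau> m)
  from nrm_times.prems show ?case by (rule nrmE(3)) (use nrm_times in blast)
qed

fun fren_ne :: "(nat \<Rightarrow> nat) \<Rightarrow> ('s, 'o) ne \<Rightarrow> ('s, 'o) ne"
and fren_nf :: "(nat \<Rightarrow> nat) \<Rightarrow> ('s, 'o) nf \<Rightarrow> ('s, 'o) nf" where
  "fren_ne f (NVar i) = NVar (f i)"
| "fren_ne f (NOp \<theta> ns) = NOp \<theta> (map (fren_nf f) ns)"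
| "fren_ne f (NApp t s) = NApp (fren_ne f t) (fren_nf f s)"
| "fren_ne f (NFst t) = NFst (fren_ne f t)"
| "fren_ne f (NSnd t) = NSnd (fren_ne f t)"
| "fren_nf f (NNe t) = NNe (fren_ne f t)"
| "fren_nf f (NLam \<sigma> t) = NLam \<sigma> (fren_nf (rup f) t)"
| "fren_nf f (NPair s t) = NPair (fren_nf f s) (fren_nf f t)"

definition rty :: "'s ctx \<Rightarrow> 's ctx \<Rightarrow> (nat \<Rightarrow> nat) \<Rightarrow> bool" where
  "rty \<Delta> \<Gamma> f \<longleftrightarrow> (\<forall>i<length \<Gamma>. f i < length \<Delta> \<and> \<Delta> ! f i = \<Gamma> ! i)"

lemma rty_up: "rty \<Delta> \<Gamma> f \<Longrightarrow> rty (\<sigma> # \<Delta>) (\<sigma> # \<Gamma>) (rup f)"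
  by (auto simp: rty_def rup_def less_Suc_eq_0_disj split: nat.split)

lemma rty_Suc: "rty (\<sigma> # \<Gamma>) \<Gamma> Suc"
  by (auto simp: rty_def)

lemma rty_id: "rty \<Gamma> \<Gamma> (\<lambda>i. i)"
  by (auto simp: rty_def)

lemma rty_comp: "rty \<Xi> \<Delta> f \<Longrightarrow> rty \<Delta> \<Gamma> g \<Longrightarrow> rty \<Xi> \<Gamma> (\<lambda>i. f (g i))"
  by (auto simp: rty_def)

lemma nrm_ren:
  shows "nen Sg \<Gamma> t \<tau> n \<Longrightarrow> rty \<Delta> \<Gamma> f \<Longrightarrow> nen Sg \<Delta> (lren f t) \<tau> (fren_ne f n)"
    and "nrm Sg \<Gamma> \<tau>' s m \<Longrightarrow> rty \<Delta> \<Gamma> f \<Longrightarrow> nrm Sg \<Delta> \<tau>' (lren f s) (fren_nf f m)"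
proof (induction arbitrary: \<Delta> f and \<Delta> f rule: nen_nrm.inducts)
  case (nen_var i \<Gamma>)
  then show ?case using nen_nrm.nen_var[of "f i" \<Delta>] by (auto simp: rty_def)
next
  case (nen_op \<theta> \<Delta>' \<tau> ts ns \<Gamma>)
  show ?case using nen_op by (auto intro!: nen_nrm.nen_op)
next
  case (nrm_arrow \<sigma> \<Gamma> \<tau> t n)
  have "lren (rup f) (LA (lren Suc t) (LV 0)) = LA (lren Suc (lren f t)) (LV 0)"
    by (simp add: lren_lren rup_def)
  with nrm_arrow rty_up show ?case by (fastforce intro!: nen_nrm.nrm_arrow)
next
  case (nen_app \<Gamma> t \<sigma> \<tau> n s m)
  then show ?case by (simp del: fren_ne.simps add: fren_ne.simps(3)) (blast intro: nen_nrm.nen_app)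
next
  case (nen_fst \<Gamma> t \<sigma> \<tau> n)
  then show ?case by (simp) (blast intro: nen_nrm.nen_fst)
next
  case (nen_snd \<Gamma> t \<sigma> \<tau> n)
  then show ?case by (simp) (blast intro: nen_nrm.nen_snd)
next
  case (nrm_atom t u \<Gamma> a n)
  then show ?case by (simp) (blast intro: nen_nrm.nrm_atom whrs_lren)
next
  case (nrm_times \<Gamma> \<sigma> t n \<tau> m)
  then show ?case by (simp add: nen_nrm.nrm_times)
qed

lemma nrm_exp: "whr t t' \<Longrightarrow> nrm Sg \<Gamma> \<tau> t' n \<Longrightarrow> nrm Sg \<Gamma> \<tau> t n"
proof (induction \<tau> arbitrary: \<Gamma> t t' n)
  case (Atom a)
  from Atom(2) show ?case
    by (rule nrmE(1)) (use Atom(1) in \<open>auto intro: nrm_atom converse_rtranclp_into_rtranclp\<close>)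
next
  case (Times \<sigma> \<tau>)
  then show ?case using whr_cfst whr_csnd by (auto elim!: nrmE intro!: nrm_times) blast+
next
  case (Arrow \<sigma> \<tau>)
  from Arrow.prems(2) show ?case
    by (rule nrmE(2)) (auto intro!: nrm_arrow intro: Arrow.IH(2) whr_app whr_lren Arrow.prems(1))
qed

fun LR :: "('s, 'o) signature \<Rightarrow> 's ctx \<Rightarrow> 's ty \<Rightarrow> 'o lt \<Rightarrow> 'o lt \<Rightarrow> bool" where
  "LR Sg \<Gamma> (Atom a) s t = (\<exists>n. nrm Sg \<Gamma> (Atom a) s n \<and> nrm Sg \<Gamma> (Atom a) t n)"
| "LR Sg \<Gamma> (\<sigma> \<otimes> \<tau>) s t = (LR Sg \<Gamma> \<sigma> (LF s) (LF t) \<and> LR Sg \<Gamma> \<tau> (LS s) (LS t))"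
| "LR Sg \<Gamma> (\<sigma> \<rightarrow> \<tau>) s t = (\<forall>\<Delta> f a b. rty \<Delta> \<Gamma> f \<longrightarrow> LR Sg \<Delta> \<sigma> a b \<longrightarrow>
     LR Sg \<Delta> \<tau> (LA (lren f s) a) (LA (lren f t) b))"

lemma LR_sym: "LR Sg \<Gamma> \<tau> s t \<Longrightarrow> LR Sg \<Gamma> \<tau> t s"
  by (induction \<tau> arbitrary: \<Gamma> s t) auto

lemma LR_trans: "LR Sg \<Gamma> \<tau> s t \<Longrightarrow> LR Sg \<Gamma> \<tau> t u \<Longrightarrow> LR Sg \<Gamma> \<tau> s u"
proof (induction \<tau> arbitrary: \<Gamma> s t u)
  case (Atom a)
  then show ?case by (auto dest: nrm_det(2))
next
  case (Times \<sigma> \<tau>)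
  then show ?case by (auto; blast)
next
  case (Arrow \<sigma> \<tau>)
  show ?case unfolding LR.simps
  proof (intro allI impI)
    fix \<Delta> f a b assume f: "rty \<Delta> \<Gamma> f" and ab: "LR Sg \<Delta> \<sigma> a b"
    have bb: "LR Sg \<Delta> \<sigma> b b" using Arrow.IH(1) ab LR_sym by blast
    show "LR Sg \<Delta> \<tau> (LA (lren f s) a) (LA (lren f u) b)"
      using Arrow.prems f ab bb Arrow.IH(2) by (meson LR.simps(3))
  qed
qed

lemma LR_mono: "LR Sg \<Gamma> \<tau> s t \<Longrightarrow> rty \<Delta> \<Gamma> f \<Longrightarrow> LR Sg \<Delta> \<tau> (lren f s) (lren f t)"
proof (induction \<tau> arbitrary: \<Gamma> s t \<Delta> f)
  case (Atom a)
  then show ?case by (auto dest: nrm_ren(2))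
next
  case (Times \<sigma> \<tau>)
  then show ?case by fastforce
next
  case (Arrow \<sigma> \<tau>)
  then show ?case by (auto simp: lren_lren rty_comp)
qed

lemma LR_exp: "whr s s' \<Longrightarrow> LR Sg \<Gamma> \<tau> s' t \<Longrightarrow> LR Sg \<Gamma> \<tau> s t"
proof (induction \<tau> arbitrary: \<Gamma> s s' t)
  case (Atom a)
  then show ?case by (auto intro: nrm_exp)
next
  case (Times \<sigma> \<tau>)
  then show ?case using whr_cfst whr_csnd by auto blast+
next
  case (Arrow \<sigma> \<tau>)
  then show ?case by (auto; meson whr_app whr_lren)
qed

lemma LR_exp2: "whr t t' \<Longrightarrow> LR Sg \<Gamma> \<tau> s t' \<Longrightarrow> LR Sg \<Gamma> \<tau> s t"
  using LR_exp LR_sym by blast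

lemma LR_escape:
  shows "LR Sg \<Gamma> \<tau> s t \<Longrightarrow> \<exists>n. nrm Sg \<Gamma> \<tau> s n \<and> nrm Sg \<Gamma> \<tau> t n"
    and "nen Sg \<Gamma> s \<tau> n \<Longrightarrow> nen Sg \<Gamma> t \<tau> n \<Longrightarrow> LR Sg \<Gamma> \<tau> s t"
proof (induction \<tau> arbitrary: \<Gamma> s t n)
  case (Atom a)
  { case 1 then show ?case by simp }
  { case 2 then show ?case by (auto intro: nrm_atom) }
next
  case (Times \<sigma> \<tau>)
  { case 1 then show ?case using Times(1,3) by (fastforce intro: nrm_times) }
  { case 2 then show ?case using Times(2)[OF nen_fst nen_fst] Times(4)[OF nen_snd nen_snd] by auto }
next
  case (Arrow \<sigma> \<tau>)
  { case 1
    have "nen Sg (\<sigma> # \<Gamma>) (LV 0) \<sigma> (NVar 0)" using nen_var[of 0 "\<sigma> # \<Gamma>"] by simp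
    then have "LR Sg (\<sigma> # \<Gamma>) \<sigma> (LV 0) (LV 0)" using Arrow(2) by blast
    then have "LR Sg (\<sigma> # \<Gamma>) \<tau> (LA (lren Suc s) (LV 0)) (LA (lren Suc t) (LV 0))"
      using 1 rty_Suc by auto
    then show ?case using Arrow(3) by (meson nrm_arrow) }
  { case 2
    show ?case unfolding LR.simps
    proof (intro allI impI)
      fix \<Delta> f a b assume f: "rty \<Delta> \<Gamma> f" and ab: "LR Sg \<Delta> \<sigma> a b"
      obtain m where "nrm Sg \<Delta> \<sigma> a m" "nrm Sg \<Delta> \<sigma> b m" using Arrow(1) ab by blast
      then show "LR Sg \<Delta> \<tau> (LA (lren f s) a) (LA (lren f t) b)"
        using Arrow(4) 2 f by (meson nen_app nrm_ren(1))
    qed }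
qed

definition LRS :: "('s, 'o) signature \<Rightarrow> 's ctx \<Rightarrow> 's ctx \<Rightarrow> (nat \<Rightarrow> 'o lt) \<Rightarrow> (nat \<Rightarrow> 'o lt) \<Rightarrow> bool" where
  "LRS Sg \<Delta> \<Gamma> \<delta> \<delta>' \<longleftrightarrow> (\<forall>i<length \<Gamma>. LR Sg \<Delta> (\<Gamma> ! i) (\<delta> i) (\<delta>' i))"

lemma LRS_case: "LRS Sg \<Delta> \<Gamma> \<delta> \<delta>' \<Longrightarrow> LR Sg \<Delta> \<sigma> a b \<Longrightarrow> LRS Sg \<Delta> (\<sigma> # \<Gamma>) (case_nat a \<delta>) (case_nat b \<delta>')"
  by (auto simp: LRS_def less_Suc_eq_0_disj)

lemma LRS_mono: "LRS Sg \<Delta> \<Gamma> \<delta> \<delta>' \<Longrightarrow> rty \<Xi> \<Delta> f \<Longrightarrow> LRS Sg \<Xi> \<Gamma> (\<lambda>i. lren f (\<delta> i)) (\<lambda>i. lren f (\<delta>' i))"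
  by (auto simp: LRS_def LR_mono)

lemma LRS_sym: "LRS Sg \<Delta> \<Gamma> \<delta> \<delta>' \<Longrightarrow> LRS Sg \<Delta> \<Gamma> \<delta>' \<delta>"
  by (auto simp: LRS_def LR_sym)

lemma LRS_trans: "LRS Sg \<Delta> \<Gamma> \<delta> \<delta>' \<Longrightarrow> LRS Sg \<Delta> \<Gamma> \<delta>' \<delta>'' \<Longrightarrow> LRS Sg \<Delta> \<Gamma> \<delta> \<delta>''"
  by (auto simp: LRS_def intro: LR_trans)

lemma LRS_id: "LRS Sg \<Gamma> \<Gamma> LV LV"
  by (auto simp: LRS_def intro!: LR_escape(2) nen_var)

lemma LR_lam:
  assumes "\<And>\<Xi> f a b. rty \<Xi> \<Delta> f \<Longrightarrow> LR Sg \<Xi> \<sigma> a b \<Longrightarrow>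
     LR Sg \<Xi> \<tau> (lsub (case_nat a (\<lambda>i. lren f (\<delta> i))) s) (lsub (case_nat b (\<lambda>i. lren f (\<delta>' i))) t)"
  shows "LR Sg \<Delta> (\<sigma> \<rightarrow> \<tau>) (lsub \<delta> (LL s)) (lsub \<delta>' (LL t))"
  unfolding LR.simps
proof (intro allI impI)
  fix \<Xi> f a b assume "rty \<Xi> \<Delta> f" "LR Sg \<Xi> \<sigma> a b"
  note a = assms[OF this]
  have "whr (LA (lren f (lsub \<delta> (LL s))) a) (lsub (case_nat a (\<lambda>i. lren f (\<delta> i))) s)"
    "whr (LA (lren f (lsub \<delta>' (LL t))) b) (lsub (case_nat b (\<lambda>i. lren f (\<delta>' i))) t)"
    using whr_beta[of "lren (rup f) (lsub (lsup \<delta>) s)" a] whr_beta[of "lren (rup f) (lsub (lsup \<delta>') t)" b]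
    by (simp_all add: inst_up)
  with a show "LR Sg \<Xi> \<tau> (LA (lren f (lsub \<delta> (LL s))) a) (LA (lren f (lsub \<delta>' (LL t))) b)"
    using LR_exp LR_exp2 by blast
qed

lemma LR_app: "LR Sg \<Gamma> (\<sigma> \<rightarrow> \<tau>) s t \<Longrightarrow> LR Sg \<Gamma> \<sigma> a b \<Longrightarrow> LR Sg \<Gamma> \<tau> (LA s a) (LA t b)"
  using rty_id[of \<Gamma>] by fastforce

lemma LR_pair: "LR Sg \<Gamma> \<sigma> s s' \<Longrightarrow> LR Sg \<Gamma> \<tau> t t' \<Longrightarrow> LR Sg \<Gamma> (\<sigma> \<otimes> \<tau>) (LP s t) (LP s' t')"
  by (auto intro: LR_exp[OF whr_fst] LR_exp2[OF whr_fst] LR_exp[OF whr_snd] LR_exp2[OF whr_snd])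

lemma fund:
  shows "Sg \<bar> \<Gamma> \<turnstile> t \<Colon> \<tau> \<Longrightarrow> LRS Sg \<Delta> \<Gamma> \<delta> \<delta>' \<Longrightarrow> LR Sg \<Delta> \<tau> (lsub \<delta> (er Sg t)) (lsub \<delta>' (er Sg t))"
    and "Sg \<bar> \<Gamma> \<turnstile>\<^sub>s \<gamma> \<Colon> \<Xi> \<Longrightarrow> LRS Sg \<Delta> \<Gamma> \<delta> \<delta>' \<Longrightarrow>
      LRS Sg \<Delta> \<Xi> (\<lambda>i. lsub \<delta> (es Sg \<gamma> i)) (\<lambda>i. lsub \<delta>' (es Sg \<gamma> i))"
proof (induction arbitrary: \<Delta> \<delta> \<delta>' and \<Delta> \<delta> \<delta>' rule: tm_ty_sb_ty.inducts)
  case (ty_var \<tau> \<Gamma>)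
  then show ?case by (auto simp: LRS_def)
next
  case (ty_op \<theta> \<Delta>' \<tau>)
  have "\<forall>i<length \<Delta>'. \<exists>n. nrm Sg \<Delta> (\<Delta>' ! i) (\<delta> i) n \<and> nrm Sg \<Delta> (\<Delta>' ! i) (\<delta>' i) n"
    using ty_op LR_escape(1) unfolding LRS_def by blast
  then obtain n where n: "\<forall>i<length \<Delta>'. nrm Sg \<Delta> (\<Delta>' ! i) (\<delta> i) (n i) \<and> nrm Sg \<Delta> (\<Delta>' ! i) (\<delta>' i) (n i)"
    by metis
  have "nen Sg \<Delta> (LO \<theta> (map \<delta> [0..<length \<Delta>'])) \<tau> (NOp \<theta> (map n [0..<length \<Delta>']))"
    "nen Sg \<Delta> (LO \<theta> (map \<delta>' [0..<length \<Delta>'])) \<tau> (NOp \<theta> (map n [0..<length \<Delta>']))"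
    using n ty_op by (auto intro!: nen_op)
  then have "LR Sg \<Delta> \<tau> (LO \<theta> (map \<delta> [0..<length \<Delta>'])) (LO \<theta> (map \<delta>' [0..<length \<Delta>']))"
    by (rule LR_escape(2))
  then show ?case using ty_op(1) by (simp add: comp_def)
next
  case (ty_sub \<Delta>' t \<tau> \<Gamma> \<gamma>)
  then show ?case by (simp add: lsub_lsub)
next
  case (ty_lam \<sigma> \<Gamma> t \<tau>)
  show ?case unfolding er.simps
    by (rule LR_lam, rule ty_lam.IH, rule LRS_case, rule LRS_mono[OF ty_lam.prems])
next
  case (ty_app \<Gamma> t \<sigma> \<tau> s)
  show ?case unfolding er.simps lsub.simps
    by (rule LR_app[OF ty_app.IH(2)[OF ty_app.prems] ty_app.IH(4)[OF ty_app.prems]])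
next
  case (ty_pair \<Gamma> s \<sigma> t \<tau>)
  show ?case unfolding er.simps lsub.simps
    by (rule LR_pair[OF ty_pair.IH(2)[OF ty_pair.prems] ty_pair.IH(4)[OF ty_pair.prems]])
next
  case (ty_ext \<Gamma> \<gamma> \<Xi> t \<tau>)
  then show ?case by (auto simp: LRS_def less_Suc_eq_0_disj)
next
  case (ty_comp \<Delta>' \<gamma> \<Xi> \<Gamma> \<xi>)
  then show ?case by (simp add: lsub_lsub)
qed (auto simp: LRS_def)

lemma case_nat_sub: "(\<lambda>i. lsub \<delta> (case_nat t \<xi> i)) = case_nat (lsub \<delta> t) (\<lambda>i. lsub \<delta> (\<xi> i))"
  by (auto simp: fun_eq_iff split: nat.split)

lemma case_nat_LV: "case_nat (LV 0) (\<lambda>i. LV (Suc i)) = LV"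
  by (auto simp: fun_eq_iff split: nat.split)

lemma fund_same: "Sg \<bar> \<Gamma> \<turnstile> t \<Colon> \<tau> \<Longrightarrow> er Sg t = er Sg t' \<Longrightarrow> LRS Sg \<Delta> \<Gamma> \<delta> \<delta>' \<Longrightarrow>
    LR Sg \<Delta> \<tau> (lsub \<delta> (er Sg t)) (lsub \<delta>' (er Sg t'))"
  using fund(1) by metis

lemma fund_same_sb: "Sg \<bar> \<Gamma> \<turnstile>\<^sub>s \<gamma> \<Colon> \<Xi> \<Longrightarrow> es Sg \<gamma> = es Sg \<gamma>' \<Longrightarrow> LRS Sg \<Delta> \<Gamma> \<delta> \<delta>' \<Longrightarrow>
    LRS Sg \<Delta> \<Xi> (\<lambda>i. lsub \<delta> (es Sg \<gamma> i)) (\<lambda>i. lsub \<delta>' (es Sg \<gamma>' i))"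
  using fund(2) by metis

lemma fund_eq:
  shows "Sg \<bar> \<Gamma> \<turnstile> s \<approx> t \<Colon> \<tau> \<Longrightarrow> LRS Sg \<Delta> \<Gamma> \<delta> \<delta>' \<Longrightarrow> LR Sg \<Delta> \<tau> (lsub \<delta> (er Sg s)) (lsub \<delta>' (er Sg t))"
    and "Sg \<bar> \<Gamma> \<turnstile>\<^sub>s \<gamma> \<approx> \<gamma>' \<Colon> \<Xi> \<Longrightarrow> LRS Sg \<Delta> \<Gamma> \<delta> \<delta>' \<Longrightarrow>
      LRS Sg \<Delta> \<Xi> (\<lambda>i. lsub \<delta> (es Sg \<gamma> i)) (\<lambda>i. lsub \<delta>' (es Sg \<gamma>' i))"
proof (induction arbitrary: \<Delta> \<delta> \<delta>' and \<Delta> \<delta> \<delta>' rule: eq_tm_eq_sb.inducts)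
  case (eq_refl \<Gamma> t \<tau>) then show ?case by (rule fund)
next
  case (eq_sym \<Gamma> s t \<tau>) then show ?case using LRS_sym LR_sym by blast
next
  case (eq_trans \<Gamma> s t \<tau> u) then show ?case using LRS_sym LRS_trans LR_trans by meson
next
  case (eqs_refl \<Gamma> \<gamma> \<Xi>) then show ?case by (rule fund)
next
  case (eqs_sym \<Gamma> s t \<tau>) then show ?case using LRS_sym by blast
next
  case (eqs_trans \<Gamma> s t \<tau> u) then show ?case using LRS_sym LRS_trans by meson
next
  case (cong_sub \<Delta>' t t' \<tau> \<Gamma> \<gamma> \<gamma>')
  then show ?case by (simp add: lsub_lsub)
next
  case (cong_lam \<sigma> \<Gamma> t t' \<tau>)
  show ?case unfolding er.simps
    by (rule LR_lam, rule cong_lam.IH, rule LRS_case, rule LRS_mono[OF cong_lam.prems])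
next
  case (cong_app \<Gamma> t t' \<sigma> \<tau> s s')
  show ?case unfolding er.simps lsub.simps
    by (rule LR_app[OF cong_app.IH(2)[OF cong_app.prems] cong_app.IH(4)[OF cong_app.prems]])
next
  case (cong_pair \<Gamma> s s' \<sigma> t t' \<tau>)
  show ?case unfolding er.simps lsub.simps
    by (rule LR_pair[OF cong_pair.IH(2)[OF cong_pair.prems] cong_pair.IH(4)[OF cong_pair.prems]])
next
  case (cong_fst \<Gamma> t t' \<sigma> \<tau>) then show ?case by fastforce
next
  case (cong_snd \<Gamma> t t' \<sigma> \<tau>) then show ?case by fastforce
next
  case (cong_ext \<Gamma> \<gamma> \<gamma>' \<Xi> t t' \<tau>)
  then show ?case by (auto simp: LRS_def less_Suc_eq_0_disj)
next
  case (cong_comp \<Delta>' \<gamma> \<gamma>' \<Xi> \<Gamma> \<xi> \<xi>')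
  then show ?case by (simp add: lsub_lsub)
next
  case (eq_beta \<sigma> \<Gamma> t \<tau> s)
  have w: "whr (lsub \<delta> (er Sg (TApp (TLam \<sigma> t) s))) (lsub \<delta> (er Sg (TSub t (SExt SId s))))"
    using whr_beta[of "lsub (lsup \<delta>) (er Sg t)" "lsub \<delta> (er Sg s)"]
    unfolding inst er.simps es.simps lsub.simps by (simp only: lsub_lsub case_nat_sub lsub.simps)
  have "Sg \<bar> \<Gamma> \<turnstile> TSub t (SExt SId s) \<Colon> \<tau>" using eq_beta by (auto intro: tm_ty_sb_ty.intros)
  then show ?case using fund(1) eq_beta(3) LR_exp[OF w] by blast
next
  case (eq_eta \<Gamma> t \<sigma> \<tau>)
  have "LR Sg \<Delta> (\<sigma> \<rightarrow> \<tau>) (lsub \<delta> (er Sg t)) (lsub \<delta>' (LL (LA (lren Suc (er Sg t)) (LV 0))))"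
    unfolding LR.simps
  proof (intro allI impI)
    fix \<Xi> f a b assume f: "rty \<Xi> \<Delta> f" and ab: "LR Sg \<Xi> \<sigma> a b"
    have "whr (LA (lren f (lsub \<delta>' (LL (LA (lren Suc (er Sg t)) (LV 0))))) b)
      (lsub (case_nat b (\<lambda>i. lren f (\<delta>' i))) (LA (lren Suc (er Sg t)) (LV 0)))"
      using whr_beta[of "lren (rup f) (lsub (lsup \<delta>') (LA (lren Suc (er Sg t)) (LV 0)))" b]
      unfolding inst_up by simp
    then have w: "whr (LA (lren f (lsub \<delta>' (LL (LA (lren Suc (er Sg t)) (LV 0))))) b)
      (LA (lren f (lsub \<delta>' (er Sg t))) b)" by (simp add: lsub_lren lren_lsub)
    have "LR Sg \<Delta> (\<sigma> \<rightarrow> \<tau>) (lsub \<delta> (er Sg t)) (lsub \<delta>' (er Sg t))" using fund(1) eq_eta by blast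
    then have "LR Sg \<Xi> \<tau> (LA (lren f (lsub \<delta> (er Sg t))) a) (LA (lren f (lsub \<delta>' (er Sg t))) b)"
      using f ab by auto
    then show "LR Sg \<Xi> \<tau> (LA (lren f (lsub \<delta> (er Sg t))) a)
        (LA (lren f (lsub \<delta>' (LL (LA (lren Suc (er Sg t)) (LV 0))))) b)"
      using LR_exp2[OF w] by blast
  qed
  then show ?case by (simp add: lsub_LV_comp)
next
  case (eq_fst \<Gamma> s \<sigma> t \<tau>)
  then show ?case using LR_exp[OF whr_fst] fund(1) by fastforce
next
  case (eq_snd \<Gamma> s \<sigma> t \<tau>)
  then show ?case using LR_exp[OF whr_snd] fund(1) by fastforce
next
  case (eq_pair \<Gamma> t \<sigma> \<tau>)
  have "LR Sg \<Delta> (\<sigma> \<otimes> \<tau>) (lsub \<delta> (er Sg t)) (lsub \<delta>' (er Sg t))" using fund(1) eq_pair by blast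
  then show ?case by (auto intro!: LR_exp2[OF whr_fst] LR_exp2[OF whr_snd])
next
  case (eq_id_left \<Gamma> \<gamma> \<Xi>)
  show ?case by (rule fund_same_sb) (use eq_id_left in \<open>auto intro: tm_ty_sb_ty.intros\<close>)
next
  case (eq_id_right \<Gamma> \<gamma> \<Xi>)
  show ?case by (rule fund_same_sb) (use eq_id_right in \<open>auto intro: tm_ty_sb_ty.intros\<close>)
next
  case (eq_assoc)
  show ?case by (rule fund_same_sb) (use eq_assoc in \<open>auto intro: tm_ty_sb_ty.intros simp: lsub_lsub\<close>)
next
  case (eq_wk_ext)
  show ?case by (rule fund_same_sb) (use eq_wk_ext in \<open>auto intro: tm_ty_sb_ty.intros\<close>)
next
  case (eq_ext_comp)
  show ?case by (rule fund_same_sb) (use eq_ext_comp in \<open>auto intro: tm_ty_sb_ty.intros simp: case_nat_sub\<close>)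
next
  case (eq_sb_eta)
  show ?case by (rule fund_same_sb) (use eq_sb_eta in \<open>auto intro: tm_ty_sb_ty.intros simp: case_nat_LV\<close>)
next
  case (eq_var_ext)
  show ?case by (rule fund_same) (use eq_var_ext in \<open>auto intro: tm_ty_sb_ty.intros\<close>)
next
  case (eq_sub_id)
  show ?case by (rule fund_same) (use eq_sub_id in \<open>auto intro: tm_ty_sb_ty.intros\<close>)
next
  case (eq_sub_comp)
  show ?case by (rule fund_same) (use eq_sub_comp in \<open>auto intro: tm_ty_sb_ty.intros simp: lsub_lsub\<close>)
next
  case (eq_sub_lam)
  show ?case by (rule fund_same) (use eq_sub_lam in \<open>auto intro: tm_ty_sb_ty.intros simp: lsup_def lsub_LV_comp\<close>)
next
  case (eq_sub_app)
  show ?case by (rule fund_same) (use eq_sub_app in \<open>auto intro: tm_ty_sb_ty.intros\<close>)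
next
  case (eq_sub_pair)
  show ?case by (rule fund_same) (use eq_sub_pair in \<open>auto intro: tm_ty_sb_ty.intros\<close>)
next
  case (eq_sub_fst)
  show ?case by (rule fund_same) (use eq_sub_fst in \<open>auto intro: tm_ty_sb_ty.intros\<close>)
next
  case (eq_sub_snd)
  show ?case by (rule fund_same) (use eq_sub_snd in \<open>auto intro: tm_ty_sb_ty.intros\<close>)
qed

lemma er_var [simp]: "er Sg (var i) = LV i"
  by (induction i) auto

lemma es_tuple: "i < length ts \<Longrightarrow> es Sg (tuple \<Gamma> ts) i = er Sg (ts ! i)"
  by (induction ts arbitrary: i) (auto split: nat.split)

lemma nrm_emb:
  shows "ne_ty Sg \<Gamma> n \<tau> \<Longrightarrow> nen Sg \<Gamma> (er Sg (emb_ne \<Gamma> n)) \<tau> n"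
    and "nf_ty Sg \<Gamma> m \<tau>' \<Longrightarrow> nrm Sg \<Gamma> \<tau>' (er Sg (emb_nf \<Gamma> m)) m"
proof (induction rule: ne_ty_nf_ty.inducts)
  case (ne_var i \<Gamma>)
  then show ?case by (auto intro: nen_var)
next
  case (ne_op \<theta> \<Delta> \<tau> \<Gamma> ns)
  have l: "length ns = length \<Delta>" using ne_op(2) list_all2_lengthD by blast
  show ?case
    using ne_op l by (auto simp: es_tuple list_all2_conv_all_nth intro!: nen_op)
next
  case (nf_lam \<sigma> \<Gamma> t \<tau>)
  have "whr (LA (lren Suc (LL (er Sg (emb_nf (\<sigma> # \<Gamma>) t)))) (LV 0)) (er Sg (emb_nf (\<sigma> # \<Gamma>) t))"
  proof -
    show ?thesis
      using whr_beta[of "lren (rup Suc) (er Sg (emb_nf (\<sigma> # \<Gamma>) t))" "LV 0"]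
      by (simp add: lsub_lren case_nat_rup_Suc)
  qed
  then show ?case using nrm_exp nf_lam by (auto intro!: nrm_arrow)
next
  case (nf_pair \<Gamma> s \<sigma> t \<tau>)
  then show ?case by (auto intro!: nrm_times nrm_exp[OF whr_fst] nrm_exp[OF whr_snd])
qed (auto intro: nen_nrm.intros)

theorem nf_unique:
  assumes "nf_ty Sg \<Gamma> n \<tau>" "nf_ty Sg \<Gamma> m \<tau>" "Sg \<bar> \<Gamma> \<turnstile> emb_nf \<Gamma> n \<approx> emb_nf \<Gamma> m \<Colon> \<tau>"
  shows "n = m"
proof -
  have "LR Sg \<Gamma> \<tau> (er Sg (emb_nf \<Gamma> n)) (er Sg (emb_nf \<Gamma> m))"
    using fund_eq(1)[OF assms(3) LRS_id] by simp
  then show ?thesis using LR_escape(1) nrm_emb(2)[OF assms(1)] nrm_emb(2)[OF assms(2)] nrm_det(2) by metis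
qed


section \<open>The encoding of function spaces is injective\<close>

lemmas tm_intros = tm_ty_sb_ty.intros

lemma eq_typed:
  shows "Sg \<bar> \<Gamma> \<turnstile> s \<approx> t \<Colon> \<tau> \<Longrightarrow> (Sg \<bar> \<Gamma> \<turnstile> s \<Colon> \<tau>) \<and> (Sg \<bar> \<Gamma> \<turnstile> t \<Colon> \<tau>)"
    and "Sg \<bar> \<Gamma> \<turnstile>\<^sub>s \<delta> \<approx> \<xi> \<Colon> \<Delta> \<Longrightarrow> (Sg \<bar> \<Gamma> \<turnstile>\<^sub>s \<delta> \<Colon> \<Delta>) \<and> (Sg \<bar> \<Gamma> \<turnstile>\<^sub>s \<xi> \<Colon> \<Delta>)"
  by (induction rule: eq_tm_eq_sb.inducts) (auto intro!: tm_intros intro: tm_intros)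

lemma cls_tm_eq: "Sg \<bar> \<Gamma> \<turnstile> s \<Colon> \<tau> \<Longrightarrow> cls_tm Sg \<Gamma> \<tau> s = cls_tm Sg \<Gamma> \<tau> t \<longleftrightarrow> (Sg \<bar> \<Gamma> \<turnstile> s \<approx> t \<Colon> \<tau>)"
  unfolding cls_tm_def using eq_refl eq_sym eq_trans by blast

lemma cls_tm_eqI: "Sg \<bar> \<Gamma> \<turnstile> s \<approx> t \<Colon> \<tau> \<Longrightarrow> cls_tm Sg \<Gamma> \<tau> s = cls_tm Sg \<Gamma> \<tau> t"
  unfolding cls_tm_def using eq_sym eq_trans by blast

lemma cls_sb_eqI: "Sg \<bar> \<Gamma> \<turnstile>\<^sub>s s \<approx> t \<Colon> \<tau> \<Longrightarrow> cls_sb Sg \<Gamma> \<tau> s = cls_sb Sg \<Gamma> \<tau> t"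
  unfolding cls_sb_def using eqs_sym eqs_trans by blast

lemma c_app_cls: "Sg \<bar> \<Gamma> \<turnstile> t \<Colon> \<sigma> \<rightarrow> \<tau> \<Longrightarrow> Sg \<bar> \<Gamma> \<turnstile> s \<Colon> \<sigma> \<Longrightarrow>
    c_app Sg \<Gamma> \<tau> (cls_tm Sg \<Gamma> (\<sigma> \<rightarrow> \<tau>) t) (cls_tm Sg \<Gamma> \<sigma> s) = cls_tm Sg \<Gamma> \<tau> (TApp t s)"
  unfolding c_app_def cls_tm_def using eq_refl cong_app eq_trans by blast

lemma c_sub_cls: "Sg \<bar> \<Delta> \<turnstile> t \<Colon> \<tau> \<Longrightarrow> Sg \<bar> \<Gamma> \<turnstile>\<^sub>s \<delta> \<Colon> \<Delta> \<Longrightarrow>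
    c_sub Sg \<Gamma> \<tau> (cls_tm Sg \<Delta> \<tau> t) (cls_sb Sg \<Gamma> \<Delta> \<delta>) = cls_tm Sg \<Gamma> \<tau> (TSub t \<delta>)"
  unfolding c_sub_def cls_tm_def cls_sb_def
  by (auto intro: eq_refl eqs_refl) (meson cong_sub eq_trans)

lemma ty_bang: "Sg \<bar> \<Gamma> \<turnstile>\<^sub>s bang \<Gamma> \<Colon> []"
  by (induction \<Gamma>) (auto intro: tm_intros)

lemma ty_vari: "i < length \<Gamma> \<Longrightarrow> Sg \<bar> \<Gamma> \<turnstile> var i \<Colon> \<Gamma> ! i"
proof (induction i arbitrary: \<Gamma>)
  case 0 then show ?case by (cases \<Gamma>) (auto intro: tm_intros)
next
  case (Suc i) then show ?case by (cases \<Gamma>) (auto intro: tm_intros)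
qed

lemma ty_tuple: "list_all2 (tm_ty Sg \<Gamma>) ts \<Delta> \<Longrightarrow> Sg \<bar> \<Gamma> \<turnstile>\<^sub>s tuple \<Gamma> ts \<Colon> \<Delta>"
  by (induction rule: list_all2_induct) (auto intro: tm_intros ty_bang)

lemma bang_comp: "Sg \<bar> \<Gamma> \<turnstile>\<^sub>s \<delta> \<Colon> \<Delta> \<Longrightarrow> Sg \<bar> \<Gamma> \<turnstile>\<^sub>s SComp (bang \<Delta>) \<delta> \<approx> bang \<Gamma> \<Colon> []"
proof -
  have "(Sg \<bar> \<Gamma> \<turnstile> t \<Colon> \<tau> \<longrightarrow> True) \<and> (Sg \<bar> \<Gamma> \<turnstile>\<^sub>s \<delta> \<Colon> \<Delta> \<longrightarrow> (Sg \<bar> \<Gamma> \<turnstile>\<^sub>s SComp (bang \<Delta>) \<delta> \<approx> bang \<Gamma> \<Colon> []))" for t \<tau>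
  proof (induction rule: tm_ty_sb_ty.induct)
    case (ty_id \<Gamma>) then show ?case using ty_bang eq_id_right by blast
  next
    case (ty_wk \<tau> \<Gamma>) then show ?case using ty_bang by (auto intro: eqs_refl tm_intros)
  next
    case (ty_ext \<Gamma> \<delta> \<Delta> t \<tau>)
    have "Sg \<bar> \<Gamma> \<turnstile>\<^sub>s SComp (SComp (bang \<Delta>) SWk) (SExt \<delta> t) \<approx> SComp (bang \<Delta>) (SComp SWk (SExt \<delta> t)) \<Colon> []"
      by (rule eq_assoc) (use ty_ext in \<open>auto intro: ty_bang tm_intros\<close>)
    moreover have "Sg \<bar> \<Gamma> \<turnstile>\<^sub>s SComp (bang \<Delta>) (SComp SWk (SExt \<delta> t)) \<approx> SComp (bang \<Delta>) \<delta> \<Colon> []"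
      by (rule cong_comp) (use ty_ext in \<open>auto intro: ty_bang tm_intros eqs_refl eq_wk_ext\<close>)
    ultimately show ?case using ty_ext eqs_trans by (metis bang.simps(2))
  next
    case (ty_comp \<Delta> \<delta> \<Xi> \<Gamma> \<xi>)
    have "Sg \<bar> \<Gamma> \<turnstile>\<^sub>s SComp (SComp (bang \<Xi>) \<delta>) \<xi> \<approx> SComp (bang \<Xi>) (SComp \<delta> \<xi>) \<Colon> []"
      by (rule eq_assoc) (use ty_comp in \<open>auto intro: ty_bang tm_intros\<close>)
    moreover have "Sg \<bar> \<Gamma> \<turnstile>\<^sub>s SComp (SComp (bang \<Xi>) \<delta>) \<xi> \<approx> SComp (bang \<Delta>) \<xi> \<Colon> []"
      by (rule cong_comp) (use ty_comp in \<open>auto intro: eqs_refl\<close>)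
    ultimately show ?case using ty_comp eqs_trans eqs_sym by meson
  qed auto
  then show "Sg \<bar> \<Gamma> \<turnstile>\<^sub>s \<delta> \<Colon> \<Delta> \<Longrightarrow> ?thesis" by blast
qed

lemma tuple_comp: "list_all2 (tm_ty Sg \<Delta>) ts \<Xi> \<Longrightarrow> Sg \<bar> \<Gamma> \<turnstile>\<^sub>s \<delta> \<Colon> \<Delta> \<Longrightarrow>
    Sg \<bar> \<Gamma> \<turnstile>\<^sub>s SComp (tuple \<Delta> ts) \<delta> \<approx> tuple \<Gamma> (map (\<lambda>t. TSub t \<delta>) ts) \<Colon> \<Xi>"
proof (induction rule: list_all2_induct)
  case Nil then show ?case by (simp add: bang_comp)
next
  case (Cons t ts \<tau> \<Xi>)
  have "Sg \<bar> \<Gamma> \<turnstile>\<^sub>s SComp (SExt (tuple \<Delta> ts) t) \<delta> \<approx> SExt (SComp (tuple \<Delta> ts) \<delta>) (TSub t \<delta>) \<Colon> \<tau> # \<Xi>"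
    by (rule eq_ext_comp) (use Cons ty_tuple in auto)
  moreover have "Sg \<bar> \<Gamma> \<turnstile>\<^sub>s SExt (SComp (tuple \<Delta> ts) \<delta>) (TSub t \<delta>) \<approx> SExt (tuple \<Gamma> (map (\<lambda>t. TSub t \<delta>) ts)) (TSub t \<delta>) \<Colon> \<tau> # \<Xi>"
    by (rule cong_ext) (use Cons in \<open>auto intro: eq_refl tm_intros\<close>)
  ultimately show ?case using eqs_trans by fastforce
qed


lemma var_tuple: "list_all2 (tm_ty Sg \<Gamma>) ts \<Delta> \<Longrightarrow> i < length ts \<Longrightarrow>
    Sg \<bar> \<Gamma> \<turnstile> TSub (var i) (tuple \<Gamma> ts) \<approx> ts ! i \<Colon> \<Delta> ! i"
proof (induction arbitrary: i rule: list_all2_induct)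
  case Nil then show ?case by simp
next
  case (Cons t ts \<tau> \<Delta>)
  note ty = Cons(1,2)
  note tup = ty_tuple[OF ty(2)]
  show ?case
  proof (cases i)
    case 0
    then show ?thesis using eq_var_ext[OF tup ty(1)] by simp
  next
    case (Suc j)
    then have j: "j < length ts" "j < length \<Delta>" using Cons by (auto dest: list_all2_lengthD)
    have "Sg \<bar> \<Gamma> \<turnstile> TSub (TSub (var j) SWk) (SExt (tuple \<Gamma> ts) t) \<approx> TSub (var j) (SComp SWk (SExt (tuple \<Gamma> ts) t)) \<Colon> \<Delta> ! j"
      by (rule eq_sub_comp[OF ty_vari]) (use j ty tup in \<open>auto intro: tm_intros\<close>)
    moreover have "Sg \<bar> \<Gamma> \<turnstile> TSub (var j) (SComp SWk (SExt (tuple \<Gamma> ts) t)) \<approx> TSub (var j) (tuple \<Gamma> ts) \<Colon> \<Delta> ! j"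
      by (rule cong_sub[OF eq_refl[OF ty_vari] eq_wk_ext[OF tup ty(1)]]) (use j in auto)
    ultimately have "Sg \<bar> \<Gamma> \<turnstile> TSub (TSub (var j) SWk) (SExt (tuple \<Gamma> ts) t) \<approx> ts ! j \<Colon> \<Delta> ! j"
      using Cons.IH[OF j(1)] eq_trans by blast
    then show ?thesis using Suc by simp
  qed
qed

lemma tuple_eq: "list_all2 (\<lambda>(s, t) \<tau>. Sg \<bar> \<Gamma> \<turnstile> s \<approx> t \<Colon> \<tau>) us \<Delta> \<Longrightarrow>
    Sg \<bar> \<Gamma> \<turnstile>\<^sub>s tuple \<Gamma> (map fst us) \<approx> tuple \<Gamma> (map snd us) \<Colon> \<Delta>"
  by (induction rule: list_all2_induct) (auto intro: eqs_refl ty_bang cong_ext)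

lemma tuple_eqI:
  assumes "length ss = length \<Delta>" "length ts = length \<Delta>"
    "\<And>i. i < length \<Delta> \<Longrightarrow> Sg \<bar> \<Gamma> \<turnstile> ss ! i \<approx> ts ! i \<Colon> \<Delta> ! i"
  shows "Sg \<bar> \<Gamma> \<turnstile>\<^sub>s tuple \<Gamma> ss \<approx> tuple \<Gamma> ts \<Colon> \<Delta>"
  using tuple_eq[of Sg \<Gamma> "zip ss ts" \<Delta>] assms by (auto simp: list_all2_conv_all_nth)

lemma Ren_ty: "\<rho> \<in> Ren \<Delta> \<Gamma> \<Longrightarrow> list_all2 (tm_ty Sg \<Delta>) (map var \<rho>) \<Gamma>"
  using ty_vari by (fastforce simp: Ren_def list_all2_conv_all_nth)

lemma Ren_nth: "\<rho> \<in> Ren \<Delta> \<Gamma> \<Longrightarrow> i < length \<Gamma> \<Longrightarrow> \<rho> ! i < length \<Delta> \<and> \<Delta> ! (\<rho> ! i) = \<Gamma> ! i"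
  by (auto simp: Ren_def list_all2_conv_all_nth)

lemma Ren_len: "\<rho> \<in> Ren \<Delta> \<Gamma> \<Longrightarrow> length \<rho> = length \<Gamma>"
  by (auto simp: Ren_def list_all2_conv_all_nth)

lemma RenI: "length \<rho> = length \<Gamma> \<Longrightarrow> (\<And>i. i < length \<Gamma> \<Longrightarrow> \<rho> ! i < length \<Delta> \<and> \<Delta> ! (\<rho> ! i) = \<Gamma> ! i) \<Longrightarrow> \<rho> \<in> Ren \<Delta> \<Gamma>"
  by (auto simp: Ren_def list_all2_conv_all_nth)

lemma Ren_id: "ren_id \<Gamma> \<in> Ren \<Gamma> \<Gamma>"
  by (rule RenI) (auto simp: ren_id_def)

lemma Ren_wk: "ren_wk \<Gamma> \<in> Ren (\<sigma> # \<Gamma>) \<Gamma>"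
  by (rule RenI) (auto simp: ren_id_def ren_wk_def)

lemma Ren_comp: "\<rho> \<in> Ren \<Delta> \<Gamma> \<Longrightarrow> \<theta> \<in> Ren \<Xi> \<Delta> \<Longrightarrow> \<rho> \<odot> \<theta> \<in> Ren \<Xi> \<Gamma>"
  by (rule RenI) (auto simp: ren_comp_def Ren_len Ren_nth)

lemma Ren_lift: "\<rho> \<in> Ren \<Delta> \<Gamma> \<Longrightarrow> ren_lift \<rho> \<in> Ren (\<sigma> # \<Delta>) (\<sigma> # \<Gamma>)"
  by (rule RenI) (auto simp: ren_lift_def Ren_len Ren_nth less_Suc_eq_0_disj)

lemma ren_comp_assoc: "\<rho> \<in> Ren \<Delta> \<Gamma> \<Longrightarrow> \<theta> \<in> Ren \<Xi> \<Delta> \<Longrightarrow> (\<rho> \<odot> \<theta>) \<odot> \<zeta> = \<rho> \<odot> (\<theta> \<odot> \<zeta>)"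
  by (rule nth_equalityI) (auto simp: ren_comp_def Ren_len dest: Ren_nth)

lemma ren_lift_comp: "\<rho> \<in> Ren \<Delta> \<Gamma> \<Longrightarrow> \<theta> \<in> Ren \<Xi> \<Delta> \<Longrightarrow> ren_lift \<rho> \<odot> ren_lift \<theta> = ren_lift (\<rho> \<odot> \<theta>)"
  by (rule nth_equalityI) (auto simp: ren_comp_def ren_lift_def Ren_len nth_Cons' Ren_nth)

lemma ren_wk_lift: "\<rho> \<in> Ren \<Delta> \<Gamma> \<Longrightarrow> ren_wk \<Gamma> \<odot> ren_lift \<rho> = \<rho> \<odot> ren_wk \<Delta>"
  by (rule nth_equalityI) (auto simp: ren_comp_def ren_lift_def ren_wk_def ren_id_def Ren_len dest: Ren_nth)

lemma ren_id_left: "\<rho> \<in> Ren \<Delta> \<Gamma> \<Longrightarrow> ren_id \<Gamma> \<odot> \<rho> = \<rho>"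
  by (rule nth_equalityI) (auto simp: ren_comp_def ren_id_def Ren_len dest: Ren_nth)

lemma ren_id_right: "\<rho> \<in> Ren \<Delta> \<Gamma> \<Longrightarrow> \<rho> \<odot> ren_id \<Delta> = \<rho>"
  by (rule nth_equalityI) (auto simp: ren_comp_def ren_id_def Ren_len dest: Ren_nth)

lemma ty_ren_sb: "\<rho> \<in> Ren \<Delta> \<Gamma> \<Longrightarrow> Sg \<bar> \<Delta> \<turnstile>\<^sub>s ren_sb \<Delta> \<rho> \<Colon> \<Gamma>"
  by (auto simp: ren_sb_def intro: ty_tuple Ren_ty)

lemma ren_sb_wk_comp: "\<rho> \<in> Ren \<Delta> \<Gamma> \<Longrightarrow>
   Sg \<bar> \<sigma> # \<Delta> \<turnstile>\<^sub>s SComp (ren_sb \<Delta> \<rho>) SWk \<approx> ren_sb (\<sigma> # \<Delta>) (map Suc \<rho>) \<Colon> \<Gamma>"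
  using tuple_comp[OF Ren_ty ty_wk] by (fastforce simp: ren_sb_def comp_def)

lemma ren_sb_lift: "\<rho> \<in> Ren \<Delta> \<Gamma> \<Longrightarrow>
   Sg \<bar> \<sigma> # \<Delta> \<turnstile>\<^sub>s SExt (SComp (ren_sb \<Delta> \<rho>) SWk) TVar \<approx> ren_sb (\<sigma> # \<Delta>) (ren_lift \<rho>) \<Colon> \<sigma> # \<Gamma>"
  using cong_ext[OF ren_sb_wk_comp eq_refl[OF ty_var]] by (fastforce simp: ren_sb_def ren_lift_def)

lemma ren_sb_id: "Sg \<bar> \<Gamma> \<turnstile>\<^sub>s ren_sb \<Gamma> (ren_id \<Gamma>) \<approx> SId \<Colon> \<Gamma>"
proof (induction \<Gamma>)
  case Nil then show ?case by (auto simp: ren_sb_def ren_id_def intro: eqs_refl tm_intros)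
next
  case (Cons \<sigma> \<Gamma>)
  have e: "ren_id (\<sigma> # \<Gamma>) = ren_lift (ren_id \<Gamma>)"
    by (simp add: ren_id_def ren_lift_def map_Suc_upt upt_conv_Cons del: upt_Suc)
  have "Sg \<bar> \<sigma> # \<Gamma> \<turnstile>\<^sub>s SExt (SComp (ren_sb \<Gamma> (ren_id \<Gamma>)) SWk) TVar \<approx> SExt SWk TVar \<Colon> \<sigma> # \<Gamma>"
    by (rule cong_ext[OF _ eq_refl[OF ty_var]])
      (rule eqs_trans[OF cong_comp[OF Cons eqs_refl[OF ty_wk]] eq_id_left[OF ty_wk]])
  then show ?case unfolding e using ren_sb_lift[OF Ren_id] eq_sb_eta eqs_trans eqs_sym by meson
qed

lemma ren_sb_wk: "Sg \<bar> \<sigma> # \<Gamma> \<turnstile>\<^sub>s ren_sb (\<sigma> # \<Gamma>) (ren_wk \<Gamma>) \<approx> SWk \<Colon> \<Gamma>"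
  unfolding ren_wk_def
  by (rule eqs_trans[OF eqs_sym[OF ren_sb_wk_comp[OF Ren_id]]])
    (rule eqs_trans[OF cong_comp[OF ren_sb_id eqs_refl[OF ty_wk]] eq_id_left[OF ty_wk]])

lemma ren_sb_comp: 
  assumes "\<rho> \<in> Ren \<Delta> \<Gamma>" "\<theta> \<in> Ren \<Xi> \<Delta>"
  shows "Sg \<bar> \<Xi> \<turnstile>\<^sub>s SComp (ren_sb \<Delta> \<rho>) (ren_sb \<Xi> \<theta>) \<approx> ren_sb \<Xi> (\<rho> \<odot> \<theta>) \<Colon> \<Gamma>"
proof -
  have "Sg \<bar> \<Xi> \<turnstile>\<^sub>s tuple \<Xi> (map (\<lambda>t. TSub t (ren_sb \<Xi> \<theta>)) (map var \<rho>)) \<approx> ren_sb \<Xi> (\<rho> \<odot> \<theta>) \<Colon> \<Gamma>"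
    unfolding ren_sb_def[of _ "\<rho> \<odot> \<theta>"]
  proof (rule tuple_eqI)
    fix i assume i: "i < length \<Gamma>"
    show "Sg \<bar> \<Xi> \<turnstile> map (\<lambda>t. TSub t (ren_sb \<Xi> \<theta>)) (map var \<rho>) ! i \<approx> map var (\<rho> \<odot> \<theta>) ! i \<Colon> \<Gamma> ! i"
      using var_tuple[OF Ren_ty[OF assms(2)], of "\<rho> ! i"] i assms
      by (auto simp: ren_sb_def ren_comp_def Ren_len dest!: Ren_nth)
  qed (use assms in \<open>auto simp: Ren_len ren_comp_def\<close>)
  from eqs_trans[OF tuple_comp[OF Ren_ty[OF assms(1)] ty_ren_sb[OF assms(2)]] this]
  show ?thesis unfolding ren_sb_def[of \<Delta> \<rho>] .
qed

lemma ty_emb: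
  shows "ne_ty Sg \<Gamma> n \<tau> \<Longrightarrow> Sg \<bar> \<Gamma> \<turnstile> emb_ne \<Gamma> n \<Colon> \<tau>"
    and "nf_ty Sg \<Gamma> m \<tau>' \<Longrightarrow> Sg \<bar> \<Gamma> \<turnstile> emb_nf \<Gamma> m \<Colon> \<tau>'"
proof (induction rule: ne_ty_nf_ty.inducts)
  case (ne_op \<theta> \<Delta> \<tau> \<Gamma> ns)
  have "list_all2 (tm_ty Sg \<Gamma>) (map (emb_nf \<Gamma>) ns) \<Delta>"
    using ne_op(2) by (auto simp: list_all2_conv_all_nth)
  then show ?case using ne_op(1) ty_tuple by (auto intro!: ty_sub ty_op)
qed (auto intro: tm_intros ty_vari)

lemma ty_ren:
  shows "ne_ty Sg \<Gamma> n \<tau> \<Longrightarrow> \<rho> \<in> Ren \<Delta> \<Gamma> \<Longrightarrow> ne_ty Sg \<Delta> (ren_ne \<rho> n) \<tau>"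
    and "nf_ty Sg \<Gamma> m \<tau>' \<Longrightarrow> \<rho> \<in> Ren \<Delta> \<Gamma> \<Longrightarrow> nf_ty Sg \<Delta> (ren_nf \<rho> m) \<tau>'"
proof (induction arbitrary: \<rho> \<Delta> and \<rho> \<Delta> rule: ne_ty_nf_ty.inducts)
  case (ne_var i \<Gamma>)
  then show ?case using ne_ty_nf_ty.ne_var[of "\<rho> ! i" \<Delta>] Ren_nth[OF ne_var(2,1)] by (metis ren_ne.simps(1))
next
  case (ne_op \<theta> \<Xi> \<tau> \<Gamma> ns)
  then show ?case by (auto intro!: ne_ty_nf_ty.ne_op simp: list_all2_conv_all_nth)
next
  case (ne_app \<Gamma> t \<sigma> \<tau> s)
  then show ?case by simp (blast intro: ne_ty_nf_ty.ne_app)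
next
  case (ne_fst \<Gamma> t \<sigma> \<tau>)
  then show ?case by simp (blast intro: ne_ty_nf_ty.ne_fst)
next
  case (ne_snd \<Gamma> t \<sigma> \<tau>)
  then show ?case by simp (blast intro: ne_ty_nf_ty.ne_snd)
next
  case (nf_lam \<sigma> \<Gamma> t \<tau>)
  then show ?case by (auto intro!: ne_ty_nf_ty.nf_lam Ren_lift)
qed (auto intro: ne_ty_nf_ty.intros)

lemma ren_ren:
  shows "ne_ty Sg \<Gamma> n \<tau> \<Longrightarrow> \<rho> \<in> Ren \<Delta> \<Gamma> \<Longrightarrow> \<theta> \<in> Ren \<Xi> \<Delta> \<Longrightarrow> ren_ne \<theta> (ren_ne \<rho> n) = ren_ne (\<rho> \<odot> \<theta>) n"
    and "nf_ty Sg \<Gamma> m \<tau>' \<Longrightarrow> \<rho> \<in> Ren \<Delta> \<Gamma> \<Longrightarrow> \<theta> \<in> Ren \<Xi> \<Delta> \<Longrightarrow> ren_nf \<theta> (ren_nf \<rho> m) = ren_nf (\<rho> \<odot> \<theta>) m"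
proof (induction arbitrary: \<rho> \<theta> \<Delta> \<Xi> and \<rho> \<theta> \<Delta> \<Xi> rule: ne_ty_nf_ty.inducts)
  case (ne_var i \<Gamma>)
  then show ?case by (auto simp: ren_comp_def Ren_len)
next
  case (ne_op \<theta>' \<Delta>' \<tau> \<Gamma> ns)
  have "ren_nf \<theta> (ren_nf \<rho> (ns ! i)) = ren_nf (\<rho> \<odot> \<theta>) (ns ! i)" if "i < length ns" for i
    using ne_op(2) that ne_op(3,4) unfolding list_all2_conv_all_nth by metis
  then show ?case by (auto simp: in_set_conv_nth)
next
  case (nf_lam \<sigma> \<Gamma> t \<tau>)
  then show ?case using ren_lift_comp[OF nf_lam(3,4)] Ren_lift by fastforce
qed auto

lemma emb_ren:
  shows "ne_ty Sg \<Gamma> n \<tau> \<Longrightarrow> \<rho> \<in> Ren \<Delta> \<Gamma> \<Longrightarrow> Sg \<bar> \<Delta> \<turnstile> TSub (emb_ne \<Gamma> n) (ren_sb \<Delta> \<rho>) \<approx> emb_ne \<Delta> (ren_ne \<rho> n) \<Colon> \<tau>"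
    and "nf_ty Sg \<Gamma> m \<tau>' \<Longrightarrow> \<rho> \<in> Ren \<Delta> \<Gamma> \<Longrightarrow> Sg \<bar> \<Delta> \<turnstile> TSub (emb_nf \<Gamma> m) (ren_sb \<Delta> \<rho>) \<approx> emb_nf \<Delta> (ren_nf \<rho> m) \<Colon> \<tau>'"
proof (induction arbitrary: \<rho> \<Delta> and \<rho> \<Delta> rule: ne_ty_nf_ty.inducts)
  case (ne_var i \<Gamma>)
  then show ?case using var_tuple[OF Ren_ty[OF ne_var(2)], of i Sg] by (auto simp: ren_sb_def Ren_len)
next
  case (ne_op \<theta> \<Xi> \<tau> \<Gamma> ns)
  let ?r = "ren_sb \<Delta> \<rho>"
  have l: "length ns = length \<Xi>" using ne_op(2) list_all2_lengthD by blast
  have ty: "list_all2 (tm_ty Sg \<Gamma>) (map (emb_nf \<Gamma>) ns) \<Xi>"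
    using ne_op(2) by (auto simp: list_all2_conv_all_nth intro!: ty_emb(2))
  have "Sg \<bar> \<Delta> \<turnstile>\<^sub>s tuple \<Delta> (map (\<lambda>t. TSub t ?r) (map (emb_nf \<Gamma>) ns)) \<approx> tuple \<Delta> (map (emb_nf \<Delta>) (map (ren_nf \<rho>) ns)) \<Colon> \<Xi>"
    by (rule tuple_eqI) (use ne_op l in \<open>auto simp: list_all2_conv_all_nth\<close>)
  then have "Sg \<bar> \<Delta> \<turnstile>\<^sub>s SComp (tuple \<Gamma> (map (emb_nf \<Gamma>) ns)) ?r \<approx> tuple \<Delta> (map (emb_nf \<Delta>) (map (ren_nf \<rho>) ns)) \<Colon> \<Xi>"
    using tuple_comp[OF ty ty_ren_sb[OF ne_op(3)]] eqs_trans by blast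
  moreover have op: "Sg \<bar> \<Xi> \<turnstile> TOp \<theta> \<Colon> \<tau>" using ne_op(1) by (rule ty_op)
  ultimately show ?case
    using eq_trans[OF eq_sub_comp[OF op ty_tuple[OF ty] ty_ren_sb[OF ne_op(3)]]
      cong_sub[OF eq_refl[OF op]]] by simp
next
  case (ne_app \<Gamma> t \<sigma> \<tau> s)
  show ?case unfolding emb_ne.simps ren_ne.simps
    by (rule eq_trans[OF eq_sub_app[OF ty_emb(1)[OF ne_app(1)] ty_emb(2)[OF ne_app(3)] ty_ren_sb] cong_app])
      (use ne_app in auto)
next
  case (ne_fst \<Gamma> t \<sigma> \<tau>)
  show ?case unfolding emb_ne.simps ren_ne.simps
    by (rule eq_trans[OF eq_sub_fst[OF ty_emb(1)[OF ne_fst(1)] ty_ren_sb] cong_fst]) (use ne_fst in auto)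
next
  case (ne_snd \<Gamma> t \<sigma> \<tau>)
  show ?case unfolding emb_ne.simps ren_ne.simps
    by (rule eq_trans[OF eq_sub_snd[OF ty_emb(1)[OF ne_snd(1)] ty_ren_sb] cong_snd]) (use ne_snd in auto)
next
  case (nf_ne \<Gamma> t a)
  then show ?case by simp
next
  case (nf_lam \<sigma> \<Gamma> t \<tau>)
  have "Sg \<bar> \<sigma> # \<Delta> \<turnstile> TSub (emb_nf (\<sigma> # \<Gamma>) t) (SExt (SComp (ren_sb \<Delta> \<rho>) SWk) TVar) \<approx> emb_nf (\<sigma> # \<Delta>) (ren_nf (ren_lift \<rho>) t) \<Colon> \<tau>"
    by (rule eq_trans[OF cong_sub[OF eq_refl[OF ty_emb(2)[OF nf_lam(1)]] ren_sb_lift[OF nf_lam(3)]]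
      nf_lam(2)[OF Ren_lift[OF nf_lam(3)]]])
  then show ?case unfolding emb_nf.simps ren_nf.simps
    using eq_trans[OF eq_sub_lam[OF ty_emb(2)[OF nf_lam(1)] ty_ren_sb[OF nf_lam(3)]] cong_lam] by blast
next
  case (nf_pair \<Gamma> s \<sigma> t \<tau>)
  show ?case unfolding emb_nf.simps ren_nf.simps
    by (rule eq_trans[OF eq_sub_pair[OF ty_emb(2)[OF nf_pair(1)] ty_emb(2)[OF nf_pair(3)] ty_ren_sb] cong_pair])
      (use nf_pair in auto)
qed

lemma tm_act_cls: "Sg \<bar> \<Gamma> \<turnstile> t \<Colon> \<tau> \<Longrightarrow> \<rho> \<in> Ren \<Delta> \<Gamma> \<Longrightarrow>
    tm_act Sg \<tau> \<Gamma> \<Delta> \<rho> (cls_tm Sg \<Gamma> \<tau> t) = cls_tm Sg \<Delta> \<tau> (TSub t (ren_sb \<Delta> \<rho>))"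
  unfolding tm_act_def by (rule c_sub_cls) (auto intro: ty_ren_sb)

lemma tm_act_Hom: "T \<in> Hom_tm Sg \<Gamma> \<tau> \<Longrightarrow> \<rho> \<in> Ren \<Delta> \<Gamma> \<Longrightarrow> tm_act Sg \<tau> \<Gamma> \<Delta> \<rho> T \<in> Hom_tm Sg \<Delta> \<tau>"
  using ty_sub ty_ren_sb by (fastforce simp: Hom_tm_def tm_act_cls)

lemma tm_act_comp: "T \<in> Hom_tm Sg \<Gamma> \<tau> \<Longrightarrow> \<rho> \<in> Ren \<Delta> \<Gamma> \<Longrightarrow> \<theta> \<in> Ren \<Xi> \<Delta> \<Longrightarrow>
    tm_act Sg \<tau> \<Delta> \<Xi> \<theta> (tm_act Sg \<tau> \<Gamma> \<Delta> \<rho> T) = tm_act Sg \<tau> \<Gamma> \<Xi> (\<rho> \<odot> \<theta>) T"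
proof -
  assume a: "T \<in> Hom_tm Sg \<Gamma> \<tau>" "\<rho> \<in> Ren \<Delta> \<Gamma>" "\<theta> \<in> Ren \<Xi> \<Delta>"
  then obtain t where t: "Sg \<bar> \<Gamma> \<turnstile> t \<Colon> \<tau>" "T = cls_tm Sg \<Gamma> \<tau> t" by (auto simp: Hom_tm_def)
  have "Sg \<bar> \<Xi> \<turnstile> TSub (TSub t (ren_sb \<Delta> \<rho>)) (ren_sb \<Xi> \<theta>) \<approx> TSub t (ren_sb \<Xi> (\<rho> \<odot> \<theta>)) \<Colon> \<tau>"
    using eq_trans[OF eq_sub_comp[OF t(1) ty_ren_sb[OF a(2)] ty_ren_sb[OF a(3)]]
      cong_sub[OF eq_refl[OF t(1)] ren_sb_comp[OF a(2,3)]]] .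
  then show ?thesis using a t ty_sub[OF t(1) ty_ren_sb[OF a(2)]]
    by (simp add: tm_act_cls Ren_comp cls_tm_eqI)
qed

lemma tm_act_id: "T \<in> Hom_tm Sg \<Gamma> \<tau> \<Longrightarrow> tm_act Sg \<tau> \<Gamma> \<Gamma> (ren_id \<Gamma>) T = T"
proof -
  assume "T \<in> Hom_tm Sg \<Gamma> \<tau>"
  then obtain t where t: "Sg \<bar> \<Gamma> \<turnstile> t \<Colon> \<tau>" "T = cls_tm Sg \<Gamma> \<tau> t" by (auto simp: Hom_tm_def)
  have "Sg \<bar> \<Gamma> \<turnstile> TSub t (ren_sb \<Gamma> (ren_id \<Gamma>)) \<approx> t \<Colon> \<tau>"
    using eq_trans[OF cong_sub[OF eq_refl[OF t(1)] ren_sb_id] eq_sub_id[OF t(1)]] .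
  then show ?thesis using t by (simp add: tm_act_cls Ren_id cls_tm_eqI)
qed

lemma down_ne_Hom: "ne_ty Sg \<Gamma> n \<tau> \<Longrightarrow> down_ne Sg \<tau> \<Gamma> n \<in> Hom_tm Sg \<Gamma> \<tau>"
  unfolding down_ne_def Hom_tm_def using ty_emb(1)[of Sg \<Gamma> n \<tau>] by blast

lemma down_ne_ren: "ne_ty Sg \<Gamma> n \<tau> \<Longrightarrow> \<rho> \<in> Ren \<Delta> \<Gamma> \<Longrightarrow>
    tm_act Sg \<tau> \<Gamma> \<Delta> \<rho> (down_ne Sg \<tau> \<Gamma> n) = down_ne Sg \<tau> \<Delta> (ren_ne \<rho> n)"
  unfolding down_ne_def using ty_emb(1)[of Sg \<Gamma> n \<tau>] emb_ren(1)[of Sg \<Gamma> n \<tau> \<rho> \<Delta>]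
  by (simp add: tm_act_cls cls_tm_eqI)

lemma down_nf_ren: "nf_ty Sg \<Gamma> n \<tau> \<Longrightarrow> \<rho> \<in> Ren \<Delta> \<Gamma> \<Longrightarrow>
    tm_act Sg \<tau> \<Gamma> \<Delta> \<rho> (down_nf Sg \<tau> \<Gamma> n) = down_nf Sg \<tau> \<Delta> (ren_nf \<rho> n)"
  unfolding down_nf_def using ty_emb(2)[of Sg \<Gamma> n \<tau>] emb_ren(2)[of Sg \<Gamma> n \<tau> \<rho> \<Delta>]
  by (simp add: tm_act_cls cls_tm_eqI)

definition good :: "('s, 'o) signature \<Rightarrow> 's ty \<Rightarrow> ('s, 'o) sem \<Rightarrow> bool" where
  "good Sg \<tau> A \<longleftrightarrow>
     (\<forall>\<Gamma> n. ne_ty Sg \<Gamma> n \<tau> \<longrightarrow> reflect A \<Gamma> n \<in> car A \<Gamma>) \<and>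
     (\<forall>\<Gamma> v. v \<in> car A \<Gamma> \<longrightarrow> nf_ty Sg \<Gamma> (reify A \<Gamma> v) \<tau>) \<and>
     (\<forall>\<Gamma> n. ne_ty Sg \<Gamma> n \<tau> \<longrightarrow> (Sg \<bar> \<Gamma> \<turnstile> emb_nf \<Gamma> (reify A \<Gamma> (reflect A \<Gamma> n)) \<approx> emb_ne \<Gamma> n \<Colon> \<tau>)) \<and>
     (\<forall>\<Gamma> \<Delta> \<rho> n. ne_ty Sg \<Gamma> n \<tau> \<longrightarrow> \<rho> \<in> Ren \<Delta> \<Gamma> \<longrightarrow> act A \<Gamma> \<Delta> \<rho> (reflect A \<Gamma> n) = reflect A \<Delta> (ren_ne \<rho> n)) \<and>
     (\<forall>\<Gamma> \<Delta> \<rho> v. v \<in> car A \<Gamma> \<longrightarrow> \<rho> \<in> Ren \<Delta> \<Gamma> \<longrightarrow> reify A \<Delta> (act A \<Gamma> \<Delta> \<rho> v) = ren_nf \<rho> (reify A \<Gamma> v)) \<and>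
     (\<forall>\<Gamma>. inj_on (reify A \<Gamma>) (car A \<Gamma>)) \<and>
     (\<forall>\<Gamma> \<Delta> \<rho> v. v \<in> car A \<Gamma> \<longrightarrow> \<rho> \<in> Ren \<Delta> \<Gamma> \<longrightarrow> act A \<Gamma> \<Delta> \<rho> v \<in> car A \<Delta>)"

lemma goodD:
  assumes "good Sg \<tau> A"
  shows "ne_ty Sg \<Gamma> n \<tau> \<Longrightarrow> reflect A \<Gamma> n \<in> car A \<Gamma>"
    and "v \<in> car A \<Gamma> \<Longrightarrow> nf_ty Sg \<Gamma> (reify A \<Gamma> v) \<tau>"
    and "ne_ty Sg \<Gamma> n \<tau> \<Longrightarrow> Sg \<bar> \<Gamma> \<turnstile> emb_nf \<Gamma> (reify A \<Gamma> (reflect A \<Gamma> n)) \<approx> emb_ne \<Gamma> n \<Colon> \<tau>"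
    and "ne_ty Sg \<Gamma> n \<tau> \<Longrightarrow> \<rho> \<in> Ren \<Delta> \<Gamma> \<Longrightarrow> act A \<Gamma> \<Delta> \<rho> (reflect A \<Gamma> n) = reflect A \<Delta> (ren_ne \<rho> n)"
    and "v \<in> car A \<Gamma> \<Longrightarrow> \<rho> \<in> Ren \<Delta> \<Gamma> \<Longrightarrow> reify A \<Delta> (act A \<Gamma> \<Delta> \<rho> v) = ren_nf \<rho> (reify A \<Gamma> v)"
    and "inj_on (reify A \<Gamma>) (car A \<Gamma>)"
    and "v \<in> car A \<Gamma> \<Longrightarrow> \<rho> \<in> Ren \<Delta> \<Gamma> \<Longrightarrow> act A \<Gamma> \<Delta> \<rho> v \<in> car A \<Delta>"
  using assms unfolding good_def by blast+

lemma good_atom: "good Sg (Atom a) (sem_atom Sg a)"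
  unfolding good_def sem_atom_def NF_def
  by (auto intro: nf_ne eq_refl ty_emb ty_ren inj_onI)

lemma good_times:
  assumes A: "good Sg \<sigma> A" and B: "good Sg \<tau> B"
  shows "good Sg (\<sigma> \<otimes> \<tau>) (sem_times A B)"
proof -
  have e: "Sg \<bar> \<Gamma> \<turnstile> TPair (emb_nf \<Gamma> (reify A \<Gamma> (reflect A \<Gamma> (NFst n)))) (emb_nf \<Gamma> (reify B \<Gamma> (reflect B \<Gamma> (NSnd n))))
     \<approx> emb_ne \<Gamma> n \<Colon> \<sigma> \<otimes> \<tau>" if n: "ne_ty Sg \<Gamma> n (\<sigma> \<otimes> \<tau>)" for \<Gamma> n
    using eq_trans[OF cong_pair[OF goodD(3)[OF A ne_fst[OF n]] goodD(3)[OF B ne_snd[OF n]]]]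
      eq_sym[OF eq_pair[OF ty_emb(1)[OF n]]] by simp
  have n1: "reflect A \<Gamma> (NFst n) \<in> car A \<Gamma>" "reflect B \<Gamma> (NSnd n) \<in> car B \<Gamma>"
    if "ne_ty Sg \<Gamma> n (\<sigma> \<otimes> \<tau>)" for \<Gamma> n
    using goodD(1)[OF A ne_fst[OF that]] goodD(1)[OF B ne_snd[OF that]] by auto
  have n2: "act A \<Gamma> \<Delta> \<rho> (reflect A \<Gamma> (NFst n)) = reflect A \<Delta> (NFst (ren_ne \<rho> n))"
    "act B \<Gamma> \<Delta> \<rho> (reflect B \<Gamma> (NSnd n)) = reflect B \<Delta> (NSnd (ren_ne \<rho> n))"
    if "ne_ty Sg \<Gamma> n (\<sigma> \<otimes> \<tau>)" "\<rho> \<in> Ren \<Delta> \<Gamma>" for \<Gamma> \<Delta> \<rho> n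
    using goodD(4)[OF A ne_fst[OF that(1)] that(2)] goodD(4)[OF B ne_snd[OF that(1)] that(2)] by auto
  have inj: "inj_on (\<lambda>v. NPair (reify A \<Gamma> (vfst v)) (reify B \<Gamma> (vsnd v)))
      {VPair a b |a b. a \<in> car A \<Gamma> \<and> b \<in> car B \<Gamma>}" for \<Gamma>
    using goodD(6)[OF A, of \<Gamma>] goodD(6)[OF B, of \<Gamma>] by (auto simp: inj_on_def)
  show ?thesis
    unfolding good_def sem_times_def
    using e n1 n2 inj by (auto intro!: nf_pair goodD(2,5,7)[OF A] goodD(2,5,7)[OF B])
qed

context
  fixes Sg :: "('s, 'o) signature" and \<sigma> \<tau> A B
  assumes A: "good Sg \<sigma> A" and B: "good Sg \<tau> B"
begin

lemma pb_inj: "inj_on encode (pullback Sg \<sigma> \<tau> A B \<Gamma>)"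
proof (rule inj_onI)
  fix p p' assume p: "p \<in> pullback Sg \<sigma> \<tau> A B \<Gamma>" and p': "p' \<in> pullback Sg \<sigma> \<tau> A B \<Gamma>"
    and e: "encode p = encode p'"
  obtain t F where tF: "p = (t, F)" by force
  obtain F' where tF': "p' = (t, F')" using e tF by (cases p') (auto simp: encode_def)
  have "F \<Delta> \<rho> v = F' \<Delta> \<rho> v" for \<Delta> \<rho> v
  proof (cases "\<rho> \<in> Ren \<Delta> \<Gamma> \<and> v \<in> car A \<Delta>")
    case True
    then have c: "F \<Delta> \<rho> v \<in> car B \<Delta>" "F' \<Delta> \<rho> v \<in> car B \<Delta>"
      and d: "down_nf Sg \<tau> \<Delta> (reify B \<Delta> (F \<Delta> \<rho> v)) = down_nf Sg \<tau> \<Delta> (reify B \<Delta> (F' \<Delta> \<rho> v))"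
      using p p' unfolding tF tF' pullback_def expo_def by auto
    note n = goodD(2)[OF B c(1)] goodD(2)[OF B c(2)]
    have "Sg \<bar> \<Delta> \<turnstile> emb_nf \<Delta> (reify B \<Delta> (F \<Delta> \<rho> v)) \<approx> emb_nf \<Delta> (reify B \<Delta> (F' \<Delta> \<rho> v)) \<Colon> \<tau>"
      using d cls_tm_eq[OF ty_emb(2)[OF n(1)]] by (simp add: down_nf_def)
    then show ?thesis using nf_unique n goodD(6)[OF B] c by (meson inj_onD)
  next
    case False
    have "F = restr A \<Gamma> F" "F' = restr A \<Gamma> F'"
      using p p' unfolding tF tF' pullback_def expo_def by auto
    then show ?thesis using False by (metis restr_def)
  qed
  then show "p = p'" using tF tF' by blast
qed

lemma decode_encode: "p \<in> pullback Sg \<sigma> \<tau> A B \<Gamma> \<Longrightarrow> decode Sg \<sigma> \<tau> A B \<Gamma> (encode p) = p"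
  unfolding decode_def using pb_inj by (rule inv_into_f_f)

lemma pbD:
  assumes "(t, F) \<in> pullback Sg \<sigma> \<tau> A B \<Gamma>"
  shows "t \<in> Hom_tm Sg \<Gamma> (\<sigma> \<rightarrow> \<tau>)"
    and "\<rho> \<in> Ren \<Delta> \<Gamma> \<Longrightarrow> v \<in> car A \<Delta> \<Longrightarrow> F \<Delta> \<rho> v \<in> car B \<Delta>"
    and "\<rho> \<in> Ren \<Delta> \<Gamma> \<Longrightarrow> \<theta> \<in> Ren \<Xi> \<Delta> \<Longrightarrow> v \<in> car A \<Delta> \<Longrightarrow>
      F \<Xi> (\<rho> \<odot> \<theta>) (act A \<Delta> \<Xi> \<theta> v) = act B \<Delta> \<Xi> \<theta> (F \<Delta> \<rho> v)"
    and "\<rho> \<in> Ren \<Delta> \<Gamma> \<Longrightarrow> v \<in> car A \<Delta> \<Longrightarrow> down_nf Sg \<tau> \<Delta> (reify B \<Delta> (F \<Delta> \<rho> v))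
            = c_app Sg \<Delta> \<tau> (tm_act Sg (\<sigma> \<rightarrow> \<tau>) \<Gamma> \<Delta> \<rho> t) (down_nf Sg \<sigma> \<Delta> (reify A \<Delta> v))"
  using assms unfolding pullback_def expo_def by auto

lemma pbI:
  assumes "t \<in> Hom_tm Sg \<Gamma> (\<sigma> \<rightarrow> \<tau>)"
    and "\<And>\<Delta> \<rho> v. \<rho> \<in> Ren \<Delta> \<Gamma> \<Longrightarrow> v \<in> car A \<Delta> \<Longrightarrow> F \<Delta> \<rho> v \<in> car B \<Delta>"
    and "\<And>\<Delta> \<Xi> \<rho> \<theta> v. \<rho> \<in> Ren \<Delta> \<Gamma> \<Longrightarrow> \<theta> \<in> Ren \<Xi> \<Delta> \<Longrightarrow> v \<in> car A \<Delta> \<Longrightarrow>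
      F \<Xi> (\<rho> \<odot> \<theta>) (act A \<Delta> \<Xi> \<theta> v) = act B \<Delta> \<Xi> \<theta> (F \<Delta> \<rho> v)"
    and "\<And>\<Delta> \<rho> v. \<rho> \<in> Ren \<Delta> \<Gamma> \<Longrightarrow> v \<in> car A \<Delta> \<Longrightarrow> down_nf Sg \<tau> \<Delta> (reify B \<Delta> (F \<Delta> \<rho> v))
            = c_app Sg \<Delta> \<tau> (tm_act Sg (\<sigma> \<rightarrow> \<tau>) \<Gamma> \<Delta> \<rho> t) (down_nf Sg \<sigma> \<Delta> (reify A \<Delta> v))"
  shows "(t, restr A \<Gamma> F) \<in> pullback Sg \<sigma> \<tau> A B \<Gamma>"
  using assms unfolding pullback_def expo_def
  by (auto simp: restr_def fun_eq_iff Ren_comp goodD(7)[OF A])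

lemma reflect_pb:
  assumes n: "ne_ty Sg \<Gamma> n (\<sigma> \<rightarrow> \<tau>)"
  shows "(down_ne Sg (\<sigma> \<rightarrow> \<tau>) \<Gamma> n, restr A \<Gamma> (\<lambda>\<Delta> \<rho> v. reflect B \<Delta> (NApp (ren_ne \<rho> n) (reify A \<Delta> v))))
    \<in> pullback Sg \<sigma> \<tau> A B \<Gamma>"
proof (rule pbI)
  have ap: "ne_ty Sg \<Delta> (NApp (ren_ne \<rho> n) (reify A \<Delta> v)) \<tau>" if "\<rho> \<in> Ren \<Delta> \<Gamma>" "v \<in> car A \<Delta>" for \<Delta> \<rho> v
    by (rule ne_app[OF ty_ren(1)[OF n that(1)] goodD(2)[OF A that(2)]])
  show "down_ne Sg (\<sigma> \<rightarrow> \<tau>) \<Gamma> n \<in> Hom_tm Sg \<Gamma> (\<sigma> \<rightarrow> \<tau>)" by (rule down_ne_Hom[OF n])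
  fix \<Delta> \<rho> v assume r: "\<rho> \<in> Ren \<Delta> \<Gamma>" and v: "v \<in> car A \<Delta>"
  show "reflect B \<Delta> (NApp (ren_ne \<rho> n) (reify A \<Delta> v)) \<in> car B \<Delta>"
    by (rule goodD(1)[OF B ap[OF r v]])
  show "down_nf Sg \<tau> \<Delta> (reify B \<Delta> (reflect B \<Delta> (NApp (ren_ne \<rho> n) (reify A \<Delta> v))))
      = c_app Sg \<Delta> \<tau> (tm_act Sg (\<sigma> \<rightarrow> \<tau>) \<Gamma> \<Delta> \<rho> (down_ne Sg (\<sigma> \<rightarrow> \<tau>) \<Gamma> n)) (down_nf Sg \<sigma> \<Delta> (reify A \<Delta> v))"
    unfolding down_ne_ren[OF n r] unfolding down_ne_def down_nf_def
    unfolding c_app_cls[OF ty_emb(1)[OF ty_ren(1)[OF n r]] ty_emb(2)[OF goodD(2)[OF A v]]]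
    using cls_tm_eqI[OF goodD(3)[OF B ap[OF r v]]] by simp
  fix \<Xi> \<theta> assume th: "\<theta> \<in> Ren \<Xi> \<Delta>"
  show "reflect B \<Xi> (NApp (ren_ne (\<rho> \<odot> \<theta>) n) (reify A \<Xi> (act A \<Delta> \<Xi> \<theta> v)))
    = act B \<Delta> \<Xi> \<theta> (reflect B \<Delta> (NApp (ren_ne \<rho> n) (reify A \<Delta> v)))"
    unfolding goodD(4)[OF B ap[OF r v] th] goodD(5)[OF A v th] ren_ren(1)[OF n r th, symmetric] by simp
qed

lemma act_pb:
  assumes p: "(t, F) \<in> pullback Sg \<sigma> \<tau> A B \<Gamma>" and r: "\<rho> \<in> Ren \<Delta> \<Gamma>"
  shows "(tm_act Sg (\<sigma> \<rightarrow> \<tau>) \<Gamma> \<Delta> \<rho> t, expo_act A \<Delta> \<rho> F) \<in> pullback Sg \<sigma> \<tau> A B \<Delta>"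
  unfolding expo_act_def
proof (rule pbI)
  show "tm_act Sg (\<sigma> \<rightarrow> \<tau>) \<Gamma> \<Delta> \<rho> t \<in> Hom_tm Sg \<Delta> (\<sigma> \<rightarrow> \<tau>)" by (rule tm_act_Hom[OF pbD(1)[OF p] r])
  fix \<Xi> \<theta> v assume th: "\<theta> \<in> Ren \<Xi> \<Delta>" and v: "v \<in> car A \<Xi>"
  note c = Ren_comp[OF r th]
  show "F \<Xi> (\<rho> \<odot> \<theta>) v \<in> car B \<Xi>" by (rule pbD(2)[OF p c v])
  show "down_nf Sg \<tau> \<Xi> (reify B \<Xi> (F \<Xi> (\<rho> \<odot> \<theta>) v)) = c_app Sg \<Xi> \<tau>
      (tm_act Sg (\<sigma> \<rightarrow> \<tau>) \<Delta> \<Xi> \<theta> (tm_act Sg (\<sigma> \<rightarrow> \<tau>) \<Gamma> \<Delta> \<rho> t)) (down_nf Sg \<sigma> \<Xi> (reify A \<Xi> v))"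
    unfolding tm_act_comp[OF pbD(1)[OF p] r th] by (rule pbD(4)[OF p c v])
  fix \<Theta> \<zeta> assume z: "\<zeta> \<in> Ren \<Theta> \<Xi>"
  show "F \<Theta> (\<rho> \<odot> (\<theta> \<odot> \<zeta>)) (act A \<Xi> \<Theta> \<zeta> v) = act B \<Xi> \<Theta> \<zeta> (F \<Xi> (\<rho> \<odot> \<theta>) v)"
    using pbD(3)[OF p c z v] ren_comp_assoc[OF r th] by simp
qed

lemma fresh: "ne_ty Sg (\<sigma> # \<Gamma>) (NVar 0) \<sigma>"
  using ne_var[of 0 "\<sigma> # \<Gamma>" Sg] by simp

lemma glue_pb:
  assumes p: "(t, F) \<in> pullback Sg \<sigma> \<tau> A B \<Gamma>"
  defines "n \<equiv> reify B (\<sigma> # \<Gamma>) (F (\<sigma> # \<Gamma>) (ren_wk \<Gamma>) (reflect A (\<sigma> # \<Gamma>) (NVar 0)))"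
  shows "nf_ty Sg (\<sigma> # \<Gamma>) n \<tau>" and "down_nf Sg (\<sigma> \<rightarrow> \<tau>) \<Gamma> (NLam \<sigma> n) = t"
proof -
  note x = goodD(1)[OF A fresh[of \<Gamma>]]
  note Fx = pbD(2)[OF p Ren_wk x]
  show n: "nf_ty Sg (\<sigma> # \<Gamma>) n \<tau>" unfolding n_def by (rule goodD(2)[OF B Fx])
  obtain t0 where t: "Sg \<bar> \<Gamma> \<turnstile> t0 \<Colon> \<sigma> \<rightarrow> \<tau>" "t = cls_tm Sg \<Gamma> (\<sigma> \<rightarrow> \<tau>) t0"
    using pbD(1)[OF p] by (auto simp: Hom_tm_def)
  let ?t = "TSub t0 (ren_sb (\<sigma> # \<Gamma>) (ren_wk \<Gamma>))"
  let ?x = "emb_nf (\<sigma> # \<Gamma>) (reify A (\<sigma> # \<Gamma>) (reflect A (\<sigma> # \<Gamma>) (NVar 0)))"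
  have t': "Sg \<bar> \<sigma> # \<Gamma> \<turnstile> ?t \<Colon> \<sigma> \<rightarrow> \<tau>" by (rule ty_sub[OF t(1) ty_ren_sb[OF Ren_wk]])
  have x': "Sg \<bar> \<sigma> # \<Gamma> \<turnstile> ?x \<Colon> \<sigma>" by (rule ty_emb(2)[OF goodD(2)[OF A x]])
  have "down_nf Sg \<tau> (\<sigma> # \<Gamma>) n = cls_tm Sg (\<sigma> # \<Gamma>) \<tau> (TApp ?t ?x)"
    using pbD(4)[OF p Ren_wk x] c_app_cls[OF t' x'] tm_act_cls[OF t(1) Ren_wk]
    unfolding t(2) n_def down_nf_def by simp
  then have "Sg \<bar> \<sigma> # \<Gamma> \<turnstile> emb_nf (\<sigma> # \<Gamma>) n \<approx> TApp ?t ?x \<Colon> \<tau>"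
    unfolding down_nf_def using cls_tm_eq[OF ty_emb(2)[OF n]] by blast
  moreover have "Sg \<bar> \<sigma> # \<Gamma> \<turnstile> ?x \<approx> TVar \<Colon> \<sigma>"
    using goodD(3)[OF A fresh] by simp
  then have "Sg \<bar> \<sigma> # \<Gamma> \<turnstile> TApp ?t ?x \<approx> TApp (TSub t0 SWk) TVar \<Colon> \<tau>"
    by (rule cong_app[OF cong_sub[OF eq_refl[OF t(1)] ren_sb_wk]])
  ultimately have "Sg \<bar> \<Gamma> \<turnstile> TLam \<sigma> (emb_nf (\<sigma> # \<Gamma>) n) \<approx> TLam \<sigma> (TApp (TSub t0 SWk) TVar) \<Colon> \<sigma> \<rightarrow> \<tau>"
    using cong_lam eq_trans by blast
  then have "Sg \<bar> \<Gamma> \<turnstile> TLam \<sigma> (emb_nf (\<sigma> # \<Gamma>) n) \<approx> t0 \<Colon> \<sigma> \<rightarrow> \<tau>"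
    using eq_eta[OF t(1)] eq_trans eq_sym by meson
  then show "down_nf Sg (\<sigma> \<rightarrow> \<tau>) \<Gamma> (NLam \<sigma> n) = t"
    unfolding t(2) down_nf_def by (simp add: cls_tm_eqI)
qed

lemma reify_act_pb:
  assumes p: "(t, F) \<in> pullback Sg \<sigma> \<tau> A B \<Gamma>" and r: "\<rho> \<in> Ren \<Delta> \<Gamma>"
  shows "reify B (\<sigma> # \<Delta>) (expo_act A \<Delta> \<rho> F (\<sigma> # \<Delta>) (ren_wk \<Delta>) (reflect A (\<sigma> # \<Delta>) (NVar 0)))
    = ren_nf (ren_lift \<rho>) (reify B (\<sigma> # \<Gamma>) (F (\<sigma> # \<Gamma>) (ren_wk \<Gamma>) (reflect A (\<sigma> # \<Gamma>) (NVar 0))))"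
proof -
  note x = goodD(1)[OF A fresh] and l = Ren_lift[OF r, of \<sigma>]
  have "act A (\<sigma> # \<Gamma>) (\<sigma> # \<Delta>) (ren_lift \<rho>) (reflect A (\<sigma> # \<Gamma>) (NVar 0)) = reflect A (\<sigma> # \<Delta>) (NVar 0)"
    using goodD(4)[OF A fresh l] by (simp add: ren_lift_def)
  moreover have "expo_act A \<Delta> \<rho> F (\<sigma> # \<Delta>) (ren_wk \<Delta>) (reflect A (\<sigma> # \<Delta>) (NVar 0))
    = F (\<sigma> # \<Delta>) (\<rho> \<odot> ren_wk \<Delta>) (reflect A (\<sigma> # \<Delta>) (NVar 0))"
    using x by (simp add: expo_act_def restr_def Ren_wk)
  ultimately show ?thesis
    using goodD(5)[OF B pbD(2)[OF p Ren_wk x] l] pbD(3)[OF p Ren_wk l x] ren_wk_lift[OF r] by simp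
qed

lemma good_arrow: "good Sg (\<sigma> \<rightarrow> \<tau>) (sem_arrow Sg \<sigma> \<tau> A B)"
proof -
  let ?C = "sem_arrow Sg \<sigma> \<tau> A B"
  have car: "car ?C \<Gamma> = encode ` pullback Sg \<sigma> \<tau> A B \<Gamma>" for \<Gamma> by (simp add: sem_arrow_def)
  have reify: "reify ?C \<Gamma> (encode (t, F)) = NLam \<sigma> (reify B (\<sigma> # \<Gamma>) (F (\<sigma> # \<Gamma>) (ren_wk \<Gamma>) (reflect A (\<sigma> # \<Gamma>) (NVar 0))))"
    if "(t, F) \<in> pullback Sg \<sigma> \<tau> A B \<Gamma>" for \<Gamma> t F
    using that by (simp add: sem_arrow_def decode_encode)
  have act: "act ?C \<Gamma> \<Delta> \<rho> (encode (t, F)) = encode (tm_act Sg (\<sigma> \<rightarrow> \<tau>) \<Gamma> \<Delta> \<rho> t, expo_act A \<Delta> \<rho> F)"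
    if "(t, F) \<in> pullback Sg \<sigma> \<tau> A B \<Gamma>" for \<Gamma> \<Delta> \<rho> t F
    using that by (simp add: sem_arrow_def decode_encode)
  have reflect: "reflect ?C \<Gamma> n = encode (down_ne Sg (\<sigma> \<rightarrow> \<tau>) \<Gamma> n,
      restr A \<Gamma> (\<lambda>\<Delta> \<rho> v. reflect B \<Delta> (NApp (ren_ne \<rho> n) (reify A \<Delta> v))))" for \<Gamma> n
    by (simp add: sem_arrow_def)
  have glue: "down_nf Sg (\<sigma> \<rightarrow> \<tau>) \<Gamma> (reify ?C \<Gamma> (encode (t, F))) = t"
    if "(t, F) \<in> pullback Sg \<sigma> \<tau> A B \<Gamma>" for \<Gamma> t F
    unfolding reify[OF that] by (rule glue_pb(2)[OF that])
  have ty: "nf_ty Sg \<Gamma> (reify ?C \<Gamma> (encode (t, F))) (\<sigma> \<rightarrow> \<tau>)"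
    if "(t, F) \<in> pullback Sg \<sigma> \<tau> A B \<Gamma>" for \<Gamma> t F
    unfolding reify[OF that] by (rule nf_lam[OF glue_pb(1)[OF that]])
  show ?thesis unfolding good_def
  proof (intro conjI allI impI)
    fix \<Gamma> n assume n: "ne_ty Sg \<Gamma> n (\<sigma> \<rightarrow> \<tau>)"
    show "reflect ?C \<Gamma> n \<in> car ?C \<Gamma>" unfolding reflect car using reflect_pb[OF n] by (rule imageI)
    have "down_nf Sg (\<sigma> \<rightarrow> \<tau>) \<Gamma> (reify ?C \<Gamma> (reflect ?C \<Gamma> n)) = down_ne Sg (\<sigma> \<rightarrow> \<tau>) \<Gamma> n"
      unfolding reflect by (rule glue[OF reflect_pb[OF n]])
    moreover have "nf_ty Sg \<Gamma> (reify ?C \<Gamma> (reflect ?C \<Gamma> n)) (\<sigma> \<rightarrow> \<tau>)"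
      unfolding reflect by (rule ty[OF reflect_pb[OF n]])
    ultimately show "Sg \<bar> \<Gamma> \<turnstile> emb_nf \<Gamma> (reify ?C \<Gamma> (reflect ?C \<Gamma> n)) \<approx> emb_ne \<Gamma> n \<Colon> \<sigma> \<rightarrow> \<tau>"
      unfolding down_nf_def down_ne_def by (simp add: cls_tm_eq[OF ty_emb(2)])
    fix \<Delta> \<rho> assume r: "\<rho> \<in> Ren \<Delta> \<Gamma>"
    show "act ?C \<Gamma> \<Delta> \<rho> (reflect ?C \<Gamma> n) = reflect ?C \<Delta> (ren_ne \<rho> n)"
      unfolding reflect act[OF reflect_pb[OF n]] down_ne_ren[OF n r] by (simp add: encode_def)
  next
    fix \<Gamma> v assume "v \<in> car ?C \<Gamma>"
    then obtain t F where v: "v = encode (t, F)" and p: "(t, F) \<in> pullback Sg \<sigma> \<tau> A B \<Gamma>"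
      unfolding car by auto
    show "nf_ty Sg \<Gamma> (reify ?C \<Gamma> v) (\<sigma> \<rightarrow> \<tau>)" unfolding v by (rule ty[OF p])
    fix \<Delta> \<rho> assume r: "\<rho> \<in> Ren \<Delta> \<Gamma>"
    show "act ?C \<Gamma> \<Delta> \<rho> v \<in> car ?C \<Delta>" unfolding v act[OF p] car using act_pb[OF p r] by (rule imageI)
    show "reify ?C \<Delta> (act ?C \<Gamma> \<Delta> \<rho> v) = ren_nf \<rho> (reify ?C \<Gamma> v)"
      unfolding v act[OF p] reify[OF p] reify[OF act_pb[OF p r]] reify_act_pb[OF p r] by simp
  next
    fix \<Gamma> show "inj_on (reify ?C \<Gamma>) (car ?C \<Gamma>)"
    proof (rule inj_onI)
      fix v w assume "v \<in> car ?C \<Gamma>" "w \<in> car ?C \<Gamma>" and e: "reify ?C \<Gamma> v = reify ?C \<Gamma> w"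
      then obtain t F s G where v: "v = encode (t, F)" "(t, F) \<in> pullback Sg \<sigma> \<tau> A B \<Gamma>"
        and w: "w = encode (s, G)" "(s, G) \<in> pullback Sg \<sigma> \<tau> A B \<Gamma>" unfolding car by auto
      have "t = s" using glue[OF v(2)] glue[OF w(2)] e v(1) w(1) by simp
      then show "v = w" using v w by (simp add: encode_def)
    qed
  qed
qed

end

lemma good_P: "good Sg \<tau> (P_ty Sg \<tau>)"
  by (induction \<tau>) (simp_all add: good_atom good_times good_arrow)

theorem inj_on_encode: "inj_on encode (pullback Sg \<sigma> \<tau> (P_ty Sg \<sigma>) (P_ty Sg \<tau>) \<Gamma>)"
  by (rule pb_inj[OF good_P good_P])


section \<open>The canonical interpretation of the operations\<close>

lemma P_ctx_nth: "e \<in> P_ctx Sg \<Delta> \<Xi> \<longleftrightarrow> length e = length \<Delta> \<and> (\<forall>i<length \<Delta>. e ! i \<in> car (P_ty Sg (\<Delta> ! i)) \<Xi>)"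
  by (auto simp: P_ctx_def list_all2_conv_all_nth)

lemma reify_ctx_ty: "e \<in> P_ctx Sg \<Delta> \<Xi> \<Longrightarrow> list_all2 (nf_ty Sg \<Xi>) (reify_ctx Sg \<Delta> \<Xi> e) \<Delta>"
  by (auto simp: P_ctx_nth reify_ctx_def list_all2_conv_all_nth intro!: goodD(2)[OF good_P])

lemma reify_emb_ty: "e \<in> P_ctx Sg \<Delta> \<Xi> \<Longrightarrow> list_all2 (tm_ty Sg \<Xi>) (map (emb_nf \<Xi>) (reify_ctx Sg \<Delta> \<Xi> e)) \<Delta>"
  using reify_ctx_ty[of e Sg \<Delta> \<Xi>] by (auto simp: list_all2_conv_all_nth intro!: ty_emb(2))

lemma reify_ctx_act: "e \<in> P_ctx Sg \<Delta> \<Xi> \<Longrightarrow> \<rho> \<in> Ren \<Theta> \<Xi> \<Longrightarrow>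
    reify_ctx Sg \<Delta> \<Theta> (act_ctx Sg \<Delta> \<Xi> \<Theta> \<rho> e) = map (ren_nf \<rho>) (reify_ctx Sg \<Delta> \<Xi> e)"
  by (rule nth_equalityI) (auto simp: P_ctx_nth reify_ctx_def act_ctx_def goodD(5)[OF good_P])

lemma act_ctx_P: "e \<in> P_ctx Sg \<Delta> \<Xi> \<Longrightarrow> \<rho> \<in> Ren \<Theta> \<Xi> \<Longrightarrow> act_ctx Sg \<Delta> \<Xi> \<Theta> \<rho> e \<in> P_ctx Sg \<Delta> \<Theta>"
  by (auto simp: P_ctx_nth act_ctx_def goodD(7)[OF good_P])

definition canon_op :: "('s, 'o) signature \<Rightarrow> 'o \<Rightarrow> ('s, 'o) gl_tm" where
  "canon_op Sg \<theta> = (case the (Sg \<theta>) of (\<Delta>, \<tau>) \<Rightarrow>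
     (\<lambda>\<Xi> e. reflect (P_ty Sg \<tau>) \<Xi> (NOp \<theta> (reify_ctx Sg \<Delta> \<Xi> e)), cls_tm Sg \<Delta> \<tau> (TOp \<theta>)))"

theorem canon_op: "op_interpretation Sg (canon_op Sg)"
  unfolding op_interpretation_def
proof (intro allI impI)
  fix \<theta> \<Delta> \<tau> assume op: "Sg \<theta> = Some (\<Delta>, \<tau>)"
  have ne: "ne_ty Sg \<Xi> (NOp \<theta> (reify_ctx Sg \<Delta> \<Xi> e)) \<tau>" if "e \<in> P_ctx Sg \<Delta> \<Xi>" for e \<Xi>
    by (rule ne_op[OF op reify_ctx_ty[OF that]])
  note ty = ty_op[of Sg \<theta> \<Delta> \<tau>, OF op]
  show "canon_op Sg \<theta> \<in> Gl_tm Sg \<Delta> \<tau> \<and> snd (canon_op Sg \<theta>) = cls_tm Sg \<Delta> \<tau> (TOp \<theta>)"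
    unfolding canon_op_def op option.sel prod.case Gl_tm_def mem_Collect_eq snd_conv
  proof (intro conjI allI ballI refl)
    show "cls_tm Sg \<Delta> \<tau> (TOp \<theta>) \<in> Hom_tm Sg \<Delta> \<tau>" using ty by (auto simp: Hom_tm_def)
    fix \<Xi> e assume e: "e \<in> P_ctx Sg \<Delta> \<Xi>"
    show "reflect (P_ty Sg \<tau>) \<Xi> (NOp \<theta> (reify_ctx Sg \<Delta> \<Xi> e)) \<in> car (P_ty Sg \<tau>) \<Xi>"
      by (rule goodD(1)[OF good_P ne[OF e]])
    show "glue Sg \<tau> \<Xi> (reflect (P_ty Sg \<tau>) \<Xi> (NOp \<theta> (reify_ctx Sg \<Delta> \<Xi> e)))
      = c_sub Sg \<Xi> \<tau> (cls_tm Sg \<Delta> \<tau> (TOp \<theta>)) (glue_ctx Sg \<Delta> \<Xi> e)"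
      unfolding glue_ctx_def down_nf_ctx_def c_sub_cls[OF ty ty_tuple[OF reify_emb_ty[OF e]]]
      using goodD(3)[OF good_P ne[OF e]] by (simp add: glue_def down_nf_def cls_tm_eqI)
    fix \<Theta> \<rho> assume "\<rho> \<in> Ren \<Theta> \<Xi>"
    then show "reflect (P_ty Sg \<tau>) \<Theta> (NOp \<theta> (reify_ctx Sg \<Delta> \<Theta> (act_ctx Sg \<Delta> \<Xi> \<Theta> \<rho> e)))
      = act (P_ty Sg \<tau>) \<Xi> \<Theta> \<rho> (reflect (P_ty Sg \<tau>) \<Xi> (NOp \<theta> (reify_ctx Sg \<Delta> \<Xi> e)))"
      using goodD(4)[OF good_P ne[OF e]] reify_ctx_act[OF e] by simp
  qed
qed

end

theory Submission
  imports Defs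
begin

text \<open>The interpretation of a term \<open>t\<close> is a morphism \<open>(d,t)\<close> of the gluing category, so \<open>d\<close> followed by
  \<open>\<down>\<^sup>n\<^sup>f \<circ> reify\<close> is substitution into \<open>t\<close>. At \<open>reflect id\<close>, which denotes the identity substitution,
  this says that the normal form is equal to \<open>t\<close>. Since the structure maps \<open>\<down>\<^sup>n\<^sup>f \<circ> reify\<close> are
  natural and injective, naturality of \<open>d\<close> is a consequence of the gluing equation; it is therefore left
  out of the induction on typing derivations.\<close>

section \<open>Uniqueness of typing\<close>

inductive_cases tm_tyE:
  "Sg \<bar> \<Gamma> \<turnstile> TVar \<Colon> \<tau>" "Sg \<bar> \<Gamma> \<turnstile> TOp \<theta> \<Colon> \<tau>" "Sg \<bar> \<Gamma> \<turnstile> TSub t \<delta> \<Colon> \<tau>" "Sg \<bar> \<Gamma> \<turnstile> TLam \<sigma> t \<Colon> \<tau>"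
  "Sg \<bar> \<Gamma> \<turnstile> TApp t s \<Colon> \<tau>" "Sg \<bar> \<Gamma> \<turnstile> TPair s t \<Colon> \<tau>" "Sg \<bar> \<Gamma> \<turnstile> TFst t \<Colon> \<tau>" "Sg \<bar> \<Gamma> \<turnstile> TSnd t \<Colon> \<tau>"

inductive_cases sb_tyE:
  "Sg \<bar> \<Gamma> \<turnstile>\<^sub>s SId \<Colon> \<Delta>" "Sg \<bar> \<Gamma> \<turnstile>\<^sub>s SWk \<Colon> \<Delta>" "Sg \<bar> \<Gamma> \<turnstile>\<^sub>s SExt \<delta> t \<Colon> \<Delta>" "Sg \<bar> \<Gamma> \<turnstile>\<^sub>s SComp \<delta> \<xi> \<Colon> \<Delta>"

text \<open>The annotations in \<open>interp_tm\<close> and \<open>interp_sb\<close> are the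
  definite descriptions \<open>typ_of\<close> and \<open>cod_of\<close>; uniqueness is what makes
  them compute. It holds because \<open>TLam\<close> carries its domain, and every other form takes
  its type from the context, the signature or its immediate subexpressions.\<close>

lemma ty_unique:
  shows "Sg \<bar> \<Gamma> \<turnstile> t \<Colon> \<tau> \<Longrightarrow> Sg \<bar> \<Gamma> \<turnstile> t \<Colon> \<tau>' \<Longrightarrow> \<tau>' = \<tau>"
    and "Sg \<bar> \<Gamma> \<turnstile>\<^sub>s \<delta> \<Colon> \<Delta> \<Longrightarrow> Sg \<bar> \<Gamma> \<turnstile>\<^sub>s \<delta> \<Colon> \<Delta>' \<Longrightarrow> \<Delta>' = \<Delta>"
proof (induction arbitrary: \<tau>' and \<Delta>' rule: tm_ty_sb_ty.inducts)
  case (ty_sub \<Delta> t \<tau> \<Gamma> \<delta>)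
  from ty_sub.prems show ?case by (rule tm_tyE(3)) (use ty_sub.IH in auto)
next
  case (ty_app \<Gamma> t \<sigma> \<tau> s)
  from ty_app.prems show ?case by (rule tm_tyE(5)) (use ty_app.IH in auto)
next
  case (ty_fst \<Gamma> t \<sigma> \<tau>)
  from ty_fst.prems show ?case by (rule tm_tyE(7)) (use ty_fst.IH in auto)
next
  case (ty_snd \<Gamma> t \<sigma> \<tau>)
  from ty_snd.prems show ?case by (rule tm_tyE(8)) (use ty_snd.IH in auto)
next
  case (ty_comp \<Delta> \<delta> \<Xi> \<Gamma> \<xi>)
  from ty_comp.prems show ?case by (rule sb_tyE(4)) (use ty_comp.IH in auto)
next
  case (ty_lam \<sigma> \<Gamma> t \<tau>)
  from ty_lam.prems show ?case by (rule tm_tyE(4)) (use ty_lam.IH in auto)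
next
  case (ty_pair \<Gamma> s \<sigma> t \<tau>)
  from ty_pair.prems show ?case by (rule tm_tyE(6)) (use ty_pair.IH in auto)
next
  case (ty_ext \<Gamma> \<delta> \<Delta> t \<tau>)
  from ty_ext.prems show ?case by (rule sb_tyE(3)) (use ty_ext.IH in auto)
qed (erule tm_tyE(1,2) sb_tyE(1,2); simp)+

lemma typ_of_eq: "Sg \<bar> \<Gamma> \<turnstile> t \<Colon> \<tau> \<Longrightarrow> typ_of Sg \<Gamma> t = \<tau>"
  unfolding typ_of_def by (blast intro: the_equality ty_unique(1))

lemma cod_of_eq: "Sg \<bar> \<Gamma> \<turnstile>\<^sub>s \<delta> \<Colon> \<Delta> \<Longrightarrow> cod_of Sg \<Gamma> \<delta> = \<Delta>"
  unfolding cod_of_def by (blast intro: the_equality ty_unique(2))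


section \<open>Operations on equivalence classes\<close>

text \<open>An operation on classes collects everything equal to its value on some representatives,
  so by the congruence rule any representatives will do. The same reason covers the lemmas that
  follow; together they let the syntactic components of the gluing operations be computed on raw
  terms.\<close>

lemma c_lam_cls: "Sg \<bar> \<sigma> # \<Gamma> \<turnstile> t \<Colon> \<tau> \<Longrightarrow>
    c_lam Sg \<Gamma> \<sigma> \<tau> (cls_tm Sg (\<sigma> # \<Gamma>) \<tau> t) = cls_tm Sg \<Gamma> (\<sigma> \<rightarrow> \<tau>) (TLam \<sigma> t)"
  unfolding c_lam_def cls_tm_def using eq_refl cong_lam eq_trans by blast

lemma c_pair_cls: "Sg \<bar> \<Gamma> \<turnstile> s \<Colon> \<sigma> \<Longrightarrow> Sg \<bar> \<Gamma> \<turnstile> t \<Colon> \<tau> \<Longrightarrow>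
    c_pair Sg \<Gamma> \<sigma> \<tau> (cls_tm Sg \<Gamma> \<sigma> s) (cls_tm Sg \<Gamma> \<tau> t) = cls_tm Sg \<Gamma> (\<sigma> \<otimes> \<tau>) (TPair s t)"
  unfolding c_pair_def cls_tm_def using eq_refl cong_pair eq_trans by blast

lemma c_fst_cls: "Sg \<bar> \<Gamma> \<turnstile> t \<Colon> \<sigma> \<otimes> \<tau> \<Longrightarrow>
    c_fst Sg \<Gamma> \<sigma> (cls_tm Sg \<Gamma> (\<sigma> \<otimes> \<tau>) t) = cls_tm Sg \<Gamma> \<sigma> (TFst t)"
  unfolding c_fst_def cls_tm_def using eq_refl cong_fst eq_trans by blast

lemma c_snd_cls: "Sg \<bar> \<Gamma> \<turnstile> t \<Colon> \<sigma> \<otimes> \<tau> \<Longrightarrow>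
    c_snd Sg \<Gamma> \<tau> (cls_tm Sg \<Gamma> (\<sigma> \<otimes> \<tau>) t) = cls_tm Sg \<Gamma> \<tau> (TSnd t)"
  unfolding c_snd_def cls_tm_def using eq_refl cong_snd eq_trans by blast

lemma c_ext_cls: "Sg \<bar> \<Gamma> \<turnstile>\<^sub>s \<delta> \<Colon> \<Delta> \<Longrightarrow> Sg \<bar> \<Gamma> \<turnstile> t \<Colon> \<tau> \<Longrightarrow>
    c_ext Sg \<Gamma> \<Delta> \<tau> (cls_sb Sg \<Gamma> \<Delta> \<delta>) (cls_tm Sg \<Gamma> \<tau> t) = cls_sb Sg \<Gamma> (\<tau> # \<Delta>) (SExt \<delta> t)"
  unfolding c_ext_def cls_tm_def cls_sb_def
  by (auto intro: eq_refl eqs_refl) (meson cong_ext eqs_trans)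

lemma c_comp_cls: "Sg \<bar> \<Delta> \<turnstile>\<^sub>s \<delta> \<Colon> \<Xi> \<Longrightarrow> Sg \<bar> \<Gamma> \<turnstile>\<^sub>s \<xi> \<Colon> \<Delta> \<Longrightarrow>
    c_comp Sg \<Gamma> \<Xi> (cls_sb Sg \<Delta> \<Xi> \<delta>) (cls_sb Sg \<Gamma> \<Delta> \<xi>) = cls_sb Sg \<Gamma> \<Xi> (SComp \<delta> \<xi>)"
  unfolding c_comp_def cls_sb_def using eqs_refl cong_comp eqs_trans by blast


section \<open>Environments as substitutions\<close>

text \<open>A raw representative of the class \<open>glue_ctx\<close>, the image of an environment
  under the structure map of the context. With it the gluing equations become judgements about raw
  terms, to which the equational rules apply directly.\<close>

definition env_sb :: "('s, 'o) signature \<Rightarrow> 's ctx \<Rightarrow> 's ctx \<Rightarrow> ('s, 'o) val list \<Rightarrow> ('s, 'o) sb" where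
  "env_sb Sg \<Delta> \<Xi> e = tuple \<Xi> (map (emb_nf \<Xi>) (reify_ctx Sg \<Delta> \<Xi> e))"

lemma glue_ctx_env_sb: "glue_ctx Sg \<Delta> \<Xi> e = cls_sb Sg \<Xi> \<Delta> (env_sb Sg \<Delta> \<Xi> e)"
  by (simp add: glue_ctx_def down_nf_ctx_def env_sb_def)

lemma ty_env_sb: "e \<in> P_ctx Sg \<Delta> \<Xi> \<Longrightarrow> Sg \<bar> \<Xi> \<turnstile>\<^sub>s env_sb Sg \<Delta> \<Xi> e \<Colon> \<Delta>"
  unfolding env_sb_def by (rule ty_tuple[OF reify_emb_ty])

lemma ty_reify: "v \<in> car (P_ty Sg \<tau>) \<Xi> \<Longrightarrow> Sg \<bar> \<Xi> \<turnstile> emb_nf \<Xi> (reify (P_ty Sg \<tau>) \<Xi> v) \<Colon> \<tau>"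
  by (rule ty_emb(2)[OF goodD(2)[OF good_P]])

lemma env_sb_Cons: "env_sb Sg (\<tau> # \<Delta>) \<Xi> (v # e) = SExt (env_sb Sg \<Delta> \<Xi> e) (emb_nf \<Xi> (reify (P_ty Sg \<tau>) \<Xi> v))"
  by (simp add: env_sb_def reify_ctx_def)

lemma P_ctx_Cons: "v # e \<in> P_ctx Sg (\<tau> # \<Delta>) \<Xi> \<longleftrightarrow> v \<in> car (P_ty Sg \<tau>) \<Xi> \<and> e \<in> P_ctx Sg \<Delta> \<Xi>"
  by (simp add: P_ctx_def)

lemma P_ctx_ConsE:
  assumes "e \<in> P_ctx Sg (\<tau> # \<Delta>) \<Xi>"
  obtains v e' where "e = v # e'" "v \<in> car (P_ty Sg \<tau>) \<Xi>" "e' \<in> P_ctx Sg \<Delta> \<Xi>"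
  using assms by (auto simp: P_ctx_def list_all2_Cons2)

text \<open>Naturality of the structure map of a context, on representatives: composition
  distributes over the tuple, and in each component \<open>emb_ren\<close> turns substitution by
  \<open>ren_sb\<close> into renaming of the normal form.\<close>

lemma env_sb_act:
  assumes e: "e \<in> P_ctx Sg \<Delta> \<Xi>" and r: "\<rho> \<in> Ren \<Theta> \<Xi>"
  shows "Sg \<bar> \<Theta> \<turnstile>\<^sub>s SComp (env_sb Sg \<Delta> \<Xi> e) (ren_sb \<Theta> \<rho>) \<approx> env_sb Sg \<Delta> \<Theta> (act_ctx Sg \<Delta> \<Xi> \<Theta> \<rho> e) \<Colon> \<Delta>"
proof -
  let ?ns = "reify_ctx Sg \<Delta> \<Xi> e"
  note ty = reify_ctx_ty[OF e]
  have "Sg \<bar> \<Theta> \<turnstile>\<^sub>s tuple \<Theta> (map (\<lambda>t. TSub t (ren_sb \<Theta> \<rho>)) (map (emb_nf \<Xi>) ?ns))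
      \<approx> tuple \<Theta> (map (emb_nf \<Theta>) (map (ren_nf \<rho>) ?ns)) \<Colon> \<Delta>"
    by (rule tuple_eqI) (use ty r in \<open>auto simp: list_all2_conv_all_nth intro!: emb_ren(2)\<close>)
  then show ?thesis
    using tuple_comp[OF reify_emb_ty[OF e] ty_ren_sb[OF r]] eqs_trans reify_ctx_act[OF e r]
    unfolding env_sb_def by metis
qed

text \<open>Functoriality is pulled back along \<open>reify\<close>, which is injective and carries
  \<open>act\<close> to \<open>ren_nf\<close>; renaming of typed normal forms respects composition.
  The abstraction case needs this to move an environment along a composite renaming.\<close>

lemma act_comp:
  assumes v: "v \<in> car (P_ty Sg \<tau>) \<Xi>" and r: "\<rho> \<in> Ren \<Theta> \<Xi>" and th: "\<theta> \<in> Ren \<Delta> \<Theta>"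
  shows "act (P_ty Sg \<tau>) \<Xi> \<Delta> (\<rho> \<odot> \<theta>) v = act (P_ty Sg \<tau>) \<Theta> \<Delta> \<theta> (act (P_ty Sg \<tau>) \<Xi> \<Theta> \<rho> v)"
proof (rule inj_onD[OF goodD(6)[OF good_P]])
  note G = good_P[of Sg \<tau>]
  note v' = goodD(7)[OF G v r]
  show "act (P_ty Sg \<tau>) \<Xi> \<Delta> (\<rho> \<odot> \<theta>) v \<in> car (P_ty Sg \<tau>) \<Delta>"
    by (rule goodD(7)[OF G v Ren_comp[OF r th]])
  show "act (P_ty Sg \<tau>) \<Theta> \<Delta> \<theta> (act (P_ty Sg \<tau>) \<Xi> \<Theta> \<rho> v) \<in> car (P_ty Sg \<tau>) \<Delta>"
    by (rule goodD(7)[OF G v' th])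
  show "reify (P_ty Sg \<tau>) \<Delta> (act (P_ty Sg \<tau>) \<Xi> \<Delta> (\<rho> \<odot> \<theta>) v)
      = reify (P_ty Sg \<tau>) \<Delta> (act (P_ty Sg \<tau>) \<Theta> \<Delta> \<theta> (act (P_ty Sg \<tau>) \<Xi> \<Theta> \<rho> v))"
    unfolding goodD(5)[OF G v' th] goodD(5)[OF G v r] goodD(5)[OF G v Ren_comp[OF r th]]
    by (rule ren_ren(2)[OF goodD(2)[OF G v] r th, symmetric])
qed

lemma act_ctx_comp:
  "e \<in> P_ctx Sg \<Gamma> \<Xi> \<Longrightarrow> \<rho> \<in> Ren \<Theta> \<Xi> \<Longrightarrow> \<theta> \<in> Ren \<Delta> \<Theta> \<Longrightarrow>
    act_ctx Sg \<Gamma> \<Xi> \<Delta> (\<rho> \<odot> \<theta>) e = act_ctx Sg \<Gamma> \<Theta> \<Delta> \<theta> (act_ctx Sg \<Gamma> \<Xi> \<Theta> \<rho> e)"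
  by (rule nth_equalityI) (auto simp: P_ctx_nth act_ctx_def act_comp)

section \<open>The environment of reflected variables\<close>

lemma ne_id_P: "reflect_ctx Sg \<Gamma> \<Gamma> (ne_id \<Gamma>) \<in> P_ctx Sg \<Gamma> \<Gamma>"
  by (auto simp: P_ctx_nth reflect_ctx_def ne_id_def intro!: goodD(1)[OF good_P] ne_var)

text \<open>Reifying a reflected neutral returns that neutral up to equality, so the tuple agrees
  with the tuple of all variables, which is the identity by \<open>ren_sb_id\<close>.\<close>

lemma env_sb_ne_id: "Sg \<bar> \<Gamma> \<turnstile>\<^sub>s env_sb Sg \<Gamma> \<Gamma> (reflect_ctx Sg \<Gamma> \<Gamma> (ne_id \<Gamma>)) \<approx> SId \<Colon> \<Gamma>"
proof -
  have "Sg \<bar> \<Gamma> \<turnstile>\<^sub>s env_sb Sg \<Gamma> \<Gamma> (reflect_ctx Sg \<Gamma> \<Gamma> (ne_id \<Gamma>)) \<approx> ren_sb \<Gamma> (ren_id \<Gamma>) \<Colon> \<Gamma>"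
    unfolding env_sb_def ren_sb_def
  proof (rule tuple_eqI)
    fix i assume i: "i < length \<Gamma>"
    show "Sg \<bar> \<Gamma> \<turnstile> map (emb_nf \<Gamma>) (reify_ctx Sg \<Gamma> \<Gamma> (reflect_ctx Sg \<Gamma> \<Gamma> (ne_id \<Gamma>))) ! i
        \<approx> map var (ren_id \<Gamma>) ! i \<Colon> \<Gamma> ! i"
      using goodD(3)[OF good_P ne_var[OF i, of Sg]] i
      by (simp add: reify_ctx_def reflect_ctx_def ne_id_def ren_id_def)
  qed (simp_all add: reify_ctx_def reflect_ctx_def ne_id_def ren_id_def)
  then show ?thesis using ren_sb_id eqs_trans by blast
qed


section \<open>The gluing equation for interpretations\<close>

text \<open>The conditions of \<open>Gl_tm\<close> without naturality, with the gluing equation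
  stated between a chosen raw term and the embedded normal form instead of between their
  classes.\<close>

definition realizes_tm :: "('s, 'o) signature \<Rightarrow> 's ctx \<Rightarrow> 's ty \<Rightarrow> ('s, 'o) gl_tm \<Rightarrow> ('s, 'o) tm \<Rightarrow> bool" where
  "realizes_tm Sg \<Gamma> \<tau> f t \<longleftrightarrow> snd f = cls_tm Sg \<Gamma> \<tau> t \<and>
     (\<forall>\<Xi>. \<forall>e\<in>P_ctx Sg \<Gamma> \<Xi>. fst f \<Xi> e \<in> car (P_ty Sg \<tau>) \<Xi> \<and>
       (Sg \<bar> \<Xi> \<turnstile> emb_nf \<Xi> (reify (P_ty Sg \<tau>) \<Xi> (fst f \<Xi> e)) \<approx> TSub t (env_sb Sg \<Gamma> \<Xi> e) \<Colon> \<tau>))"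

definition realizes_sb :: "('s, 'o) signature \<Rightarrow> 's ctx \<Rightarrow> 's ctx \<Rightarrow> ('s, 'o) gl_sb \<Rightarrow> ('s, 'o) sb \<Rightarrow> bool" where
  "realizes_sb Sg \<Gamma> \<Delta> f \<delta> \<longleftrightarrow> snd f = cls_sb Sg \<Gamma> \<Delta> \<delta> \<and>
     (\<forall>\<Xi>. \<forall>e\<in>P_ctx Sg \<Gamma> \<Xi>. fst f \<Xi> e \<in> P_ctx Sg \<Delta> \<Xi> \<and>
       (Sg \<bar> \<Xi> \<turnstile>\<^sub>s env_sb Sg \<Delta> \<Xi> (fst f \<Xi> e) \<approx> SComp \<delta> (env_sb Sg \<Gamma> \<Xi> e) \<Colon> \<Delta>))"

lemma realizes_tmD:
  assumes "realizes_tm Sg \<Gamma> \<tau> f t"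
  shows "snd f = cls_tm Sg \<Gamma> \<tau> t"
    and "e \<in> P_ctx Sg \<Gamma> \<Xi> \<Longrightarrow> fst f \<Xi> e \<in> car (P_ty Sg \<tau>) \<Xi>"
    and "e \<in> P_ctx Sg \<Gamma> \<Xi> \<Longrightarrow>
      Sg \<bar> \<Xi> \<turnstile> emb_nf \<Xi> (reify (P_ty Sg \<tau>) \<Xi> (fst f \<Xi> e)) \<approx> TSub t (env_sb Sg \<Gamma> \<Xi> e) \<Colon> \<tau>"
  using assms unfolding realizes_tm_def by blast+

lemma realizes_sbD:
  assumes "realizes_sb Sg \<Gamma> \<Delta> f \<delta>"
  shows "snd f = cls_sb Sg \<Gamma> \<Delta> \<delta>"
    and "e \<in> P_ctx Sg \<Gamma> \<Xi> \<Longrightarrow> fst f \<Xi> e \<in> P_ctx Sg \<Delta> \<Xi>"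
    and "e \<in> P_ctx Sg \<Gamma> \<Xi> \<Longrightarrow>
      Sg \<bar> \<Xi> \<turnstile>\<^sub>s env_sb Sg \<Delta> \<Xi> (fst f \<Xi> e) \<approx> SComp \<delta> (env_sb Sg \<Gamma> \<Xi> e) \<Colon> \<Delta>"
  using assms unfolding realizes_sb_def by blast+

section \<open>Naturality recovered from the gluing equation\<close>

text \<open>Both sides embed, up to equality, to \<open>t\<close> under the renamed environment. By
  \<open>nf_unique\<close> their reifications are then identical, and \<open>reify\<close> is
  injective. The exponential consists of natural families, so the abstraction case depends on
  this.\<close>

lemma realizes_natural:
  assumes f: "realizes_tm Sg \<Gamma> \<tau> f t" and t: "Sg \<bar> \<Gamma> \<turnstile> t \<Colon> \<tau>"
    and e: "e \<in> P_ctx Sg \<Gamma> \<Xi>" and r: "\<rho> \<in> Ren \<Theta> \<Xi>"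
  shows "fst f \<Theta> (act_ctx Sg \<Gamma> \<Xi> \<Theta> \<rho> e) = act (P_ty Sg \<tau>) \<Xi> \<Theta> \<rho> (fst f \<Xi> e)"
proof -
  let ?A = "P_ty Sg \<tau>" and ?e = "act_ctx Sg \<Gamma> \<Xi> \<Theta> \<rho> e" and ?r = "ren_sb \<Theta> \<rho>"
  note G = good_P[of Sg \<tau>] and d = realizes_tmD(2)[OF f e] and e' = act_ctx_P[OF e r]
  note d' = realizes_tmD(2)[OF f e'] and ad = goodD(7)[OF G d r] and ty = ty_ren_sb[OF r]
  have "Sg \<bar> \<Theta> \<turnstile> TSub (TSub t (env_sb Sg \<Gamma> \<Xi> e)) ?r \<approx> TSub t (env_sb Sg \<Gamma> \<Theta> ?e) \<Colon> \<tau>"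
    by (rule eq_trans[OF eq_sub_comp[OF t ty_env_sb[OF e] ty]
          cong_sub[OF eq_refl[OF t] env_sb_act[OF e r]]])
  moreover have "Sg \<bar> \<Theta> \<turnstile> TSub (emb_nf \<Xi> (reify ?A \<Xi> (fst f \<Xi> e))) ?r \<approx> TSub (TSub t (env_sb Sg \<Gamma> \<Xi> e)) ?r \<Colon> \<tau>"
    by (rule cong_sub[OF realizes_tmD(3)[OF f e] eqs_refl[OF ty]])
  moreover have "Sg \<bar> \<Theta> \<turnstile> TSub (emb_nf \<Xi> (reify ?A \<Xi> (fst f \<Xi> e))) ?r \<approx> emb_nf \<Theta> (reify ?A \<Theta> (act ?A \<Xi> \<Theta> \<rho> (fst f \<Xi> e))) \<Colon> \<tau>"
    unfolding goodD(5)[OF G d r] by (rule emb_ren(2)[OF goodD(2)[OF G d] r])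
  moreover note realizes_tmD(3)[OF f e']
  ultimately have "Sg \<bar> \<Theta> \<turnstile> emb_nf \<Theta> (reify ?A \<Theta> (fst f \<Theta> ?e)) \<approx> emb_nf \<Theta> (reify ?A \<Theta> (act ?A \<Xi> \<Theta> \<rho> (fst f \<Xi> e))) \<Colon> \<tau>"
    using eq_trans eq_sym by meson
  then have "reify ?A \<Theta> (fst f \<Theta> ?e) = reify ?A \<Theta> (act ?A \<Xi> \<Theta> \<rho> (fst f \<Xi> e))"
    by (rule nf_unique[rotated 2]) (rule goodD(2)[OF G d'], rule goodD(2)[OF G ad])
  then show ?thesis by (rule inj_onD[OF goodD(6)[OF G] _ d' ad])
qed

section \<open>Function types: structure map, abstraction, application\<close>

text \<open>The structure map of the exponential is the first projection of the pullback: by the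
  pullback condition at the weakening and the reflected fresh variable, reification yields the eta
  expansion of a representative of \<open>t\<close>.\<close>

lemma reify_encode:
  assumes "(t, F) \<in> pullback Sg \<sigma> \<tau> (P_ty Sg \<sigma>) (P_ty Sg \<tau>) \<Gamma>"
  shows "down_nf Sg (\<sigma> \<rightarrow> \<tau>) \<Gamma> (reify (P_ty Sg (\<sigma> \<rightarrow> \<tau>)) \<Gamma> (encode (t, F))) = t"
  using glue_pb(2)[OF good_P good_P assms] decode_encode[OF good_P good_P assms]
  by (simp add: sem_arrow_def)

text \<open>This computation makes the pullback condition hold for abstractions: once
  \<open>\<delta>\<close> is pushed under the binder and beta is applied, the lifted substitution
  followed by \<open>(id, s)\<close> collapses to \<open>(\<delta>, s)\<close>.\<close>

lemma beta_sub:
  assumes t: "Sg \<bar> \<sigma> # \<Delta> \<turnstile> t \<Colon> \<tau>" and d: "Sg \<bar> \<Gamma> \<turnstile>\<^sub>s \<delta> \<Colon> \<Delta>" and s: "Sg \<bar> \<Gamma> \<turnstile> s \<Colon> \<sigma>"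
  shows "Sg \<bar> \<Gamma> \<turnstile> TApp (TSub (TLam \<sigma> t) \<delta>) s \<approx> TSub t (SExt \<delta> s) \<Colon> \<tau>"
proof -
  let ?up = "SExt (SComp \<delta> SWk) TVar" and ?i = "SExt SId s"
  have w: "Sg \<bar> \<sigma> # \<Gamma> \<turnstile>\<^sub>s SComp \<delta> SWk \<Colon> \<Delta>" by (rule ty_comp[OF d ty_wk])
  have up: "Sg \<bar> \<sigma> # \<Gamma> \<turnstile>\<^sub>s ?up \<Colon> \<sigma> # \<Delta>" by (rule ty_ext[OF w ty_var])
  have i: "Sg \<bar> \<Gamma> \<turnstile>\<^sub>s ?i \<Colon> \<sigma> # \<Gamma>" by (rule ty_ext[OF ty_id s])
  \<comment> \<open>The weakening cancels the extension by \<open>s\<close>, leaving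
    \<open>\<delta>\<close> composed with the identity.\<close>
  have "Sg \<bar> \<Gamma> \<turnstile>\<^sub>s SComp (SComp \<delta> SWk) ?i \<approx> \<delta> \<Colon> \<Delta>"
    by (rule eqs_trans[OF eq_assoc[OF d ty_wk i]])
      (rule eqs_trans[OF cong_comp[OF eqs_refl[OF d] eq_wk_ext[OF ty_id s]] eq_id_right[OF d]])
  then have "Sg \<bar> \<Gamma> \<turnstile>\<^sub>s SExt (SComp (SComp \<delta> SWk) ?i) (TSub TVar ?i) \<approx> SExt \<delta> s \<Colon> \<sigma> # \<Delta>"
    by (rule cong_ext[OF _ eq_var_ext[OF ty_id s]])
  then have c: "Sg \<bar> \<Gamma> \<turnstile>\<^sub>s SComp ?up ?i \<approx> SExt \<delta> s \<Colon> \<sigma> # \<Delta>"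
    by (rule eqs_trans[OF eq_ext_comp[OF w ty_var i]])
  have "Sg \<bar> \<Gamma> \<turnstile> TApp (TSub (TLam \<sigma> t) \<delta>) s \<approx> TApp (TLam \<sigma> (TSub t ?up)) s \<Colon> \<tau>"
    by (rule cong_app[OF eq_sub_lam[OF t d] eq_refl[OF s]])
  then have "Sg \<bar> \<Gamma> \<turnstile> TApp (TSub (TLam \<sigma> t) \<delta>) s \<approx> TSub (TSub t ?up) ?i \<Colon> \<tau>"
    by (rule eq_trans[OF _ eq_beta[OF ty_sub[OF t up] s]])
  then show ?thesis
    by (rule eq_trans[OF _ eq_trans[OF eq_sub_comp[OF t up i] cong_sub[OF eq_refl[OF t] c]]])
qed

text \<open>The main work is to show that the pair behind the token lies in the pullback; membership
  in the carrier is then immediate, and \<open>reify_encode\<close> gives the gluing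
  equation.\<close>

lemma realizes_lam:
  assumes t: "Sg \<bar> \<sigma> # \<Gamma> \<turnstile> t \<Colon> \<tau>" and f: "realizes_tm Sg (\<sigma> # \<Gamma>) \<tau> f t"
  shows "realizes_tm Sg \<Gamma> (\<sigma> \<rightarrow> \<tau>) (gl_lam Sg \<Gamma> \<sigma> \<tau> f) (TLam \<sigma> t)"
proof -
  let ?A = "P_ty Sg \<sigma>" and ?B = "P_ty Sg \<tau>"
  have l: "Sg \<bar> \<Gamma> \<turnstile> TLam \<sigma> t \<Colon> \<sigma> \<rightarrow> \<tau>" by (rule ty_lam[OF t])
  have "fst (gl_lam Sg \<Gamma> \<sigma> \<tau> f) \<Xi> e \<in> car (P_ty Sg (\<sigma> \<rightarrow> \<tau>)) \<Xi> \<and>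
      (Sg \<bar> \<Xi> \<turnstile> emb_nf \<Xi> (reify (P_ty Sg (\<sigma> \<rightarrow> \<tau>)) \<Xi> (fst (gl_lam Sg \<Gamma> \<sigma> \<tau> f) \<Xi> e))
        \<approx> TSub (TLam \<sigma> t) (env_sb Sg \<Gamma> \<Xi> e) \<Colon> \<sigma> \<rightarrow> \<tau>)"
    if e: "e \<in> P_ctx Sg \<Gamma> \<Xi>" for \<Xi> e
  proof -
    let ?s = "TSub (TLam \<sigma> t) (env_sb Sg \<Gamma> \<Xi> e)"
    \<comment> \<open>The currying of \<open>f\<close>: the environment is moved along the renaming
      before the argument is added.\<close>
    define F where "F = (\<lambda>\<Theta> \<rho> v. fst f \<Theta> (v # act_ctx Sg \<Gamma> \<Xi> \<Theta> \<rho> e))"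
    have s: "Sg \<bar> \<Xi> \<turnstile> ?s \<Colon> \<sigma> \<rightarrow> \<tau>" by (rule ty_sub[OF l ty_env_sb[OF e]])
    have d: "fst (gl_lam Sg \<Gamma> \<sigma> \<tau> f) \<Xi> e = encode (cls_tm Sg \<Xi> (\<sigma> \<rightarrow> \<tau>) ?s, restr ?A \<Xi> F)"
      unfolding F_def gl_lam_def
      by (simp add: Let_def realizes_tmD(1)[OF f] c_lam_cls[OF t] glue_ctx_env_sb c_sub_cls[OF l ty_env_sb[OF e]])
    have p: "(cls_tm Sg \<Xi> (\<sigma> \<rightarrow> \<tau>) ?s, restr ?A \<Xi> F) \<in> pullback Sg \<sigma> \<tau> ?A ?B \<Xi>"
    proof (rule pbI[OF good_P good_P])
      show "cls_tm Sg \<Xi> (\<sigma> \<rightarrow> \<tau>) ?s \<in> Hom_tm Sg \<Xi> (\<sigma> \<rightarrow> \<tau>)"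
        using s by (auto simp: Hom_tm_def)
      fix \<Theta> \<rho> v assume r: "\<rho> \<in> Ren \<Theta> \<Xi>" and v: "v \<in> car ?A \<Theta>"
      let ?e = "act_ctx Sg \<Gamma> \<Xi> \<Theta> \<rho> e" and ?v = "emb_nf \<Theta> (reify ?A \<Theta> v)" and ?r = "ren_sb \<Theta> \<rho>"
      note e' = act_ctx_P[OF e r]
      have ve: "v # ?e \<in> P_ctx Sg (\<sigma> # \<Gamma>) \<Theta>" using v e' by (simp add: P_ctx_Cons)
      show "F \<Theta> \<rho> v \<in> car ?B \<Theta>" unfolding F_def by (rule realizes_tmD(2)[OF f ve])
      note v' = ty_reify[OF v]
      \<comment> \<open>Renaming the substituted abstraction amounts to substituting the renamed
        environment; \<open>beta_sub\<close> then turns its application to \<open>?v\<close> into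
        the body under \<open>v # ?e\<close>, where the equation for \<open>f\<close>
        applies.\<close>
      have "Sg \<bar> \<Theta> \<turnstile> TSub ?s ?r \<approx> TSub (TLam \<sigma> t) (env_sb Sg \<Gamma> \<Theta> ?e) \<Colon> \<sigma> \<rightarrow> \<tau>"
        by (rule eq_trans[OF eq_sub_comp[OF l ty_env_sb[OF e] ty_ren_sb[OF r]]
              cong_sub[OF eq_refl[OF l] env_sb_act[OF e r]]])
      from eq_trans[OF cong_app[OF this eq_refl[OF v']] beta_sub[OF t ty_env_sb[OF e'] v']]
      have "Sg \<bar> \<Theta> \<turnstile> TApp (TSub ?s ?r) ?v \<approx> TSub t (env_sb Sg (\<sigma> # \<Gamma>) \<Theta> (v # ?e)) \<Colon> \<tau>"
        unfolding env_sb_Cons .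
      from eq_trans[OF realizes_tmD(3)[OF f ve] eq_sym[OF this]]
      have "Sg \<bar> \<Theta> \<turnstile> emb_nf \<Theta> (reify ?B \<Theta> (F \<Theta> \<rho> v)) \<approx> TApp (TSub ?s ?r) ?v \<Colon> \<tau>"
        unfolding F_def .
      then show "down_nf Sg \<tau> \<Theta> (reify ?B \<Theta> (F \<Theta> \<rho> v)) = c_app Sg \<Theta> \<tau>
          (tm_act Sg (\<sigma> \<rightarrow> \<tau>) \<Xi> \<Theta> \<rho> (cls_tm Sg \<Xi> (\<sigma> \<rightarrow> \<tau>) ?s)) (down_nf Sg \<sigma> \<Theta> (reify ?A \<Theta> v))"
        unfolding down_nf_def tm_act_cls[OF s r] c_app_cls[OF ty_sub[OF s ty_ren_sb[OF r]] v']
        by (rule cls_tm_eqI)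
      fix \<Theta>' \<theta> assume th: "\<theta> \<in> Ren \<Theta>' \<Theta>"
      \<comment> \<open>Naturality of \<open>F\<close> is naturality of \<open>f\<close> at the
        extended environment \<open>v # ?e\<close>, once the action along the composite renaming has
        been split.\<close>
      show "F \<Theta>' (\<rho> \<odot> \<theta>) (act ?A \<Theta> \<Theta>' \<theta> v) = act ?B \<Theta> \<Theta>' \<theta> (F \<Theta> \<rho> v)"
        using realizes_natural[OF f t ve th]
        unfolding F_def act_ctx_comp[OF e r th] by (simp add: act_ctx_def)
    qed
    have "fst (gl_lam Sg \<Gamma> \<sigma> \<tau> f) \<Xi> e \<in> car (P_ty Sg (\<sigma> \<rightarrow> \<tau>)) \<Xi>"
      unfolding d using p by (simp add: sem_arrow_def)
    moreover from this show ?thesis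
      using reify_encode[OF p] cls_tm_eq[OF ty_reify, of "fst (gl_lam Sg \<Gamma> \<sigma> \<tau> f) \<Xi> e"]
      unfolding d down_nf_def by blast
  qed
  then show ?thesis
    unfolding realizes_tm_def using c_lam_cls[OF t] realizes_tmD(1)[OF f]
    by (auto simp: gl_lam_def Let_def)
qed

lemma realizes_app:
  assumes t: "Sg \<bar> \<Gamma> \<turnstile> t \<Colon> \<sigma> \<rightarrow> \<tau>" and s: "Sg \<bar> \<Gamma> \<turnstile> s \<Colon> \<sigma>"
    and f: "realizes_tm Sg \<Gamma> (\<sigma> \<rightarrow> \<tau>) f t" and g: "realizes_tm Sg \<Gamma> \<sigma> g s"
  shows "realizes_tm Sg \<Gamma> \<tau> (gl_app Sg \<Gamma> \<sigma> \<tau> f g) (TApp t s)"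
proof -
  let ?A = "P_ty Sg \<sigma>" and ?B = "P_ty Sg \<tau>"
  have "fst (gl_app Sg \<Gamma> \<sigma> \<tau> f g) \<Xi> e \<in> car ?B \<Xi> \<and>
      (Sg \<bar> \<Xi> \<turnstile> emb_nf \<Xi> (reify ?B \<Xi> (fst (gl_app Sg \<Gamma> \<sigma> \<tau> f g) \<Xi> e)) \<approx> TSub (TApp t s) (env_sb Sg \<Gamma> \<Xi> e) \<Colon> \<tau>)"
    if e: "e \<in> P_ctx Sg \<Gamma> \<Xi>" for \<Xi> e
  proof -
    let ?d = "env_sb Sg \<Gamma> \<Xi> e" and ?v = "fst g \<Xi> e"
    note env = ty_env_sb[OF e] and v = realizes_tmD(2)[OF g e]
    note t' = ty_sub[OF t env] and s' = ty_sub[OF s env]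
    obtain T F where fe: "fst f \<Xi> e = encode (T, F)" and p: "(T, F) \<in> pullback Sg \<sigma> \<tau> ?A ?B \<Xi>"
      using realizes_tmD(2)[OF f e] by (auto simp: sem_arrow_def)
    \<comment> \<open>The token alone determines \<open>T\<close>: the structure map returns it,
      while the equation for \<open>f\<close> gives the class of \<open>t\<close> under the
      environment.\<close>
    have T: "T = cls_tm Sg \<Xi> (\<sigma> \<rightarrow> \<tau>) (TSub t ?d)"
      using reify_encode[OF p] cls_tm_eqI[OF realizes_tmD(3)[OF f e]] unfolding fe down_nf_def by simp
    have a: "fst (gl_app Sg \<Gamma> \<sigma> \<tau> f g) \<Xi> e = F \<Xi> (ren_id \<Xi>) ?v"
      by (simp add: gl_app_def fe decode_encode[OF good_P good_P p])
    have c: "F \<Xi> (ren_id \<Xi>) ?v \<in> car ?B \<Xi>" by (rule pbD(2)[OF good_P good_P p Ren_id v])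
    have "down_nf Sg \<sigma> \<Xi> (reify ?A \<Xi> ?v) = cls_tm Sg \<Xi> \<sigma> (TSub s ?d)"
      unfolding down_nf_def by (rule cls_tm_eqI[OF realizes_tmD(3)[OF g e]])
    \<comment> \<open>Application evaluates the family at the identity renaming, where
      \<open>tm_act\<close> fixes \<open>T\<close>; the pullback condition there is the required
      equation, at the level of classes.\<close>
    then have "cls_tm Sg \<Xi> \<tau> (emb_nf \<Xi> (reify ?B \<Xi> (F \<Xi> (ren_id \<Xi>) ?v))) = cls_tm Sg \<Xi> \<tau> (TApp (TSub t ?d) (TSub s ?d))"
      using pbD(4)[OF good_P good_P p Ren_id v] tm_act_id[OF pbD(1)[OF good_P good_P p]] c_app_cls[OF t' s']
      unfolding T down_nf_def[of _ \<tau>] by simp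
    then have "Sg \<bar> \<Xi> \<turnstile> emb_nf \<Xi> (reify ?B \<Xi> (F \<Xi> (ren_id \<Xi>) ?v)) \<approx> TApp (TSub t ?d) (TSub s ?d) \<Colon> \<tau>"
      unfolding cls_tm_eq[OF ty_reify[OF c]] .
    from eq_trans[OF this eq_sym[OF eq_sub_app[OF t s env]]] c show ?thesis unfolding a by blast
  qed
  then show ?thesis
    unfolding realizes_tm_def using c_app_cls[OF t s] realizes_tmD(1)[OF f] realizes_tmD(1)[OF g]
    by (auto simp: gl_app_def)
qed

section \<open>Product types\<close>

lemma realizes_pair:
  assumes s: "Sg \<bar> \<Gamma> \<turnstile> s \<Colon> \<sigma>" and t: "Sg \<bar> \<Gamma> \<turnstile> t \<Colon> \<tau>"
    and f: "realizes_tm Sg \<Gamma> \<sigma> f s" and g: "realizes_tm Sg \<Gamma> \<tau> g t"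
  shows "realizes_tm Sg \<Gamma> (\<sigma> \<otimes> \<tau>) (gl_pair Sg \<Gamma> \<sigma> \<tau> f g) (TPair s t)"
  unfolding realizes_tm_def
proof (intro conjI allI ballI)
  show "snd (gl_pair Sg \<Gamma> \<sigma> \<tau> f g) = cls_tm Sg \<Gamma> (\<sigma> \<otimes> \<tau>) (TPair s t)"
    using realizes_tmD(1)[OF f] realizes_tmD(1)[OF g] c_pair_cls[OF s t] by (simp add: gl_pair_def)
  fix \<Xi> e assume e: "e \<in> P_ctx Sg \<Gamma> \<Xi>"
  show "fst (gl_pair Sg \<Gamma> \<sigma> \<tau> f g) \<Xi> e \<in> car (P_ty Sg (\<sigma> \<otimes> \<tau>)) \<Xi>"
    using realizes_tmD(2)[OF f e] realizes_tmD(2)[OF g e] by (simp add: gl_pair_def sem_times_def)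
  from eq_trans[OF cong_pair[OF realizes_tmD(3)[OF f e] realizes_tmD(3)[OF g e]]
      eq_sym[OF eq_sub_pair[OF s t ty_env_sb[OF e]]]]
  show "Sg \<bar> \<Xi> \<turnstile> emb_nf \<Xi> (reify (P_ty Sg (\<sigma> \<otimes> \<tau>)) \<Xi> (fst (gl_pair Sg \<Gamma> \<sigma> \<tau> f g) \<Xi> e))
      \<approx> TSub (TPair s t) (env_sb Sg \<Gamma> \<Xi> e) \<Colon> \<sigma> \<otimes> \<tau>"
    by (simp add: gl_pair_def sem_times_def)
qed

text \<open>At a product type the equation for \<open>f\<close> concerns the pair of reified
  components. Each component is a projection of that pair by beta, and substitution commutes with
  projections.\<close>

lemma realizes_proj:
  assumes t: "Sg \<bar> \<Gamma> \<turnstile> t \<Colon> \<sigma> \<otimes> \<tau>" and f: "realizes_tm Sg \<Gamma> (\<sigma> \<otimes> \<tau>) f t"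
  shows "realizes_tm Sg \<Gamma> \<sigma> (gl_fst Sg \<Gamma> \<sigma> f) (TFst t)"
    and "realizes_tm Sg \<Gamma> \<tau> (gl_snd Sg \<Gamma> \<tau> f) (TSnd t)"
proof -
  have *: "vfst (fst f \<Xi> e) \<in> car (P_ty Sg \<sigma>) \<Xi>" "vsnd (fst f \<Xi> e) \<in> car (P_ty Sg \<tau>) \<Xi>"
    "Sg \<bar> \<Xi> \<turnstile> emb_nf \<Xi> (reify (P_ty Sg \<sigma>) \<Xi> (vfst (fst f \<Xi> e))) \<approx> TSub (TFst t) (env_sb Sg \<Gamma> \<Xi> e) \<Colon> \<sigma>"
    "Sg \<bar> \<Xi> \<turnstile> emb_nf \<Xi> (reify (P_ty Sg \<tau>) \<Xi> (vsnd (fst f \<Xi> e))) \<approx> TSub (TSnd t) (env_sb Sg \<Gamma> \<Xi> e) \<Colon> \<tau>"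
    if e: "e \<in> P_ctx Sg \<Gamma> \<Xi>" for \<Xi> e
  proof -
    note env = ty_env_sb[OF e]
    show a: "vfst (fst f \<Xi> e) \<in> car (P_ty Sg \<sigma>) \<Xi>" and b: "vsnd (fst f \<Xi> e) \<in> car (P_ty Sg \<tau>) \<Xi>"
      using realizes_tmD(2)[OF f e] by (auto simp: sem_times_def)
    let ?a = "emb_nf \<Xi> (reify (P_ty Sg \<sigma>) \<Xi> (vfst (fst f \<Xi> e)))"
    let ?b = "emb_nf \<Xi> (reify (P_ty Sg \<tau>) \<Xi> (vsnd (fst f \<Xi> e)))"
    have p: "Sg \<bar> \<Xi> \<turnstile> TPair ?a ?b \<approx> TSub t (env_sb Sg \<Gamma> \<Xi> e) \<Colon> \<sigma> \<otimes> \<tau>"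
      using realizes_tmD(3)[OF f e] by (simp add: sem_times_def)
    show "Sg \<bar> \<Xi> \<turnstile> ?a \<approx> TSub (TFst t) (env_sb Sg \<Gamma> \<Xi> e) \<Colon> \<sigma>"
      by (rule eq_trans[OF eq_sym[OF eq_fst[OF ty_reify[OF a] ty_reify[OF b]]]
            eq_trans[OF cong_fst[OF p] eq_sym[OF eq_sub_fst[OF t env]]]])
    show "Sg \<bar> \<Xi> \<turnstile> ?b \<approx> TSub (TSnd t) (env_sb Sg \<Gamma> \<Xi> e) \<Colon> \<tau>"
      by (rule eq_trans[OF eq_sym[OF eq_snd[OF ty_reify[OF a] ty_reify[OF b]]]
            eq_trans[OF cong_snd[OF p] eq_sym[OF eq_sub_snd[OF t env]]]])
  qed
  show "realizes_tm Sg \<Gamma> \<sigma> (gl_fst Sg \<Gamma> \<sigma> f) (TFst t)"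
    unfolding realizes_tm_def using * c_fst_cls[OF t] realizes_tmD(1)[OF f] by (simp add: gl_fst_def)
  show "realizes_tm Sg \<Gamma> \<tau> (gl_snd Sg \<Gamma> \<tau> f) (TSnd t)"
    unfolding realizes_tm_def using * c_snd_cls[OF t] realizes_tmD(1)[OF f] by (simp add: gl_snd_def)
qed

section \<open>Substitution, composition and extension; variables, weakening and identity\<close>

text \<open>Two gluing squares are pasted: that of \<open>f\<close> at the environment produced by
  \<open>g\<close>, and that of \<open>g\<close> itself. \<open>realizes_comp\<close> follows the
  same pattern.\<close>

lemma realizes_sub:
  assumes t: "Sg \<bar> \<Delta> \<turnstile> t \<Colon> \<tau>" and d: "Sg \<bar> \<Gamma> \<turnstile>\<^sub>s \<delta> \<Colon> \<Delta>"
    and f: "realizes_tm Sg \<Delta> \<tau> f t" and g: "realizes_sb Sg \<Gamma> \<Delta> g \<delta>"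
  shows "realizes_tm Sg \<Gamma> \<tau> (gl_sub Sg \<Gamma> \<tau> f g) (TSub t \<delta>)"
  unfolding realizes_tm_def gl_sub_def fst_conv snd_conv realizes_tmD(1)[OF f] realizes_sbD(1)[OF g]
proof (intro conjI allI ballI)
  show "c_sub Sg \<Gamma> \<tau> (cls_tm Sg \<Delta> \<tau> t) (cls_sb Sg \<Gamma> \<Delta> \<delta>) = cls_tm Sg \<Gamma> \<tau> (TSub t \<delta>)"
    by (rule c_sub_cls[OF t d])
  fix \<Xi> e assume e: "e \<in> P_ctx Sg \<Gamma> \<Xi>"
  note e' = realizes_sbD(2)[OF g e]
  show "fst f \<Xi> (fst g \<Xi> e) \<in> car (P_ty Sg \<tau>) \<Xi>" by (rule realizes_tmD(2)[OF f e'])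
  show "Sg \<bar> \<Xi> \<turnstile> emb_nf \<Xi> (reify (P_ty Sg \<tau>) \<Xi> (fst f \<Xi> (fst g \<Xi> e)))
      \<approx> TSub (TSub t \<delta>) (env_sb Sg \<Gamma> \<Xi> e) \<Colon> \<tau>"
    by (rule eq_trans[OF realizes_tmD(3)[OF f e'] eq_trans[OF cong_sub[OF eq_refl[OF t] realizes_sbD(3)[OF g e]]
          eq_sym[OF eq_sub_comp[OF t d ty_env_sb[OF e]]]]])
qed

lemma realizes_comp:
  assumes d: "Sg \<bar> \<Delta> \<turnstile>\<^sub>s \<delta> \<Colon> \<Theta>" and x: "Sg \<bar> \<Gamma> \<turnstile>\<^sub>s \<xi> \<Colon> \<Delta>"
    and f: "realizes_sb Sg \<Delta> \<Theta> f \<delta>" and g: "realizes_sb Sg \<Gamma> \<Delta> g \<xi>"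
  shows "realizes_sb Sg \<Gamma> \<Theta> (gl_comp Sg \<Gamma> \<Theta> f g) (SComp \<delta> \<xi>)"
  unfolding realizes_sb_def gl_comp_def fst_conv snd_conv realizes_sbD(1)[OF f] realizes_sbD(1)[OF g]
proof (intro conjI allI ballI)
  show "c_comp Sg \<Gamma> \<Theta> (cls_sb Sg \<Delta> \<Theta> \<delta>) (cls_sb Sg \<Gamma> \<Delta> \<xi>) = cls_sb Sg \<Gamma> \<Theta> (SComp \<delta> \<xi>)"
    by (rule c_comp_cls[OF d x])
  fix \<Xi> e assume e: "e \<in> P_ctx Sg \<Gamma> \<Xi>"
  note e' = realizes_sbD(2)[OF g e]
  show "fst f \<Xi> (fst g \<Xi> e) \<in> P_ctx Sg \<Theta> \<Xi>" by (rule realizes_sbD(2)[OF f e'])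
  show "Sg \<bar> \<Xi> \<turnstile>\<^sub>s env_sb Sg \<Theta> \<Xi> (fst f \<Xi> (fst g \<Xi> e)) \<approx> SComp (SComp \<delta> \<xi>) (env_sb Sg \<Gamma> \<Xi> e) \<Colon> \<Theta>"
    by (rule eqs_trans[OF realizes_sbD(3)[OF f e'] eqs_trans[OF cong_comp[OF eqs_refl[OF d] realizes_sbD(3)[OF g e]]
          eqs_sym[OF eq_assoc[OF d x ty_env_sb[OF e]]]]])
qed

lemma realizes_ext:
  assumes d: "Sg \<bar> \<Gamma> \<turnstile>\<^sub>s \<delta> \<Colon> \<Delta>" and t: "Sg \<bar> \<Gamma> \<turnstile> t \<Colon> \<tau>"
    and f: "realizes_sb Sg \<Gamma> \<Delta> f \<delta>" and g: "realizes_tm Sg \<Gamma> \<tau> g t"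
  shows "realizes_sb Sg \<Gamma> (\<tau> # \<Delta>) (gl_ext Sg \<Gamma> \<Delta> \<tau> f g) (SExt \<delta> t)"
  unfolding realizes_sb_def gl_ext_def fst_conv snd_conv realizes_sbD(1)[OF f] realizes_tmD(1)[OF g]
proof (intro conjI allI ballI)
  show "c_ext Sg \<Gamma> \<Delta> \<tau> (cls_sb Sg \<Gamma> \<Delta> \<delta>) (cls_tm Sg \<Gamma> \<tau> t) = cls_sb Sg \<Gamma> (\<tau> # \<Delta>) (SExt \<delta> t)"
    by (rule c_ext_cls[OF d t])
  fix \<Xi> e assume e: "e \<in> P_ctx Sg \<Gamma> \<Xi>"
  show "fst g \<Xi> e # fst f \<Xi> e \<in> P_ctx Sg (\<tau> # \<Delta>) \<Xi>"
    using realizes_tmD(2)[OF g e] realizes_sbD(2)[OF f e] by (simp add: P_ctx_Cons)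
  show "Sg \<bar> \<Xi> \<turnstile>\<^sub>s env_sb Sg (\<tau> # \<Delta>) \<Xi> (fst g \<Xi> e # fst f \<Xi> e) \<approx> SComp (SExt \<delta> t) (env_sb Sg \<Gamma> \<Xi> e) \<Colon> \<tau> # \<Delta>"
    unfolding env_sb_Cons
    by (rule eqs_trans[OF cong_ext[OF realizes_sbD(3)[OF f e] realizes_tmD(3)[OF g e]]
          eqs_sym[OF eq_ext_comp[OF d t ty_env_sb[OF e]]]])
qed

lemma realizes_Cons:
  shows realizes_var: "realizes_tm Sg (\<tau> # \<Gamma>) \<tau> (gl_var Sg \<Gamma> \<tau>) TVar"
    and realizes_wk: "realizes_sb Sg (\<tau> # \<Gamma>) \<Gamma> (gl_wk Sg \<Gamma> \<tau>) SWk"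
  unfolding realizes_tm_def realizes_sb_def gl_var_def gl_wk_def
  by (auto elim!: P_ctx_ConsE simp: env_sb_Cons
      intro: eq_sym[OF eq_var_ext[OF ty_env_sb ty_reify]] eqs_sym[OF eq_wk_ext[OF ty_env_sb ty_reify]])

lemma realizes_id: "realizes_sb Sg \<Gamma> \<Gamma> (gl_id Sg \<Gamma>) SId"
  unfolding realizes_sb_def gl_id_def by (auto intro: eqs_sym[OF eq_id_left[OF ty_env_sb]])

section \<open>Operation symbols and induction on typing\<close>

lemma realizes_op:
  assumes J: "op_interpretation Sg J" and op: "Sg \<theta> = Some (\<Delta>, \<tau>)"
  shows "realizes_tm Sg \<Delta> \<tau> (J \<theta>) (TOp \<theta>)"
  unfolding realizes_tm_def
proof (intro conjI allI ballI)
  have G: "J \<theta> \<in> Gl_tm Sg \<Delta> \<tau>" and s: "snd (J \<theta>) = cls_tm Sg \<Delta> \<tau> (TOp \<theta>)"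
    using J op unfolding op_interpretation_def by auto
  show "snd (J \<theta>) = cls_tm Sg \<Delta> \<tau> (TOp \<theta>)" by (rule s)
  fix \<Xi> e assume e: "e \<in> P_ctx Sg \<Delta> \<Xi>"
  show c: "fst (J \<theta>) \<Xi> e \<in> car (P_ty Sg \<tau>) \<Xi>"
    using G e by (auto simp: Gl_tm_def)
  have "glue Sg \<tau> \<Xi> (fst (J \<theta>) \<Xi> e) = c_sub Sg \<Xi> \<tau> (snd (J \<theta>)) (glue_ctx Sg \<Delta> \<Xi> e)"
    using G e by (auto simp: Gl_tm_def)
  then show "Sg \<bar> \<Xi> \<turnstile> emb_nf \<Xi> (reify (P_ty Sg \<tau>) \<Xi> (fst (J \<theta>) \<Xi> e)) \<approx> TSub (TOp \<theta>) (env_sb Sg \<Delta> \<Xi> e) \<Colon> \<tau>"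
    unfolding s glue_ctx_env_sb c_sub_cls[OF ty_op[of Sg, OF op] ty_env_sb[OF e]] glue_def down_nf_def
      cls_tm_eq[OF ty_reify[OF c]] .
qed

lemma interp_realizes:
  assumes J: "op_interpretation Sg J"
  shows "Sg \<bar> \<Gamma> \<turnstile> t \<Colon> \<tau> \<Longrightarrow> realizes_tm Sg \<Gamma> \<tau> (interp_tm Sg J \<Gamma> t) t"
    and "Sg \<bar> \<Gamma> \<turnstile>\<^sub>s \<delta> \<Colon> \<Delta> \<Longrightarrow> realizes_sb Sg \<Gamma> \<Delta> (interp_sb Sg J \<Gamma> \<delta>) \<delta>"
proof (induction rule: tm_ty_sb_ty.inducts)
  case (ty_op \<theta> \<Delta> \<tau>)
  then show ?case by (simp add: realizes_op[OF J])
next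
  \<comment> \<open>For substitution, application, projections and composition the interpretation is
    annotated with the type or codomain of the whole expression, so its typing is rebuilt before
    \<open>typ_of\<close> or \<open>cod_of\<close> can be evaluated.\<close>
  case (ty_sub \<Delta> t \<tau> \<Gamma> \<delta>)
  then show ?case
    using typ_of_eq[OF tm_ty_sb_ty.ty_sub[OF ty_sub(1,3)]] by (simp add: cod_of_eq realizes_sub)
next
  case (ty_app \<Gamma> t \<sigma> \<tau> s)
  then show ?case
    using typ_of_eq[OF tm_ty_sb_ty.ty_app[OF ty_app(1,3)]] by (simp add: typ_of_eq realizes_app)
next
  case (ty_fst \<Gamma> t \<sigma> \<tau>)
  then show ?case
    using typ_of_eq[OF tm_ty_sb_ty.ty_fst[OF ty_fst(1)]] by (simp add: realizes_proj)
next
  case (ty_snd \<Gamma> t \<sigma> \<tau>)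
  then show ?case
    using typ_of_eq[OF tm_ty_sb_ty.ty_snd[OF ty_snd(1)]] by (simp add: realizes_proj)
next
  case (ty_comp \<Delta> \<delta> \<Xi> \<Gamma> \<xi>)
  then show ?case
    using cod_of_eq[OF tm_ty_sb_ty.ty_comp[OF ty_comp(1,3)]] by (simp add: cod_of_eq realizes_comp)
qed (simp_all add: typ_of_eq cod_of_eq realizes_var realizes_wk realizes_id realizes_lam realizes_pair realizes_ext)

section \<open>Evaluation at the reflected identity environment\<close>

theorem mainTheorem4:
  fixes Sg :: "('s, 'o) signature" and J :: "'o \<Rightarrow> ('s, 'o) gl_tm"
    and \<Gamma> :: "'s ctx" and \<tau> :: "'s ty" and t :: "('s, 'o) tm"
  assumes "op_interpretation Sg J"
    and "Sg \<bar> \<Gamma> \<turnstile> t \<Colon> \<tau>"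
  shows "Sg \<bar> \<Gamma> \<turnstile> emb_nf \<Gamma> (norm_tm Sg J \<Gamma> \<tau> (cls_tm Sg \<Gamma> \<tau> t)) \<approx> t \<Colon> \<tau>"
proof -
  \<comment> \<open>The representative that \<open>Interp_tm\<close> selects may differ from
    \<open>t\<close>; it is equal to \<open>t\<close>, hence well typed, and the argument runs with
    \<open>s\<close> until the last link.\<close>
  define s where "s = (SOME s. s \<in> cls_tm Sg \<Gamma> \<tau> t)"
  have "t \<in> cls_tm Sg \<Gamma> \<tau> t" using eq_refl[OF assms(2)] by (simp add: cls_tm_def)
  then have "s \<in> cls_tm Sg \<Gamma> \<tau> t" unfolding s_def by (rule someI)
  then have st: "Sg \<bar> \<Gamma> \<turnstile> s \<approx> t \<Colon> \<tau>" by (simp add: cls_tm_def)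
  then have s: "Sg \<bar> \<Gamma> \<turnstile> s \<Colon> \<tau>" using eq_typed(1) by blast
  have "Sg \<bar> \<Gamma> \<turnstile> emb_nf \<Gamma> (norm_tm Sg J \<Gamma> \<tau> (cls_tm Sg \<Gamma> \<tau> t))
      \<approx> TSub s (env_sb Sg \<Gamma> \<Gamma> (reflect_ctx Sg \<Gamma> \<Gamma> (ne_id \<Gamma>))) \<Colon> \<tau>"
    unfolding norm_tm_def Interp_tm_def s_def[symmetric]
    by (rule realizes_tmD(3)[OF interp_realizes(1)[OF assms(1) s] ne_id_P])
  moreover have "Sg \<bar> \<Gamma> \<turnstile> TSub s (env_sb Sg \<Gamma> \<Gamma> (reflect_ctx Sg \<Gamma> \<Gamma> (ne_id \<Gamma>))) \<approx> s \<Colon> \<tau>"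
    by (rule eq_trans[OF cong_sub[OF eq_refl[OF s] env_sb_ne_id] eq_sub_id[OF s]])
  ultimately show ?thesis using st eq_trans by blast
qed

end
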